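(* Let $(M,g)$ be a complete, spatial Ads-Schwarzschild manifold of dimension $n\ge3$ with positive mass. Let $\Sigma_0$ be the horizon in $(M,g)$ (i.e. the unique closed minimal surface in $(M,g)$). Then the following are true: (i) There exist functions $\lambda$ on $(M,g)$ satisfying $-(\Delta_g\lambda)g+\nabla^2_g\lambda-\lambda\,\mathrm{Ric}(g)=g$. (ii) Let $M_+$, $M_-$ be the two components of $M\setminus\Sigma_0$. There exist a rotationally symmetric sphere $\Sigma_\zeta$ in $M_+$ and a rotationally symmetric sphere $\Sigma_{-\zeta}$ in $M_-$, which is the image of $\Sigma_\zeta$ under the reflection with respect to $\Sigma_0$, such that if $U$ is the (closed) domain bounded by $\Sigma_\zeta$ and $\Sigma_{-\zeta}$, then for any rotationally symmetric sphere $\Sigma_{\zeta_1}$ in $M_+\setminus U$, there exists a rotationally symmetric sphere $\Sigma_{\zeta_2}$ in $M_-\setminus U$ such that $g$ is a critical metric on the (closed) domain $\Omega$ bounded by $\Sigma_{\zeta_1}$ and $\Sigma_{\zeta_2}$. (iii) Let $U$ be as in (ii). There exists a rotationally symmetric sphere $\Sigma_\theta$ in $M_+\setminus U$ (or equivalently $M_-\setminus U$) such that if $\Omega$ is the (closed) domain bounded by $\Sigma_\theta$ and $\Sigma_0$ and if $(\tilde\Omega,\tilde g)$ is the quotient manifold obtained from $(\Omega,g)$ by identifying points on $\Sigma_0$ through the antipodal map on $\Sigma_0$, then $\tilde g$ is a critical metric on $\tilde\Omega$.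
   Context: A metric $g$ on a compact manifold $\Omega$ with smooth boundary is called a critical metric if there is a (smooth) function $\lambda$ on $\Omega$, vanishing on the boundary of $\Omega$, such that $-(\Delta_g\lambda)g+\nabla_g^2\lambda-\lambda\,\mathrm{Ric}(g)=g$ on $\Omega$. The complete spatial Ads-Schwarzschild manifold with positive mass (and constant scalar curvature $R<0$) is $M=\mathbb{R}^1\times\mathbb{S}^{n-1}$ with $g=ds^2+r(s)^2h$, where $h$ is the standard round metric (sectional curvature $1$) on $\mathbb{S}^{n-1}$ and $r$ is the positive function on $\mathbb{R}^1$ with $r'(0)=0$, $r''+\frac{R}{n(n-1)}r=a r^{1-n}$ and $(r')^2+\frac{R}{n(n-1)}r^2+\frac{2a}{n-2}r^{2-n}=1$ for a constant $a>0$ (the mass parameter). Equivalently, on each side of the horizon, $g=\frac{1}{1-\frac{R}{n(n-1)}r^2-\frac{2a}{n-2}r^{2-n}}dr^2+r^2h$. The horizon is $\Sigma_0=\{0\}\times\mathbb{S}^{n-1}$; rotationally symmetric spheres are the slices $\{s\}\times\mathbb{S}^{n-1}$; the reflection with respect to $\Sigma_0$ is $(s,x)\mapsto(-s,x)$. *)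

theory Defs
  imports "HOL-Analysis.Analysis"
begin

section \<open>Smooth maps and smooth domains in Euclidean space\<close>

text \<open>On an open set \<open>W\<close> of a finite-dimensional space, \<open>C_diff k W f\<close> says that \<open>f\<close> is of
  class \<open>C\<^sup>k\<close>: the directional derivatives of order at most \<open>k\<close> exist and are continuous.\<close>

primrec C_diff ::
  "nat \<Rightarrow> 'a::euclidean_space set \<Rightarrow> ('a \<Rightarrow> 'b::real_normed_vector) \<Rightarrow> bool"
where
  "C_diff 0 W f \<longleftrightarrow> continuous_on W f"
| "C_diff (Suc k) W f \<longleftrightarrow>
     (\<forall>x\<in>W. f differentiable (at x)) \<and>
     (\<forall>v. C_diff k W (\<lambda>x. frechet_derivative f (at x) v))"

text \<open>Smoothness on an arbitrary set is, as usual, local extendability to smooth functions on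
  open sets; on a closed domain this is smoothness up to the boundary.\<close>

definition smooth_on ::
  "'a::euclidean_space set \<Rightarrow> ('a \<Rightarrow> 'b::real_normed_vector) \<Rightarrow> bool"
where
  "smooth_on D f \<longleftrightarrow>
     (\<forall>x\<in>D. \<exists>W F. open W \<and> x \<in> W \<and> (\<forall>k. C_diff k W F) \<and> (\<forall>y\<in>D \<inter> W. F y = f y))"

text \<open>A set with smooth boundary, which may contain all, some or none of its boundary points:
  near each of its points \<open>D\<close> is the superlevel set \<open>{\<rho> \<ge> 0}\<close> of a smooth function that is
  regular on \<open>{\<rho> = 0}\<close>. Near interior points take \<open>\<rho> = 1\<close>.\<close>

definition smooth_domain :: "'a::euclidean_space set \<Rightarrow> bool" where
  "smooth_domain D \<longleftrightarrow>
     (\<forall>p\<in>D. \<exists>W \<rho>. open W \<and> p \<in> W \<and> smooth_on W (\<rho> :: 'a \<Rightarrow> real) \<and>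
        (\<forall>x\<in>W. \<rho> x = 0 \<longrightarrow> frechet_derivative \<rho> (at x) \<noteq> (\<lambda>v. 0)) \<and>
        D \<inter> W = {x\<in>W. 0 \<le> \<rho> x})"

section \<open>Riemannian geometry in a coordinate domain\<close>

text \<open>The derivative is taken within \<open>D\<close>, so that all the following quantities make sense at
  boundary points of a smooth domain too (there the derivative within \<open>D\<close> is unique).\<close>

definition partial ::
  "(real^'n) set \<Rightarrow> 'n \<Rightarrow> (real^'n \<Rightarrow> real) \<Rightarrow> real^'n \<Rightarrow> real"
where
  "partial D i f x = frechet_derivative f (at x within D) (axis i 1)"

text \<open>\<open>G x\<close> is the matrix \<open>(g\<^sub>i\<^sub>j)\<close> of the metric at \<open>x\<close>; \<open>christoffel D G k i j\<close> is
  \<open>\<Gamma>\<^sup>k\<^sub>i\<^sub>j\<close>.\<close>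

definition christoffel ::
  "(real^'n) set \<Rightarrow> (real^'n \<Rightarrow> real^'n^'n) \<Rightarrow> 'n \<Rightarrow> 'n \<Rightarrow> 'n \<Rightarrow> real^'n \<Rightarrow> real"
where
  "christoffel D G k i j x =
     (\<Sum>l\<in>UNIV. matrix_inv (G x) $ k $ l *
        (partial D i (\<lambda>y. G y $ j $ l) x + partial D j (\<lambda>y. G y $ i $ l) x
          - partial D l (\<lambda>y. G y $ i $ j) x)) / 2"

definition hessian ::
  "(real^'n) set \<Rightarrow> (real^'n \<Rightarrow> real^'n^'n) \<Rightarrow> (real^'n \<Rightarrow> real) \<Rightarrow> 'n \<Rightarrow> 'n \<Rightarrow> real^'n \<Rightarrow> real"
where
  "hessian D G f i j x =
     partial D i (partial D j f) x - (\<Sum>k\<in>UNIV. christoffel D G k i j x * partial D k f x)"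

definition laplacian ::
  "(real^'n) set \<Rightarrow> (real^'n \<Rightarrow> real^'n^'n) \<Rightarrow> (real^'n \<Rightarrow> real) \<Rightarrow> real^'n \<Rightarrow> real"
where
  "laplacian D G f x =
     (\<Sum>i\<in>UNIV. \<Sum>j\<in>UNIV. matrix_inv (G x) $ i $ j * hessian D G f i j x)"

text \<open>\<open>riemann D G l k i j\<close> is the \<open>l\<close>-th component of \<open>R(\<partial>\<^sub>i, \<partial>\<^sub>j) \<partial>\<^sub>k\<close>, where
  \<open>R(X,Y)Z = \<nabla>\<^sub>X \<nabla>\<^sub>Y Z - \<nabla>\<^sub>Y \<nabla>\<^sub>X Z - \<nabla>\<^bsub>[X,Y]\<^esub> Z\<close>, and \<open>Ric(Y,Z)\<close> is the trace of
  \<open>X \<mapsto> R(X,Y)Z\<close>; with these signs round spheres have positive Ricci curvature.\<close>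

definition riemann ::
  "(real^'n) set \<Rightarrow> (real^'n \<Rightarrow> real^'n^'n) \<Rightarrow> 'n \<Rightarrow> 'n \<Rightarrow> 'n \<Rightarrow> 'n \<Rightarrow> real^'n \<Rightarrow> real"
where
  "riemann D G l k i j x =
     partial D i (christoffel D G l j k) x - partial D j (christoffel D G l i k) x
     + (\<Sum>m\<in>UNIV. christoffel D G l i m x * christoffel D G m j k x
                  - christoffel D G l j m x * christoffel D G m i k x)"

definition ricci ::
  "(real^'n) set \<Rightarrow> (real^'n \<Rightarrow> real^'n^'n) \<Rightarrow> 'n \<Rightarrow> 'n \<Rightarrow> real^'n \<Rightarrow> real"
where
  "ricci D G j k x = (\<Sum>i\<in>UNIV. riemann D G i k i j x)"

section \<open>Riemannian manifolds with boundary, given by an atlas\<close>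

text \<open>An atlas consists of local parametrisations \<open>(D, \<phi>)\<close>, with \<open>\<phi>\<close> mapping the coordinate
  domain \<open>D\<close> into the manifold. Coordinate domains are smooth domains, which is equivalent to
  the use of half-space charts at the boundary. A metric assigns to each member of the atlas the
  matrix of its coefficients.\<close>

type_synonym ('n, 'p) chart = "(real^'n) set \<times> (real^'n \<Rightarrow> 'p)"

type_synonym ('n, 'p) metric_coeffs = "('n, 'p) chart \<Rightarrow> real^'n \<Rightarrow> real^'n^'n"

definition manifold_topology :: "'p set \<Rightarrow> ('n::finite, 'p) chart set \<Rightarrow> 'p topology" where
  "manifold_topology X A =
     topology (\<lambda>U. U \<subseteq> X \<and> (\<forall>(D, \<phi>)\<in>A. openin (top_of_set D) {x\<in>D. \<phi> x \<in> U}))"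

definition overlap :: "('n::finite, 'p) chart \<Rightarrow> ('n, 'p) chart \<Rightarrow> (real^'n) set" where
  "overlap c d = {x \<in> fst c. snd c x \<in> snd d ` fst d}"

definition transition :: "('n::finite, 'p) chart \<Rightarrow> ('n, 'p) chart \<Rightarrow> real^'n \<Rightarrow> real^'n" where
  "transition c d x = inv_into (fst d) (snd d) (snd c x)"

text \<open>Second countability is not listed because it follows from compactness.\<close>

definition compact_manifold_with_boundary :: "'p set \<Rightarrow> ('n::finite, 'p) chart set \<Rightarrow> bool" where
  "compact_manifold_with_boundary X A \<longleftrightarrow>
     (\<Union>(D, \<phi>)\<in>A. \<phi> ` D) = X \<and>
     (\<forall>(D, \<phi>)\<in>A. smooth_domain D \<and> inj_on \<phi> D) \<and>
     (\<forall>c\<in>A. \<forall>d\<in>A. openin (top_of_set (fst c)) (overlap c d) \<and>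
                    smooth_on (overlap c d) (transition c d)) \<and>
     Hausdorff_space (manifold_topology X A) \<and>
     compact_space (manifold_topology X A)"

definition manifold_boundary :: "('n::finite, 'p) chart set \<Rightarrow> 'p set" where
  "manifold_boundary A = (\<Union>(D, \<phi>)\<in>A. \<phi> ` (D - interior D))"

definition riemannian_metric :: "('n::finite, 'p) chart set \<Rightarrow> ('n, 'p) metric_coeffs \<Rightarrow> bool" where
  "riemannian_metric A g \<longleftrightarrow>
     (\<forall>c\<in>A. smooth_on (fst c) (g c) \<and>
        (\<forall>x\<in>fst c. transpose (g c x) = g c x \<and> (\<forall>v. v \<noteq> 0 \<longrightarrow> 0 < v \<bullet> (g c x *v v)))) \<and>
     (\<forall>c\<in>A. \<forall>d\<in>A. \<forall>x\<in>overlap c d.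
        let T = transition c d; J = frechet_derivative T (at x within overlap c d)
        in \<forall>v w. v \<bullet> (g c x *v w) = J v \<bullet> (g d (T x) *v J w))"

definition smooth_function :: "('n::finite, 'p) chart set \<Rightarrow> ('p \<Rightarrow> real) \<Rightarrow> bool" where
  "smooth_function A f \<longleftrightarrow> (\<forall>(D, \<phi>)\<in>A. smooth_on D (f \<circ> \<phi>))"

definition critical_equation ::
  "('n::finite, 'p) chart set \<Rightarrow> ('n, 'p) metric_coeffs \<Rightarrow> ('p \<Rightarrow> real) \<Rightarrow> bool"
where
  "critical_equation A g f \<longleftrightarrow>
     (\<forall>(D, \<phi>)\<in>A. \<forall>x\<in>D. \<forall>i j.
        (let G = g (D, \<phi>) in
          - laplacian D G (f \<circ> \<phi>) x * G x $ i $ j + hessian D G (f \<circ> \<phi>) i j x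
            - f (\<phi> x) * ricci D G i j x = G x $ i $ j))"

definition critical_metric ::
  "'p set \<Rightarrow> ('n::finite, 'p) chart set \<Rightarrow> ('n, 'p) metric_coeffs \<Rightarrow> bool"
where
  "critical_metric X A g \<longleftrightarrow>
     compact_manifold_with_boundary X A \<and> riemannian_metric A g \<and>
     (\<exists>f. smooth_function A f \<and> (\<forall>p\<in>manifold_boundary A. f p = 0) \<and> critical_equation A g f)"

section \<open>The spatial AdS-Schwarzschild manifold\<close>

definition ads_schwarzschild_profile :: "nat \<Rightarrow> real \<Rightarrow> real \<Rightarrow> (real \<Rightarrow> real) \<Rightarrow> bool" where
  "ads_schwarzschild_profile n R a r \<longleftrightarrow>
     R < 0 \<and> a > 0 \<and>
     (\<forall>s. r s > 0) \<and>
     (\<forall>s. r differentiable (at s)) \<and> (\<forall>s. deriv r differentiable (at s)) \<and>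
     deriv r 0 = 0 \<and>
     (\<forall>s. deriv (deriv r) s + R / (real n * (real n - 1)) * r s = a * r s powi (1 - int n)) \<and>
     (\<forall>s. (deriv r s)\<^sup>2 + R / (real n * (real n - 1)) * (r s)\<^sup>2
            + 2 * a / (real n - 2) * r s powi (2 - int n) = 1)"

text \<open>The unit sphere lies in \<open>real^'n\<close>, so it has dimension \<open>n - 1\<close> where \<open>n = CARD('n)\<close>.\<close>

definition ads_space :: "(real \<times> (real^'n)) set" where
  "ads_space = UNIV \<times> sphere 0 1"

text \<open>The metric \<open>ds\<^sup>2 + r(s)\<^sup>2 h\<close>; the round metric \<open>h\<close> is induced by the inner product of
  \<open>real^'n\<close>, and tangent vectors at \<open>p\<close> are elements of \<open>real \<times> (real^'n)\<close>.\<close>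

definition warped_metric ::
  "(real \<Rightarrow> real) \<Rightarrow> real \<times> (real^'n) \<Rightarrow> real \<times> (real^'n) \<Rightarrow> real \<times> (real^'n) \<Rightarrow> real"
where
  "warped_metric r p v w = fst v * fst w + (r (fst p))\<^sup>2 * (snd v \<bullet> snd w)"

definition pullback_coeffs ::
  "(real \<Rightarrow> real) \<Rightarrow> (real^'n \<Rightarrow> real \<times> (real^'n)) \<Rightarrow> real^'n \<Rightarrow> real^'n^'n"
where
  "pullback_coeffs r \<psi> x =
     (\<chi> i j. warped_metric r (\<psi> x) (frechet_derivative \<psi> (at x) (axis i 1))
                                   (frechet_derivative \<psi> (at x) (axis j 1)))"

text \<open>Polar coordinates are a diffeomorphism from \<open>- {0}\<close> onto \<open>ads_space\<close>: the whole manifold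
  has a single global parametrisation. It is used for every subdomain as well.\<close>

definition polar :: "real^'n \<Rightarrow> real \<times> (real^'n)" where
  "polar x = (ln (norm x), x /\<^sub>R norm x)"

definition ads_atlas :: "(real \<times> (real^'n)) set \<Rightarrow> ('n, real \<times> (real^'n)) chart set" where
  "ads_atlas \<Omega> = {({x. x \<noteq> 0 \<and> polar x \<in> \<Omega>}, polar)}"

definition ads_metric :: "(real \<Rightarrow> real) \<Rightarrow> ('n, real \<times> (real^'n)) metric_coeffs" where
  "ads_metric r = (\<lambda>(D, \<phi>). pullback_coeffs r \<phi>)"

definition rot_sphere :: "real \<Rightarrow> (real \<times> (real^'n)) set" where
  "rot_sphere s = {s} \<times> sphere 0 1"

definition horizon :: "(real \<times> (real^'n)) set" where
  "horizon = rot_sphere 0"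

definition horizon_reflection :: "real \<times> (real^'n) \<Rightarrow> real \<times> (real^'n)" where
  "horizon_reflection p = (- fst p, snd p)"

definition closed_domain :: "real \<Rightarrow> real \<Rightarrow> (real \<times> (real^'n)) set" where
  "closed_domain s t = closed_segment s t \<times> sphere 0 1"

section \<open>The antipodal quotient at the horizon\<close>

text \<open>On the domain bounded by \<open>rot_sphere \<theta>\<close> and the horizon (\<open>\<theta>\<close> of either sign), antipodal
  points of the horizon are identified.\<close>

definition antipodal_rel :: "real \<Rightarrow> ((real \<times> (real^'n)) \<times> (real \<times> (real^'n))) set" where
  "antipodal_rel \<theta> =
     {(p, q). p \<in> closed_domain \<theta> 0 \<and> q \<in> closed_domain \<theta> 0 \<and>
        (p = q \<or> p \<in> horizon \<and> q \<in> horizon \<and> snd q = - snd p)}"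

definition quotient_space :: "real \<Rightarrow> (real \<times> (real^'n)) set set" where
  "quotient_space \<theta> = closed_domain \<theta> 0 // antipodal_rel \<theta>"

text \<open>The quotient has no boundary at the horizon: a curve that reaches the horizon at
  \<open>(0, x)\<close> continues from \<open>(0, - x)\<close>. Hence a collar of the horizon in \<open>\<Omega>\<close> is completed to a
  two-sided one by letting \<open>(s, x)\<close> beyond the horizon stand for the point
  \<open>(- s, - x)\<close> of \<open>\<Omega>\<close>. The resulting map from the closed domain between \<open>rot_sphere \<theta>\<close> and
  \<open>rot_sphere (- \<theta>)\<close> to the quotient is two-to-one; it becomes injective on the part lying over
  an open hemisphere, and this gives one local parametrisation for each unit vector \<open>e\<close>. The
  quotient metric in these coordinates is the pullback of \<open>g\<close> under the choice of
  representatives in \<open>\<Omega>\<close>.\<close>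

definition antipodal_flip :: "real \<times> (real^'n) \<Rightarrow> real \<times> (real^'n)" where
  "antipodal_flip p = (- fst p, - snd p)"

definition quotient_lift :: "real \<Rightarrow> real^'n \<Rightarrow> real^'n \<Rightarrow> real \<times> (real^'n)" where
  "quotient_lift \<theta> x = (if 0 \<le> \<theta> * ln (norm x) then polar else antipodal_flip \<circ> polar)"

definition quotient_param :: "real \<Rightarrow> real^'n \<Rightarrow> (real \<times> (real^'n)) set" where
  "quotient_param \<theta> x = antipodal_rel \<theta> `` {quotient_lift \<theta> x x}"

definition quotient_atlas :: "real \<Rightarrow> ('n, (real \<times> (real^'n)) set) chart set" where
  "quotient_atlas \<theta> =
     {({x. x \<noteq> 0 \<and> polar x \<in> closed_domain (- \<theta>) \<theta> \<and> 0 < e \<bullet> x}, quotient_param \<theta>) | e.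
        norm e = 1}"

text \<open>What is differentiated at \<open>x\<close> is the smooth map \<open>quotient_lift \<theta> x\<close> (with this \<open>x\<close>
  kept fixed), not the map \<open>y \<mapsto> quotient_lift \<theta> y y\<close>, which jumps at the
  horizon.\<close>

definition quotient_metric ::
  "real \<Rightarrow> (real \<Rightarrow> real) \<Rightarrow> ('n, (real \<times> (real^'n)) set) metric_coeffs"
where
  "quotient_metric \<theta> r = (\<lambda>c x. pullback_coeffs r (quotient_lift \<theta> x) x)"

end

theory Submission
  imports Defs
begin

text \<open>
  For a metric \<open>ds\<^sup>2 + r\<^sup>2 h\<close> and \<open>l = l(s)\<close> the critical equation reduces to two ordinary
  differential equations. The first one, \<open>(n - 1) (r'' l - r' l') = r\<close>, determines \<open>l\<close> up to
  adding a multiple of \<open>r'\<close>, and for the AdS-Schwarzschild profile it implies the second. With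
  \<open>F = r''\<close> as a function of \<open>r\<close> the solutions are
  \<open>(n - 1) l = r / F - r' (I + C)\<close>, where \<open>I\<close> is the odd antiderivative of \<open>n a r\<^bsup>1 - n\<^esup> / F\<^sup>2\<close>.

  The zeros of such a solution off the horizon form a level set of \<open>q = r / (F r') - I\<close>, which is odd
  and decreases on \<open>s > 0\<close> from infinity to a finite limit \<open>m < 0\<close>. Hence \<open>q \<zeta> = - m\<close>
  determines \<open>\<zeta>\<close>: for \<open>\<bar>s\<bar> > \<zeta>\<close> the level of \<open>s\<close> is attained on the other side, beyond
  \<open>\<zeta>\<close>. The even solution \<open>C = 0\<close> vanishes where \<open>q = 0\<close>; being invariant under
  \<open>(s, u) \<mapsto> (- s, - u)\<close>, it descends to the antipodal quotient.
\<close>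

section \<open>Calculus of smooth maps\<close>

text \<open>The threshold -m arises as follows: \<open>q\<close> maps the side s > 0 onto (m,
  infinity), hence the other side onto (-infinity, -m), so a potential has zeros on both sides
  exactly if its level lies in (m, -m). Three obstacles shape the rest. The critical equation is
  required at boundary points, where derivatives are taken within the chart domain and must first be
  shown to be unique. Curvature is defined through coefficients: on \<open>- {0}\<close> the metric,
  its Christoffel symbols and all derived tensors are combinations of Kronecker deltas and
  coordinates with radial coefficients, so contractions become algebra and no charts of the sphere
  are needed. Finally, the oddness of \<open>q\<close> and the quotient both need r to be even,
  which is not assumed but follows from uniqueness for the profile equation; then (s, u) -> (-s,
  -u), in Cartesian coordinates x -> -x/|x|^2, is an isometry and the only coordinate change besides
  the identity.\<close>

lemma C_diff_cong:
  assumes "open W" "\<And>x. x \<in> W \<Longrightarrow> f x = g x" "C_diff k W f"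
  shows "C_diff k W g"
  using assms(2,3)
proof (induction k arbitrary: f g)
  case 0
  then show ?case by (simp cong: continuous_on_cong_simp)
next
  case (Suc k)
  have der: "(g has_derivative frechet_derivative f (at x)) (at x)" if "x \<in> W" for x
  proof -
    have "(f has_derivative frechet_derivative f (at x)) (at x)"
      using Suc.prems(2) that by (simp flip: frechet_derivative_works)
    then show ?thesis
      by (rule has_derivative_transform_within_open[OF _ assms(1) that]) (use Suc.prems(1) in auto)
  qed
  then have eq: "frechet_derivative f (at x) = frechet_derivative g (at x)" if "x \<in> W" for x
    using frechet_derivative_at that by blast
  have "C_diff k W (\<lambda>x. frechet_derivative g (at x) v)" for v
    using Suc.IH[of "\<lambda>x. frechet_derivative f (at x) v"] Suc.prems(2) eq by simp
  with der show ?case by (auto simp: differentiable_def)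
qed

text \<open>Lets the derivative be given explicitly: \<open>frechet_derivative\<close> agrees with
  it on the open set \<open>W\<close>, and \<open>C_diff_cong\<close> transfers the
  regularity.\<close>

lemma C_diff_SucI:
  assumes "open W" "\<And>x. x \<in> W \<Longrightarrow> (f has_derivative f' x) (at x)"
    and "\<And>v. C_diff k W (\<lambda>x. f' x v)"
  shows "C_diff (Suc k) W f"
proof -
  have "f' x = frechet_derivative f (at x)" if "x \<in> W" for x
    using assms(2)[OF that] by (rule frechet_derivative_at)
  then have "C_diff k W (\<lambda>x. frechet_derivative f (at x) v)" for v
    by (intro C_diff_cong[OF assms(1) _ assms(3)]) simp
  then show ?thesis
    using assms(2) by (auto simp: differentiable_def)
qed

lemma C_diff_subset:
  "C_diff k W f \<Longrightarrow> V \<subseteq> W \<Longrightarrow> C_diff k V f"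
  by (induction k arbitrary: f) (auto intro: continuous_on_subset)

lemma C_diff_Suc_continuous: "C_diff (Suc k) W f \<Longrightarrow> continuous_on W f"
  by (simp add: continuous_at_imp_continuous_on differentiable_imp_continuous_within)

lemma C_diff_Suc_derivative:
  "C_diff (Suc k) W f \<Longrightarrow> x \<in> W \<Longrightarrow> (f has_derivative frechet_derivative f (at x)) (at x)"
  by (simp flip: frechet_derivative_works)

lemma C_diff_frechet_derivative:
  "C_diff (Suc k) W f \<Longrightarrow> C_diff k W (\<lambda>x. frechet_derivative f (at x) v)"
  by simp

lemma C_diff_SucD: "C_diff (Suc k) W f \<Longrightarrow> C_diff k W f"
proof (induction k arbitrary: f)
  case 0
  then show ?case unfolding C_diff.simps(1) by (rule C_diff_Suc_continuous)
next
  case (Suc k)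
  then show ?case by (metis C_diff.simps(2))
qed

lemma C_diff_const: "open W \<Longrightarrow> C_diff k W (\<lambda>x. c)"
proof (induction k arbitrary: c)
  case (Suc k)
  then show ?case by (intro C_diff_SucI[where f' = "\<lambda>x v. 0"]) (auto intro: derivative_eq_intros)
qed simp

declare C_diff.simps(2) [simp del]

lemma C_diff_bounded_linear:
  assumes "open W" "bounded_linear f" shows "C_diff k W f"
proof (cases k)
  case 0
  then show ?thesis using assms by (simp add: linear_continuous_on)
next
  case (Suc k)
  then show ?thesis
    using assms
    by (simp add: C_diff_SucI[where f' = "\<lambda>_. f"] C_diff_const bounded_linear_imp_has_derivative)
qed

lemma C_diff_add:
  assumes "open W" "C_diff k W f" "C_diff k W g"
  shows "C_diff k W (\<lambda>x. f x + g x)"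
  using assms(2,3)
proof (induction k arbitrary: f g)
  case 0
  then show ?case by (auto intro: continuous_intros)
next
  case (Suc k)
  show ?case
    by (rule C_diff_SucI[OF assms(1)
          has_derivative_add[OF C_diff_Suc_derivative[OF Suc.prems(1)] C_diff_Suc_derivative[OF Suc.prems(2)]]])
       (assumption | intro Suc.IH C_diff_frechet_derivative Suc.prems)+
qed

lemma C_diff_mult:
  fixes f g :: "'a::euclidean_space \<Rightarrow> real"
  assumes "open W" "C_diff k W f" "C_diff k W g"
  shows "C_diff k W (\<lambda>x. f x * g x)"
  using assms(2,3)
proof (induction k arbitrary: f g)
  case 0
  then show ?case by (auto intro: continuous_intros)
next
  case (Suc k)
  \<comment> \<open>The product rule leaves one factor undifferentiated, so the induction hypothesis
    also needs \<open>f\<close> and \<open>g\<close> themselves at order k.\<close>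
  note lower = C_diff_SucD[OF Suc.prems(1)] C_diff_SucD[OF Suc.prems(2)]
  show ?case
    by (rule C_diff_SucI[OF assms(1)
          has_derivative_mult[OF C_diff_Suc_derivative[OF Suc.prems(1)] C_diff_Suc_derivative[OF Suc.prems(2)]]])
       (assumption | intro C_diff_add assms(1) Suc.IH lower C_diff_frechet_derivative Suc.prems)+
qed

lemma C_diff_cmult:
  fixes f :: "'a::euclidean_space \<Rightarrow> real"
  assumes "open W" "C_diff k W f" shows "C_diff k W (\<lambda>x. c * f x)"
  using assms by (intro C_diff_mult C_diff_const)

lemma C_diff_diff:
  fixes f g :: "'a::euclidean_space \<Rightarrow> real"
  assumes "open W" "C_diff k W f" "C_diff k W g"
  shows "C_diff k W (\<lambda>x. f x - g x)"
  using C_diff_add[OF assms(1,2) C_diff_cmult[OF assms(1,3), of "-1"]] by simp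

lemma C_diff_power:
  fixes f :: "'a::euclidean_space \<Rightarrow> real"
  assumes "open W" "C_diff k W f" shows "C_diff k W (\<lambda>x. f x ^ m)"
  using assms by (induction m) (auto intro: C_diff_const C_diff_mult)

text \<open>The derivative - f' / f^2 contains 1/f again; the induction hypothesis supplies it at
  one order less, so only products remain.\<close>

lemma C_diff_inverse:
  fixes f :: "'a::euclidean_space \<Rightarrow> real"
  assumes "open W" "C_diff k W f" "\<And>x. x \<in> W \<Longrightarrow> f x \<noteq> 0"
  shows "C_diff k W (\<lambda>x. inverse (f x))"
  using assms(2)
proof (induction k)
  case 0
  then show ?case using assms(3) by (auto intro: continuous_intros)
next
  case (Suc k)
  have IH: "C_diff k W (\<lambda>x. inverse (f x))"
    using Suc C_diff_SucD by blast
  show ?case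
  proof (rule C_diff_SucI[OF assms(1)])
    fix x assume "x \<in> W"
    then show "((\<lambda>x. inverse (f x)) has_derivative
        (\<lambda>v. (-1) * (inverse (f x) * frechet_derivative f (at x) v * inverse (f x)))) (at x)"
      using C_diff_Suc_derivative[OF Suc.prems] assms(3)
      by (auto intro!: derivative_eq_intros)
  next
    show "C_diff k W (\<lambda>x. (-1) * (inverse (f x) * frechet_derivative f (at x) v * inverse (f x)))" for v
      by (intro C_diff_cmult C_diff_mult assms(1) IH C_diff_frechet_derivative Suc.prems)
  qed
qed

lemma C_diff_divide:
  fixes f :: "'a::euclidean_space \<Rightarrow> real"
  assumes "open W" "C_diff k W f" "C_diff k W g" "\<And>x. x \<in> W \<Longrightarrow> g x \<noteq> 0"
  shows "C_diff k W (\<lambda>x. f x / g x)"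
  unfolding divide_inverse using assms by (intro C_diff_mult C_diff_inverse)

text \<open>The chain rule replaces \<open>\<phi>\<close> by its derivative while \<open>f\<close>
  stays, hence the induction over arbitrary \<open>\<phi>\<close>.\<close>

lemma C_diff_compose_real:
  fixes f :: "'a::euclidean_space \<Rightarrow> real" and \<phi> :: "real \<Rightarrow> real"
  assumes "open W" "C_diff k W f" "C_diff k UNIV \<phi>"
  shows "C_diff k W (\<lambda>x. \<phi> (f x))"
  using assms(2,3)
proof (induction k arbitrary: \<phi>)
  case 0
  then show ?case by (auto intro: continuous_on_compose2[of UNIV \<phi>])
next
  case (Suc k)
  show ?case
  proof (rule C_diff_SucI[OF assms(1)])
    fix x assume x: "x \<in> W"
    have *: "(\<phi> has_derivative frechet_derivative \<phi> (at (f x))) (at (f x))"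
      using Suc.prems(2) by (rule C_diff_Suc_derivative) simp
    interpret linear "frechet_derivative \<phi> (at (f x))"
      using * by (rule has_derivative_linear)
    define c where "c = frechet_derivative \<phi> (at (f x)) 1"
    have "frechet_derivative \<phi> (at (f x)) = (\<lambda>v. v * c)"
      unfolding c_def using scaleR[of _ 1] unfolding real_scaleR_def mult_1_right by (rule ext)
    with * have "(\<phi> has_derivative (\<lambda>v. v * c)) (at (f x))" by simp
    from has_derivative_compose[OF C_diff_Suc_derivative[OF Suc.prems(1) x] this]
    show "((\<lambda>x. \<phi> (f x)) has_derivative
        (\<lambda>v. frechet_derivative f (at x) v * frechet_derivative \<phi> (at (f x)) 1)) (at x)"
      unfolding c_def .
  next
    show "C_diff k W (\<lambda>x. frechet_derivative f (at x) v * frechet_derivative \<phi> (at (f x)) 1)" for v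
      by (rule C_diff_mult[OF assms(1) C_diff_frechet_derivative[OF Suc.prems(1)]
            Suc.IH[OF C_diff_SucD[OF Suc.prems(1)] C_diff_frechet_derivative[OF Suc.prems(2)]]])
  qed
qed

text \<open>The product and quotient rules are for real functions; vector and matrix valued maps are
  reduced to them through their coordinates.\<close>

lemma C_diff_componentwise:
  fixes f :: "'a::euclidean_space \<Rightarrow> 'b::euclidean_space"
  assumes "open W" "\<And>b. b \<in> Basis \<Longrightarrow> C_diff k W (\<lambda>x. f x \<bullet> b)"
  shows "C_diff k W f"
  using assms(2)
proof (induction k arbitrary: f)
  case 0
  then show ?case using continuous_on_componentwise[of W f] by simp
next
  case (Suc k)
  have diff: "f differentiable (at x)" if "x \<in> W" for x
    using Suc.prems that unfolding differentiable_componentwise_within[of f] C_diff.simps(2) by blast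
  have "frechet_derivative (\<lambda>x. f x \<bullet> b) (at x) v = frechet_derivative f (at x) v \<bullet> b"
    if "x \<in> W" for x v b
  proof -
    have "(f has_derivative frechet_derivative f (at x)) (at x)"
      using diff[OF that] by (simp add: frechet_derivative_works)
    from has_derivative_inner_left[OF this, of b] show ?thesis
      using frechet_derivative_at by metis
  qed
  note eq = this
  have "C_diff k W (\<lambda>x. frechet_derivative f (at x) v \<bullet> b)" if "b \<in> Basis" for v b
    by (rule C_diff_cong[OF assms(1) _ C_diff_frechet_derivative[OF Suc.prems[OF that]]]) (rule eq)
  then have "C_diff k W (\<lambda>x. frechet_derivative f (at x) v)" for v
    by (rule Suc.IH)
  then show ?case unfolding C_diff.simps(2) using diff by blast
qed

lemma C_diff_vec:
  fixes f :: "'a::euclidean_space \<Rightarrow> real^'n"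
  assumes "open W" "\<And>i. C_diff k W (\<lambda>x. f x $ i)"
  shows "C_diff k W f"
  by (rule C_diff_componentwise[OF assms(1)]) (auto simp: Basis_vec_def inner_axis assms(2))

lemma C_diff_matrix:
  fixes f :: "'a::euclidean_space \<Rightarrow> real^'n^'m"
  assumes "open W" "\<And>i j. C_diff k W (\<lambda>x. f x $ i $ j)"
  shows "C_diff k W f"
  by (rule C_diff_componentwise[OF assms(1)]) (auto simp: Basis_vec_def inner_axis assms(2))

lemma C_diff_component: "open W \<Longrightarrow> C_diff k W (\<lambda>x::real^'n. x $ i)"
  by (intro C_diff_bounded_linear bounded_linear_vec_nth)

lemma C_diff_inner_self:
  assumes "open W" shows "C_diff k W (\<lambda>x::'a::euclidean_space. x \<bullet> x)"
proof (cases k)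
  case 0
  then show ?thesis by (auto intro: continuous_intros)
next
  case (Suc k)
  have "C_diff (Suc k) W (\<lambda>x::'a. x \<bullet> x)"
    by (rule C_diff_SucI[OF assms, where f' = "\<lambda>x v. 2 * (x \<bullet> v)"])
       (auto intro!: derivative_eq_intros C_diff_bounded_linear[OF assms] bounded_linear_inner_right
           bounded_linear_const_mult simp: inner_commute[of _ "_::'a"])
  with Suc show ?thesis by simp
qed

lemma has_derivative_ln_norm:
  fixes x :: "'a::euclidean_space"
  assumes "x \<noteq> 0"
  shows "((\<lambda>x. ln (norm x)) has_derivative (\<lambda>v. (x \<bullet> v) / (x \<bullet> x))) (at x)"
proof -
  \<comment> \<open>Half the logarithm of the squared norm avoids differentiating the norm
    itself.\<close>
  have "((\<lambda>x::'a. ln (x \<bullet> x) / 2) has_derivative (\<lambda>v. (x \<bullet> v) / (x \<bullet> x))) (at x)"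
    using assms by (auto intro!: derivative_eq_intros simp: inner_commute field_simps)
  moreover have "ln (y \<bullet> y) / 2 = ln (norm y)" for y :: 'a
    by (simp add: norm_eq_sqrt_inner ln_sqrt)
  ultimately show ?thesis by simp
qed

lemma C_diff_ln_norm: "C_diff k (- {0}) (\<lambda>x::'a::euclidean_space. ln (norm x))"
proof (cases k)
  case 0
  then show ?thesis by (auto intro!: continuous_intros)
next
  case (Suc k)
  have o: "open (- {0::'a})" by auto
  have "C_diff (Suc k) (- {0}) (\<lambda>x::'a. ln (norm x))"
  proof (rule C_diff_SucI[OF o has_derivative_ln_norm])
    show "C_diff k (- {0}) (\<lambda>x. x \<bullet> v / (x \<bullet> x))" for v :: 'a
      by (rule C_diff_divide[OF o C_diff_bounded_linear[OF o bounded_linear_inner_left] C_diff_inner_self[OF o]]) simp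
  qed simp
  with Suc show ?thesis by simp
qed

lemma smooth_onI:
  assumes "open W" "D \<subseteq> W" "\<And>k. C_diff k W F" "\<And>x. x \<in> D \<Longrightarrow> F x = f x"
  shows "smooth_on D f"
  unfolding smooth_on_def using assms by (intro ballI exI[of _ W] exI[of _ F]) auto

section \<open>Derivatives within shells\<close>

text \<open>At the boundary of a shell no small step along a tangential axis stays in the shell, in either
  direction. It suffices for the uniqueness of the derivative that small steps
  in all directions of an open half-space stay in the set.\<close>

definition cone_at :: "'a::real_inner set \<Rightarrow> 'a \<Rightarrow> bool" where
  "cone_at D x \<longleftrightarrow> x \<in> D \<and>
     (\<exists>w. w \<noteq> 0 \<and> (\<forall>v. 0 < v \<bullet> w \<longrightarrow> eventually (\<lambda>t. x + t *\<^sub>R v \<in> D) (at_right 0)))"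

text \<open>For v in the open half-space the segment t -> x + t v stays in D for small t > 0, so
  \<open>f1 v\<close> and \<open>f2 v\<close> are the same one-sided derivative; and an open
  half-space spans.\<close>

lemma has_derivative_unique_cone:
  fixes f :: "'a::euclidean_space \<Rightarrow> 'b::real_normed_vector"
  assumes c: "cone_at D x"
    and f1: "(f has_derivative f1) (at x within D)" and f2: "(f has_derivative f2) (at x within D)"
  shows "f1 = f2"
proof -
  from c obtain w where w: "w \<noteq> 0"
    "\<And>v. 0 < v \<bullet> w \<Longrightarrow> eventually (\<lambda>t. x + t *\<^sub>R v \<in> D) (at_right 0)" and x: "x \<in> D"
    by (auto simp: cone_at_def)
  interpret l1: linear f1 using f1 by (rule has_derivative_linear)
  interpret l2: linear f2 using f2 by (rule has_derivative_linear)
  have pos: "f1 v = f2 v" if v: "0 < v \<bullet> w" for v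
  proof -
    obtain d where d: "d > 0" "\<And>t. 0 < t \<Longrightarrow> t < d \<Longrightarrow> x + t *\<^sub>R v \<in> D"
      using w(2)[OF v] unfolding eventually_at_right_field by auto
    let ?g = "\<lambda>t::real. x + t *\<^sub>R v"
    have sub: "?g ` {0..<d} \<subseteq> D"
      using d(2) x by (force simp: le_less)
    have g: "(?g has_derivative (\<lambda>t. t *\<^sub>R v)) (at 0 within {0..<d})"
      by (auto intro!: derivative_eq_intros)
    have "((\<lambda>t. f (?g t)) has_derivative (\<lambda>t. f' (t *\<^sub>R v))) (at 0 within {0..<d})"
      if "(f has_derivative f') (at x within D)" for f'
      using has_derivative_in_compose[OF g, of f f'] has_derivative_subset[OF that sub] by simp
    from this[OF f1] this[OF f2]
    have "((\<lambda>t. f (?g t)) has_vector_derivative f1 v) (at 0 within {0..<d})"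
      "((\<lambda>t. f (?g t)) has_vector_derivative f2 v) (at 0 within {0..<d})"
      by (simp_all add: has_vector_derivative_def l1.scaleR l2.scaleR)
    moreover have "at 0 within {0..<d} \<noteq> bot"
      using d(1) by (auto simp: trivial_limit_within islimpt_Ico)
    ultimately show ?thesis by (rule vector_derivative_unique_within[rotated])
  qed
  show ?thesis
  proof
    fix v
    \<comment> \<open>v is the difference of v + c w and c w; this c makes the inner product of each
      with w positive.\<close>
    define c where "c = (1 + \<bar>v \<bullet> w\<bar>) / (w \<bullet> w)"
    have ww: "0 < w \<bullet> w" using w(1) by simp
    have cw: "c * (w \<bullet> w) = 1 + \<bar>v \<bullet> w\<bar>" unfolding c_def using ww by simp
    have 1: "0 < (v + c *\<^sub>R w) \<bullet> w" "0 < (c *\<^sub>R w) \<bullet> w"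
      using cw by (auto simp: inner_add_left)
    show "f1 v = f2 v"
      using pos[OF 1(1)] pos[OF 1(2)] by (simp add: l1.add l2.add)
  qed
qed

text \<open>Values off D do not matter: f may be replaced by any F that agrees with it on D near x,
  and F is differentiated in the full space. Derivatives within a chart domain are evaluated in this
  way.\<close>

lemma frechet_derivative_cone:
  fixes f F :: "'a::euclidean_space \<Rightarrow> 'b::real_normed_vector"
  assumes c: "cone_at D x" and N: "open N" "x \<in> N" "\<And>y. y \<in> D \<inter> N \<Longrightarrow> f y = F y"
    and F: "(F has_derivative F') (at x)"
  shows "frechet_derivative f (at x within D) = F'"
proof -
  have x: "x \<in> D" using c by (simp add: cone_at_def)
  from N obtain d where d: "d > 0" "ball x d \<subseteq> N" using open_contains_ball by blast
  have "(f has_derivative F') (at x within D)"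
    using has_derivative_at_withinI[OF F] d(1) x
    by (rule has_derivative_transform_within) (use N(3) d(2) in \<open>force simp: dist_commute\<close>)
  moreover from this have "(f has_derivative frechet_derivative f (at x within D)) (at x within D)"
    by (auto simp: frechet_derivative_works[symmetric] differentiable_def)
  ultimately show ?thesis using has_derivative_unique_cone[OF c] by blast
qed

lemma cone_at_open:
  fixes x :: "'a::euclidean_space"
  assumes "open D" "x \<in> D" shows "cone_at D x"
proof -
  obtain w :: 'a where "w \<noteq> 0" using nonempty_Basis nonzero_Basis by blast
  moreover have "eventually (\<lambda>t. x + t *\<^sub>R v \<in> D) (at_right 0)" for v
  proof -
    have "((\<lambda>t::real. x + t *\<^sub>R v) \<longlongrightarrow> x + 0 *\<^sub>R v) (at_right 0)"
      by (intro tendsto_intros)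
    then show ?thesis
      using topological_tendstoD[of _ _ _ D] assms by auto
  qed
  ultimately show ?thesis using assms(2) by (auto simp: cone_at_def)
qed

text \<open>Bounding \<open>x \<bullet> x\<close> instead of the norm makes the boundary the zero
  set of a polynomial.\<close>

definition shell :: "real \<Rightarrow> real \<Rightarrow> 'a::real_inner set" where
  "shell A B = {x. A \<le> x \<bullet> x \<and> x \<bullet> x \<le> B}"

text \<open>Since |x + t v|^2 = |x|^2 + t (2 (v \<bullet> x) + t |v|^2), the sign of v \<bullet> x
  decides about small steps: w = x serves inside the outer sphere, and w = - x on it, where A < B
  keeps the inner sphere away.\<close>

lemma cone_at_shell:
  fixes x :: "'a::euclidean_space"
  assumes H: "open H" and AB: "0 < A" "A < B" and x: "x \<in> shell A B \<inter> H"
  shows "cone_at (shell A B \<inter> H) x"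
proof -
  have x0: "x \<bullet> x > 0" using x AB by (auto simp: shell_def)
  have lim: "((\<lambda>t::real. x + t *\<^sub>R v) \<longlongrightarrow> x + 0 *\<^sub>R v) (at_right 0)" for v
    by (intro tendsto_intros)
  then have lim2: "((\<lambda>t::real. (x + t *\<^sub>R v) \<bullet> (x + t *\<^sub>R v)) \<longlongrightarrow> x \<bullet> x) (at_right 0)" for v
    using tendsto_inner[OF lim lim] by simp
  have evH: "eventually (\<lambda>t. x + t *\<^sub>R v \<in> H) (at_right 0)" for v
    using topological_tendstoD[OF lim[of v], of H] H x by auto
  have exp: "(x + t *\<^sub>R v) \<bullet> (x + t *\<^sub>R v) = x \<bullet> x + t * (2 * (v \<bullet> x) + t * (v \<bullet> v))" for t v
    by (simp add: inner_add_left inner_add_right inner_commute algebra_simps)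
  have lin: "((\<lambda>t::real. 2 * (v \<bullet> x) + t * (v \<bullet> v)) \<longlongrightarrow> 2 * (v \<bullet> x) + 0 * (v \<bullet> v)) (at_right 0)" for v
    by (intro tendsto_intros)
  have pos: "eventually (\<lambda>t. 0 < (t::real)) (at_right 0)"
    by (auto simp: eventually_at_right_field intro: exI[of _ 1])
  show ?thesis
  proof (cases "x \<bullet> x < B")
    case True
    have "eventually (\<lambda>t. x + t *\<^sub>R v \<in> shell A B \<inter> H) (at_right 0)" if v: "0 < v \<bullet> x" for v
    proof -
      have "eventually (\<lambda>t::real. 0 < 2 * (v \<bullet> x) + t * (v \<bullet> v)) (at_right 0)"
        using order_tendstoD(1)[OF lin[of v], of 0] v by simp
      with pos order_tendstoD(2)[OF lim2 True, of v] evH[of v] show ?thesis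
      proof eventually_elim
        case (elim t)
        then show ?case using x by (auto simp: shell_def exp intro: add_increasing2)
      qed
    qed
    then show ?thesis using x x0 unfolding cone_at_def by (intro conjI exI[of _ x]) auto
  next
    case False
    then have B: "x \<bullet> x = B" using x by (auto simp: shell_def)
    then have A: "A < x \<bullet> x" using AB by simp
    have "eventually (\<lambda>t. x + t *\<^sub>R v \<in> shell A B \<inter> H) (at_right 0)" if v: "0 < v \<bullet> - x" for v
    proof -
      have "eventually (\<lambda>t::real. 2 * (v \<bullet> x) + t * (v \<bullet> v) < 0) (at_right 0)"
        using order_tendstoD(2)[OF lin[of v], of 0] v by simp
      with pos order_tendstoD(1)[OF lim2 A, of v] evH[of v] show ?thesis
      proof eventually_elim
        case (elim t)
        then show ?case using B by (auto simp: shell_def exp mult_le_0_iff)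
      qed
    qed
    then show ?thesis using x x0 unfolding cone_at_def by (intro conjI exI[of _ "- x"]) auto
  qed
qed

text \<open>One defining function handles both spheres: as A < B, the factors x \<bullet> x - A and
  B - x \<bullet> x are never both negative.\<close>

lemma smooth_domain_shell:
  fixes H :: "'a::euclidean_space set"
  assumes H: "open H" and AB: "0 < A" "A < B"
  shows "smooth_domain (shell A B \<inter> H)"
  unfolding smooth_domain_def
proof
  fix p assume p: "p \<in> shell A B \<inter> H"
  define \<rho> :: "'a \<Rightarrow> real" where "\<rho> = (\<lambda>x. (x \<bullet> x - A) * (B - x \<bullet> x))"
  have D: "(\<rho> has_derivative (\<lambda>v. 2 * (x \<bullet> v) * (A + B - 2 * (x \<bullet> x)))) (at x)" for x
    unfolding \<rho>_def by (auto intro!: derivative_eq_intros simp: inner_commute algebra_simps)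
  have "smooth_on H \<rho>"
    by (rule smooth_onI[OF H order_refl])
       (auto simp: \<rho>_def intro!: C_diff_mult C_diff_diff H C_diff_inner_self C_diff_const)
  moreover have "(shell A B \<inter> H) \<inter> H = {x \<in> H. 0 \<le> \<rho> x}"
    using AB by (auto simp: shell_def \<rho>_def zero_le_mult_iff)
  moreover have "\<forall>x\<in>H. \<rho> x = 0 \<longrightarrow> frechet_derivative \<rho> (at x) \<noteq> (\<lambda>v. 0)"
  proof (intro ballI impI)
    fix x assume "\<rho> x = 0"
    then have "x \<bullet> x = A \<or> x \<bullet> x = B" by (auto simp: \<rho>_def)
    \<comment> \<open>The derivative of \<open>\<rho>\<close> in the direction x itself; on either
      sphere it is 2 (x \<bullet> x) (B - A) up to sign.\<close>
    then have "2 * (x \<bullet> x) * (A + B - 2 * (x \<bullet> x)) \<noteq> 0" using AB by auto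
    then show "frechet_derivative \<rho> (at x) \<noteq> (\<lambda>v. 0)"
      using frechet_derivative_at[OF D[of x]] by metis
  qed
  ultimately show "\<exists>W \<rho>. open W \<and> p \<in> W \<and> smooth_on W (\<rho> :: 'a \<Rightarrow> real) \<and>
      (\<forall>x\<in>W. \<rho> x = 0 \<longrightarrow> frechet_derivative \<rho> (at x) \<noteq> (\<lambda>v. 0)) \<and>
      (shell A B \<inter> H) \<inter> W = {x\<in>W. 0 \<le> \<rho> x}"
    using H p by (intro exI[of _ H] exI[of _ \<rho>]) auto
qed

lemma compact_shell: "compact (shell A B :: 'a::euclidean_space set)"
  unfolding compact_eq_bounded_closed
proof
  show "bounded (shell A B :: 'a set)"
    by (auto simp: bounded_iff shell_def norm_eq_sqrt_inner intro!: exI[of _ "sqrt B"])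
  show "closed (shell A B :: 'a set)"
    unfolding shell_def by (intro closed_Collect_conj closed_Collect_le continuous_intros)
qed

lemma shell_interior:
  fixes x :: "'a::euclidean_space"
  assumes "open H" "x \<in> H" "A < x \<bullet> x" "x \<bullet> x < B"
  shows "x \<in> interior (shell A B \<inter> H)"
proof (rule interiorI)
  show "open ({x::'a. A < x \<bullet> x} \<inter> {x. x \<bullet> x < B} \<inter> H)"
    by (intro open_Int open_Collect_less continuous_intros assms)
qed (use assms in \<open>auto simp: shell_def\<close>)

section \<open>Rotationally symmetric metrics in polar coordinates\<close>

definition kron :: "'n \<Rightarrow> 'n \<Rightarrow> real" where
  "kron i j = (if i = j then 1 else 0)"

lemma kron_sym: "kron i j = kron j i"
  and kron_self [simp]: "kron i i = 1"
  by (auto simp: kron_def)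

lemma axis_nth: "axis i 1 $ j = kron i j"
  by (auto simp: axis_def kron_def)

lemma sum_kron:
  fixes f :: "'n::finite \<Rightarrow> real"
  shows "(\<Sum>i\<in>UNIV. kron i j * f i) = f j" "(\<Sum>i\<in>UNIV. kron j i * f i) = f j"
    "(\<Sum>i\<in>UNIV. f i * kron i j) = f j" "(\<Sum>i\<in>UNIV. f i * kron j i) = f j"
    "(\<Sum>i\<in>UNIV. kron i j) = 1" "(\<Sum>i\<in>UNIV. kron j i) = 1"
  by (simp_all add: kron_def if_distrib[of "\<lambda>z. z * _"] if_distrib[of "\<lambda>z. _ * z"] cong: if_cong)

lemma sum_square_components: "(\<Sum>i\<in>UNIV. x $ i * x $ i) = x \<bullet> (x :: real^'n)"
  by (simp add: inner_vec_def)

text \<open>\<open>matrix_inv\<close> is a choice of a two-sided inverse; for square matrices a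
  right inverse is two-sided, and inverses are unique.\<close>

lemma matrix_inv_eqI:
  fixes A B :: "real^'n^'n"
  assumes "A ** B = mat 1" shows "matrix_inv A = B"
proof -
  have "B ** A = mat 1" using assms matrix_left_right_inverse by blast
  with assms have "\<exists>A'. A ** A' = mat 1 \<and> A' ** A = mat 1" by blast
  then have "A ** matrix_inv A = mat 1 \<and> matrix_inv A ** A = mat 1"
    unfolding matrix_inv_def by (rule someI_ex)
  then have "matrix_inv A ** A = mat 1" by blast
  moreover have "matrix_inv A ** (A ** B) = (matrix_inv A ** A) ** B"
    by (rule matrix_mul_assoc)
  ultimately show ?thesis using assms by (simp add: matrix_mul_lid matrix_mul_rid)
qed

text \<open>The matrices a I + b x x^T form an algebra because (x x^T)^2 = (x \<bullet> x) x
  x^T.\<close>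

lemma kron_linear_mult:
  fixes x :: "real^'n"
  shows "(\<chi> i j. a * kron i j + b * (x $ i * x $ j)) ** (\<chi> i j. c * kron i j + d * (x $ i * x $ j)) =
     (\<chi> i j. a * c * kron i j + (a * d + b * c + b * d * (x \<bullet> x)) * (x $ i * x $ j))"
proof -
  have "(\<Sum>k\<in>UNIV. (a * kron i k + b * (x $ i * x $ k)) * (c * kron k j + d * (x $ k * x $ j))) =
     a * (c * kron i j + d * (x $ i * x $ j)) + b * x $ i * (c * x $ j + d * x $ j * (x \<bullet> x))" for i j
  proof -
    have "(\<Sum>k\<in>UNIV. (a * kron i k + b * (x $ i * x $ k)) * (c * kron k j + d * (x $ k * x $ j))) =
      (\<Sum>k\<in>UNIV. kron i k * (a * (c * kron k j + d * (x $ k * x $ j)))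
        + (b * c * x $ i) * (x $ k * kron k j) + (b * d * x $ i * x $ j) * (x $ k * x $ k))"
      by (intro sum.cong) (auto simp: algebra_simps)
    then show ?thesis
      by (simp only: sum.distrib sum_kron sum_square_components sum_distrib_left[symmetric]) (simp add: algebra_simps)
  qed
  then show ?thesis
    by (simp add: matrix_matrix_mult_def vec_eq_iff algebra_simps)
qed

text \<open>With s = ln |x| one has ds^2 = (x \<bullet> dx)^2 / |x|^4 and h = |dx|^2 / |x|^2 - (x
  \<bullet> dx)^2 / |x|^4; this is ds^2 + r^2 h with the terms collected.\<close>

definition polar_metric :: "(real \<Rightarrow> real) \<Rightarrow> real^'n \<Rightarrow> real^'n^'n" where
  "polar_metric r x = (\<chi> i j. (r (ln (norm x)))\<^sup>2 / (x \<bullet> x) * kron i j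
     + (1 - (r (ln (norm x)))\<^sup>2) / (x \<bullet> x)\<^sup>2 * (x $ i * x $ j))"

text \<open>The eigenvalues are 1 / (x \<bullet> x) along x and r^2 / (x \<bullet> x) across it;
  inverting them fixes both coefficients.\<close>

lemma matrix_inv_polar_metric:
  fixes x :: "real^'n"
  assumes "x \<noteq> 0" "r (ln (norm x)) \<noteq> 0"
  shows "matrix_inv (polar_metric r x) =
    (\<chi> i j. (x \<bullet> x) / (r (ln (norm x)))\<^sup>2 * kron i j + (1 - 1 / (r (ln (norm x)))\<^sup>2) * (x $ i * x $ j))"
proof (rule matrix_inv_eqI)
  have "x \<bullet> x \<noteq> 0" using assms by simp
  then have "\<rho>\<^sup>2 / (x \<bullet> x) * ((x \<bullet> x) / \<rho>\<^sup>2) = 1"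
    "\<rho>\<^sup>2 / (x \<bullet> x) * (1 - 1 / \<rho>\<^sup>2) + (1 - \<rho>\<^sup>2) / (x \<bullet> x)\<^sup>2 * ((x \<bullet> x) / \<rho>\<^sup>2)
      + (1 - \<rho>\<^sup>2) / (x \<bullet> x)\<^sup>2 * (1 - 1 / \<rho>\<^sup>2) * (x \<bullet> x) = 0" if "\<rho> \<noteq> 0" for \<rho>
    using that by (simp_all add: field_simps power2_eq_square)
  from this[OF assms(2)] show "polar_metric r x ** (\<chi> i j. (x \<bullet> x) / (r (ln (norm x)))\<^sup>2 * kron i j + (1 - 1 / (r (ln (norm x)))\<^sup>2) * (x $ i * x $ j)) = mat 1"
    unfolding polar_metric_def kron_linear_mult by (simp add: vec_eq_iff mat_def kron_def)
qed

lemma has_derivative_radial: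
  fixes x :: "real^'n"
  assumes "x \<noteq> 0" "(f has_real_derivative f') (at (ln (norm x)))"
  shows "((\<lambda>x. f (ln (norm x))) has_derivative (\<lambda>v. f' * ((x \<bullet> v) / (x \<bullet> x)))) (at x)"
  using has_derivative_compose[OF has_derivative_ln_norm[OF assms(1)] assms(2)[unfolded has_field_derivative_def]] .

lemma has_derivative_inner_self_power:
  fixes x :: "real^'n"
  assumes "x \<noteq> 0"
  shows "((\<lambda>x. 1 / (x \<bullet> x) ^ m) has_derivative (\<lambda>v. - 2 * real m * (x \<bullet> v) / (x \<bullet> x) ^ Suc m)) (at x)"
proof -
  have "((\<lambda>x. 1 / (x \<bullet> x)) has_derivative (\<lambda>v. - 2 * (x \<bullet> v) / (x \<bullet> x)\<^sup>2)) (at x)"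
    using assms by (auto intro!: derivative_eq_intros simp: inner_commute field_simps power2_eq_square)
  from has_derivative_power[OF this, of m]
  have "((\<lambda>x. 1 / (x \<bullet> x) ^ m) has_derivative
      (\<lambda>v. real m * (- 2 * (x \<bullet> v) / (x \<bullet> x)\<^sup>2) * (1 / (x \<bullet> x)) ^ (m - 1))) (at x)"
    by (simp only: power_one_over)
  then show ?thesis using assms
    by (elim has_derivative_eq_rhs, intro ext) (cases m; simp add: power_one_over field_simps power2_eq_square)
qed

text \<open>All coefficients below have the form f(ln |x|) / (x \<bullet> x)^m. The gradient is
  again such a coefficient times x: m grows by one and f becomes f' - 2 m f.\<close>

lemma has_derivative_radial_power:
  fixes x :: "real^'n"
  assumes "x \<noteq> 0" "(f has_real_derivative f') (at (ln (norm x)))"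
  shows "((\<lambda>x. f (ln (norm x)) / (x \<bullet> x) ^ m) has_derivative
     (\<lambda>v. (f' - 2 * real m * f (ln (norm x))) / (x \<bullet> x) ^ Suc m * (x \<bullet> v))) (at x)"
proof -
  have "x \<bullet> x \<noteq> 0" using assms by simp
  with has_derivative_mult[OF has_derivative_radial[OF assms] has_derivative_inner_self_power[OF assms(1), of m]]
  show ?thesis by (simp add: field_simps)
qed

definition sym_tensor :: "(real^'n \<Rightarrow> real) \<Rightarrow> (real^'n \<Rightarrow> real) \<Rightarrow> 'n \<Rightarrow> 'n \<Rightarrow> real^'n \<Rightarrow> real" where
  "sym_tensor a b i j x = a x * kron i j + b x * (x $ i * x $ j)"

lemma has_derivative_sym_tensor:
  fixes x :: "real^'n"
  assumes "(a has_derivative (\<lambda>v. a' * (x \<bullet> v))) (at x)" "(b has_derivative (\<lambda>v. b' * (x \<bullet> v))) (at x)"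
  shows "(sym_tensor a b i j has_derivative
     (\<lambda>v. a' * (x \<bullet> v) * kron i j + b' * (x \<bullet> v) * (x $ i * x $ j) + b x * (v $ i * x $ j + x $ i * v $ j))) (at x)"
  unfolding sym_tensor_def using assms
  by (auto intro!: derivative_eq_intros bounded_linear_imp_has_derivative bounded_linear_vec_nth simp: algebra_simps)

text \<open>The ansatz for the Christoffel symbols, with upper index k: the terms that deltas and x
  allow. Symmetry in i and j forces a single coefficient \<open>p\<close> for the two mixed
  terms.\<close>

definition sym_christoffel ::
  "(real^'n \<Rightarrow> real) \<Rightarrow> (real^'n \<Rightarrow> real) \<Rightarrow> (real^'n \<Rightarrow> real) \<Rightarrow> 'n \<Rightarrow> 'n \<Rightarrow> 'n \<Rightarrow> real^'n \<Rightarrow> real" where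
  "sym_christoffel p q w k i j x =
     p x * (x $ i * kron j k + x $ j * kron i k) + q x * (kron i j * x $ k) + w x * (x $ i * x $ j * x $ k)"

lemma has_derivative_sym_christoffel:
  fixes x :: "real^'n"
  assumes "(p has_derivative (\<lambda>v. p' * (x \<bullet> v))) (at x)" "(q has_derivative (\<lambda>v. q' * (x \<bullet> v))) (at x)"
    "(w has_derivative (\<lambda>v. w' * (x \<bullet> v))) (at x)"
  shows "(sym_christoffel p q w k i j has_derivative
     (\<lambda>v. p' * (x \<bullet> v) * (x $ i * kron j k + x $ j * kron i k) + p x * (v $ i * kron j k + v $ j * kron i k)
        + q' * (x \<bullet> v) * (kron i j * x $ k) + q x * (kron i j * v $ k)
        + w' * (x \<bullet> v) * (x $ i * x $ j * x $ k)
        + w x * (v $ i * x $ j * x $ k + x $ i * v $ j * x $ k + x $ i * x $ j * v $ k))) (at x)"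
  unfolding sym_christoffel_def using assms
  by (auto intro!: derivative_eq_intros bounded_linear_imp_has_derivative bounded_linear_vec_nth simp: algebra_simps)

text \<open>The algebraic core of the Ricci tensor: \<open>d\<Gamma> m\<close> stands for the
  derivative in direction m when the gradients of p, q, w are p' x, q' x, w' x. Once each summand is
  sorted by its delta, only sums against a delta and the sum of squares N occur.\<close>

lemma ricci_contraction:
  fixes x :: "real^'n" and p q w p' q' w' :: real
  defines "\<Gamma> \<equiv> \<lambda>k i j. p * (x $ i * kron j k + x $ j * kron i k) + q * (kron i j * x $ k) + w * (x $ i * x $ j * x $ k)"
    and "d\<Gamma> \<equiv> \<lambda>m k i j. p' * x $ m * (x $ i * kron j k + x $ j * kron i k) + p * (kron m i * kron j k + kron m j * kron i k)
        + q' * x $ m * (kron i j * x $ k) + q * (kron i j * kron m k)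
        + w' * x $ m * (x $ i * x $ j * x $ k)
        + w * (kron m i * x $ j * x $ k + x $ i * kron m j * x $ k + x $ i * x $ j * kron m k)"
    and "n \<equiv> real CARD('n)" and "N \<equiv> x \<bullet> x"
  shows "(\<Sum>i\<in>UNIV. d\<Gamma> i i j k - d\<Gamma> j i i k + (\<Sum>m\<in>UNIV. \<Gamma> i i m * \<Gamma> m j k - \<Gamma> i j m * \<Gamma> m i k)) =
     (2 * p + q' * N + n * q - ((n + 1) * p + q + w * N) + ((n + 1) * p + q + w * N) * q * N - 2 * p * q * N) * kron j k
   + (2 * p' + w' * N + (n + 2) * w - ((n + 1) * p' + q' + w' * N + 2 * w) + ((n + 1) * p + q + w * N) * (2 * p + w * N)
       - ((n + 3) * p\<^sup>2 + 2 * p * q + 4 * p * w * N + q\<^sup>2 + 2 * q * w * N + w\<^sup>2 * N\<^sup>2)) * (x $ j * x $ k)"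
proof -
  \<comment> \<open>The coefficient of the trace of \<open>\<Gamma>\<close>, computed in
    \<open>tr\<close>; for a metric, t x is the gradient of the logarithm of the volume
    density.\<close>
  define t where "t = (n + 1) * p + q + w * N"
  note sums = sum.distrib sum_kron sum_square_components sum_distrib_left[symmetric] sum_constant N_def[symmetric]
  have T1: "(\<Sum>i\<in>UNIV. d\<Gamma> i i j k) =
      (2 * p + q' * N + n * q) * kron j k + (2 * p' + w' * N + (n + 2) * w) * (x $ j * x $ k)"
  proof -
    have "(\<Sum>i\<in>UNIV. d\<Gamma> i i j k) = (\<Sum>i\<in>UNIV. kron i j * (p' * (x $ i * x $ k) + 2 * p * kron i k + w * (x $ k * x $ i))
        + kron i k * (p' * (x $ i * x $ j) + w * (x $ j * x $ i))
        + (q' * kron j k + w' * (x $ j * x $ k)) * (x $ i * x $ i) + (q * kron j k + w * (x $ j * x $ k)))"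
      unfolding d\<Gamma>_def by (intro sum.cong refl) (simp add: algebra_simps kron_sym)
    then show ?thesis
      by (simp only: sums) (simp add: n_def algebra_simps)
  qed
  have T2: "(\<Sum>i\<in>UNIV. d\<Gamma> j i i k) =
      t * kron j k + ((n + 1) * p' + q' + w' * N + 2 * w) * (x $ j * x $ k)"
  proof -
    have "(\<Sum>i\<in>UNIV. d\<Gamma> j i i k) = (\<Sum>i\<in>UNIV.
          kron i k * (p' * (x $ j * x $ i) + p * kron i j + q' * (x $ j * x $ i) + q * kron i j)
        + kron i j * (2 * w * (x $ k * x $ i))
        + (w' * (x $ j * x $ k) + w * kron j k) * (x $ i * x $ i) + (p' * (x $ j * x $ k) + p * kron j k))"
      unfolding d\<Gamma>_def by (intro sum.cong refl) (simp add: algebra_simps kron_sym)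
    then show ?thesis
      by (simp only: sums) (simp add: n_def t_def algebra_simps kron_sym)
  qed
  have tr: "(\<Sum>i\<in>UNIV. \<Gamma> i i m) = t * x $ m" for m
  proof -
    have "(\<Sum>i\<in>UNIV. \<Gamma> i i m) = (\<Sum>i\<in>UNIV. kron i m * ((p + q) * x $ i) + p * x $ m + (w * x $ m) * (x $ i * x $ i))"
      unfolding \<Gamma>_def by (intro sum.cong refl) (simp add: algebra_simps kron_sym)
    then show ?thesis
      by (simp only: sums) (simp add: n_def t_def algebra_simps)
  qed
  have T3: "(\<Sum>i\<in>UNIV. \<Sum>m\<in>UNIV. \<Gamma> i i m * \<Gamma> m j k) = t * q * N * kron j k + t * (2 * p + w * N) * (x $ j * x $ k)"
  proof -
    have "(\<Sum>i\<in>UNIV. \<Sum>m\<in>UNIV. \<Gamma> i i m * \<Gamma> m j k) = (\<Sum>m\<in>UNIV. t * x $ m * \<Gamma> m j k)"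
      by (subst sum.swap) (simp add: tr flip: sum_distrib_right)
    also have "\<dots> = (\<Sum>m\<in>UNIV. kron m k * (t * p * x $ j * x $ m) + kron m j * (t * p * x $ k * x $ m)
        + (t * q * kron j k + t * w * (x $ j * x $ k)) * (x $ m * x $ m))"
      unfolding \<Gamma>_def by (intro sum.cong refl) (simp add: algebra_simps kron_sym)
    finally show ?thesis
      by (simp only: sums) (simp add: algebra_simps)
  qed
  have T4: "(\<Sum>i\<in>UNIV. \<Sum>m\<in>UNIV. \<Gamma> i j m * \<Gamma> m i k) = 2 * p * q * N * kron j k +
     ((n + 3) * p\<^sup>2 + 2 * p * q + 4 * p * w * N + q\<^sup>2 + 2 * q * w * N + w\<^sup>2 * N\<^sup>2) * (x $ j * x $ k)"
  proof -
    \<comment> \<open>Two of the three parts of \<open>\<Gamma> i j m\<close> carry a delta in m;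
      only the part along x needs this contraction.\<close>
    have x\<Gamma>: "(\<Sum>m\<in>UNIV. x $ m * \<Gamma> m i k) = (2 * p + w * N) * (x $ i * x $ k) + q * N * kron i k" for i
    proof -
      have "(\<Sum>m\<in>UNIV. x $ m * \<Gamma> m i k) = (\<Sum>m\<in>UNIV. kron m k * (p * x $ i * x $ m) + kron m i * (p * x $ k * x $ m)
          + (q * kron i k + w * (x $ i * x $ k)) * (x $ m * x $ m))"
        unfolding \<Gamma>_def by (intro sum.cong refl) (simp add: algebra_simps kron_sym)
      then show ?thesis by (simp only: sums) (simp add: algebra_simps)
    qed
    have "(\<Sum>m\<in>UNIV. \<Gamma> i j m * \<Gamma> m i k) =
        p * x $ j * \<Gamma> i i k + q * x $ i * \<Gamma> j i k
        + (p * kron i j + w * (x $ i * x $ j)) * ((2 * p + w * N) * (x $ i * x $ k) + q * N * kron i k)" for i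
    proof -
      have "(\<Sum>m\<in>UNIV. \<Gamma> i j m * \<Gamma> m i k) = (\<Sum>m\<in>UNIV. kron m i * (p * x $ j * \<Gamma> m i k)
          + kron m j * (q * x $ i * \<Gamma> m i k) + (p * kron i j + w * (x $ i * x $ j)) * (x $ m * \<Gamma> m i k))"
      proof (intro sum.cong refl)
        have "\<Gamma> i j m = p * x $ j * kron m i + q * x $ i * kron m j + (p * kron i j + w * (x $ i * x $ j)) * x $ m" for m
          unfolding \<Gamma>_def by (simp add: algebra_simps kron_sym)
        then show "\<Gamma> i j m * \<Gamma> m i k = kron m i * (p * x $ j * \<Gamma> m i k)
            + kron m j * (q * x $ i * \<Gamma> m i k) + (p * kron i j + w * (x $ i * x $ j)) * (x $ m * \<Gamma> m i k)" for m
          by (simp add: algebra_simps)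
      qed
      then show ?thesis by (simp only: sums x\<Gamma>)
    qed
    then have "(\<Sum>i\<in>UNIV. \<Sum>m\<in>UNIV. \<Gamma> i j m * \<Gamma> m i k) = (\<Sum>i\<in>UNIV.
        kron i k * ((p + q) * p * x $ j * x $ i + q\<^sup>2 * x $ i * x $ j + (p * kron i j + w * (x $ i * x $ j)) * (q * N))
      + kron i j * (p * q * x $ i * x $ k + p * (2 * p + w * N) * (x $ i * x $ k))
      + (p * w * x $ j * x $ k + p * q * kron j k + q * w * x $ j * x $ k + w * (2 * p + w * N) * (x $ j * x $ k)) * (x $ i * x $ i)
      + p\<^sup>2 * (x $ j * x $ k))"
      unfolding \<Gamma>_def by (intro sum.cong refl) (simp add: algebra_simps kron_sym power2_eq_square)
    then show ?thesis by (simp only: sums) (simp add: n_def algebra_simps power2_eq_square kron_sym)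
  qed
  show ?thesis
    unfolding sum.distrib sum_subtractf T1 T2 T3 T4 by (simp add: t_def algebra_simps)
qed


text \<open>This is index raising: the first factor has the form of the inverse metric, the second
  that of a covector in l.\<close>

lemma kron_linear_contract:
  fixes x :: "real^'n"
  shows "(\<Sum>l\<in>UNIV. (a * kron k l + b * (x $ k * x $ l)) * (c1 * kron j l + c2 * kron i l + c3 * x $ l)) =
    a * (c1 * kron j k + c2 * kron i k + c3 * x $ k) + b * x $ k * (c1 * x $ j + c2 * x $ i + c3 * (x \<bullet> x))"
proof -
  have "(\<Sum>l\<in>UNIV. (a * kron k l + b * (x $ k * x $ l)) * (c1 * kron j l + c2 * kron i l + c3 * x $ l)) =
    (\<Sum>l\<in>UNIV. kron k l * (a * (c1 * kron j l + c2 * kron i l + c3 * x $ l)) + kron j l * (b * c1 * x $ k * x $ l)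
      + kron i l * (b * c2 * x $ k * x $ l) + b * c3 * x $ k * (x $ l * x $ l))"
    by (intro sum.cong refl) (simp add: algebra_simps)
  then show ?thesis
    by (simp only: sum.distrib sum_kron sum_square_components sum_distrib_left[symmetric]) (simp add: algebra_simps)
qed

lemma sym_tensor_trace:
  fixes x :: "real^'n"
  shows "(\<Sum>i\<in>UNIV. \<Sum>j\<in>UNIV. (a * kron i j + b * (x $ i * x $ j)) * (c * kron i j + d * (x $ i * x $ j))) =
    real CARD('n) * a * c + (a * d + b * c) * (x \<bullet> x) + b * d * (x \<bullet> x)\<^sup>2"
proof -
  have "(\<Sum>j\<in>UNIV. (a * kron i j + b * (x $ i * x $ j)) * (c * kron i j + d * (x $ i * x $ j))) =
      a * c + (a * d + b * c + b * d * (x \<bullet> x)) * (x $ i * x $ i)" for i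
    using kron_linear_contract[of a i b x c i 0 i "d * x $ i"] by (simp add: kron_sym algebra_simps)
  then show ?thesis
    by (simp only: sum.distrib sum_square_components sum_distrib_left[symmetric] sum_constant)
       (simp add: algebra_simps power2_eq_square)
qed

lemma partial_eqI:
  assumes "cone_at D x" "\<And>y. y \<in> D \<Longrightarrow> f y = F y" "(F has_derivative F') (at x)"
  shows "partial D i f x = F' (axis i 1)"
  unfolding partial_def using frechet_derivative_cone[OF assms(1), of UNIV f F F'] assms(2,3) by auto

section \<open>Christoffel symbols, Ricci tensor and Hessian of a warped metric\<close>

locale warping =
  fixes r r1 r2 :: "real \<Rightarrow> real"
  assumes r_pos: "0 < r s"
    and r_deriv: "(r has_real_derivative r1 s) (at s)"
    and r1_deriv: "(r1 has_real_derivative r2 s) (at s)"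
begin

text \<open>The exponent 1 is kept so that all five coefficients match
  \<open>has_derivative_radial_power\<close>.\<close>

definition "metA x = (r (ln (norm x)))\<^sup>2 / (x \<bullet> x) ^ 1"
definition "metB x = (1 - (r (ln (norm x)))\<^sup>2) / (x \<bullet> x) ^ 2"
definition "chrP x = (r1 (ln (norm x)) / r (ln (norm x)) - 1) / (x \<bullet> x) ^ 1"
definition "chrQ x = (1 - r (ln (norm x)) * r1 (ln (norm x))) / (x \<bullet> x) ^ 1"
definition "chrW x = (r (ln (norm x)) * r1 (ln (norm x)) - 2 * r1 (ln (norm x)) / r (ln (norm x))) / (x \<bullet> x) ^ 2"

context
  fixes x :: "real^'n" and s N :: real
  assumes x0: "x \<noteq> 0"
  defines "s \<equiv> ln (norm x)" and "N \<equiv> x \<bullet> x"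
begin

lemma metA_deriv: "(metA has_derivative (\<lambda>v. (2 * r s * r1 s - 2 * (r s)\<^sup>2) / N ^ 2 * (x \<bullet> v))) (at x)"
proof -
  have "((\<lambda>s. (r s)\<^sup>2) has_real_derivative 2 * r s * r1 s) (at s)"
    by (auto intro!: derivative_eq_intros r_deriv)
  from has_derivative_radial_power[OF x0 this[unfolded s_def], of 1] show ?thesis
    unfolding metA_def s_def N_def by (simp add: numeral_2_eq_2)
qed

lemma metB_deriv: "(metB has_derivative (\<lambda>v. (- 2 * r s * r1 s - 4 * (1 - (r s)\<^sup>2)) / N ^ 3 * (x \<bullet> v))) (at x)"
proof -
  have "((\<lambda>s. 1 - (r s)\<^sup>2) has_real_derivative - 2 * r s * r1 s) (at s)"
    by (auto intro!: derivative_eq_intros r_deriv)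
  from has_derivative_radial_power[OF x0 this[unfolded s_def], of 2] show ?thesis
    unfolding metB_def s_def N_def by (simp add: numeral_3_eq_3)
qed

lemma chrP_deriv: "(chrP has_derivative
    (\<lambda>v. (r2 s / r s - (r1 s / r s)\<^sup>2 - 2 * (r1 s / r s - 1)) / N ^ 2 * (x \<bullet> v))) (at x)"
proof -
  have "((\<lambda>s. r1 s / r s - 1) has_real_derivative r2 s / r s - (r1 s / r s)\<^sup>2) (at s)"
    using r_pos[of s] by (auto intro!: derivative_eq_intros r_deriv r1_deriv simp: field_simps power2_eq_square)
  from has_derivative_radial_power[OF x0 this[unfolded s_def], of 1] show ?thesis
    unfolding chrP_def s_def N_def by (simp add: numeral_2_eq_2)
qed

lemma chrQ_deriv: "(chrQ has_derivative
    (\<lambda>v. (- (r1 s)\<^sup>2 - r s * r2 s - 2 * (1 - r s * r1 s)) / N ^ 2 * (x \<bullet> v))) (at x)"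
proof -
  have "((\<lambda>s. 1 - r s * r1 s) has_real_derivative - (r1 s)\<^sup>2 - r s * r2 s) (at s)"
    by (auto intro!: derivative_eq_intros r_deriv r1_deriv simp: field_simps power2_eq_square)
  from has_derivative_radial_power[OF x0 this[unfolded s_def], of 1] show ?thesis
    unfolding chrQ_def s_def N_def by (simp add: numeral_2_eq_2)
qed

lemma chrW_deriv: "(chrW has_derivative
    (\<lambda>v. ((r1 s)\<^sup>2 + r s * r2 s - 2 * (r2 s / r s - (r1 s / r s)\<^sup>2)
       - 4 * (r s * r1 s - 2 * r1 s / r s)) / N ^ 3 * (x \<bullet> v))) (at x)"
proof -
  have "((\<lambda>s. r s * r1 s - 2 * r1 s / r s) has_real_derivative
      (r1 s)\<^sup>2 + r s * r2 s - 2 * (r2 s / r s - (r1 s / r s)\<^sup>2)) (at s)"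
    using r_pos[of s] by (auto intro!: derivative_eq_intros r_deriv r1_deriv simp: field_simps power2_eq_square)
  from has_derivative_radial_power[OF x0 this[unfolded s_def], of 2] show ?thesis
    unfolding chrW_def s_def N_def by (simp add: numeral_3_eq_3)
qed

end

lemma polar_metric_nth: "polar_metric r x $ i $ j = sym_tensor metA metB i j x"
  by (simp add: polar_metric_def sym_tensor_def metA_def metB_def)

context
  fixes D :: "(real^'n) set" and G :: "real^'n \<Rightarrow> real^'n^'n"
  assumes cone: "\<And>x. x \<in> D \<Longrightarrow> cone_at D x" and D0: "0 \<notin> D"
    and G: "\<And>x. x \<in> D \<Longrightarrow> G x = polar_metric r x"
begin

lemma christoffel_polar:
  assumes x: "x \<in> D"
  shows "christoffel D G k i j x = sym_christoffel chrP chrQ chrW k i j x"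
proof -
  define s N where "s = ln (norm x)" and "N = x \<bullet> x"
  have x0: "x \<noteq> 0" using D0 x by auto
  then have N0: "N \<noteq> 0" by (simp add: N_def)
  have rs: "r s > 0" by (rule r_pos)
  define a' b' where "a' = (2 * r s * r1 s - 2 * (r s)\<^sup>2) / N ^ 2"
    and "b' = (- 2 * r s * r1 s - 4 * (1 - (r s)\<^sup>2)) / N ^ 3"
  have dG: "partial D i (\<lambda>y. G y $ j $ l) x =
      a' * x $ i * kron j l + b' * x $ i * (x $ j * x $ l) + metB x * (kron i j * x $ l + x $ j * kron i l)" for i j l
    using partial_eqI[OF cone[OF x] _ has_derivative_sym_tensor[OF metA_deriv[OF x0] metB_deriv[OF x0]], of "\<lambda>y. G y $ j $ l"]
    by (simp add: G polar_metric_nth a'_def b'_def s_def N_def inner_axis axis_nth)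
  have inv: "matrix_inv (G x) $ k $ l = N / (r s)\<^sup>2 * kron k l + (1 - 1 / (r s)\<^sup>2) * (x $ k * x $ l)" for l
    using matrix_inv_polar_metric[OF x0, of r] r_pos[of s] by (simp add: G[OF x] N_def s_def)
  \<comment> \<open>The part along x_l of the three metric derivatives; the terms of
    \<open>metB\<close> with a delta in l cancel.\<close>
  define c3 where "c3 = - a' * kron i j + b' * x $ i * x $ j + 2 * metB x * kron i j"
  have "christoffel D G k i j x = (\<Sum>l\<in>UNIV. (N / (r s)\<^sup>2 * kron k l + (1 - 1 / (r s)\<^sup>2) * (x $ k * x $ l)) *
       (a' * x $ i * kron j l + a' * x $ j * kron i l + c3 * x $ l)) / 2"
    unfolding christoffel_def dG inv c3_def
    by (intro arg_cong2[of _ _ _ _ "(/)"] sum.cong refl arg_cong2[of _ _ _ _ "(*)"]) (simp add: algebra_simps kron_sym)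
  also have "\<dots> = (N / (r s)\<^sup>2 * (a' * x $ i * kron j k + a' * x $ j * kron i k + c3 * x $ k) +
      (1 - 1 / (r s)\<^sup>2) * x $ k * (2 * a' * x $ i * x $ j + c3 * N)) / 2"
    unfolding kron_linear_contract by (simp add: N_def algebra_simps)
  also have "\<dots> = (N / (r s)\<^sup>2 * a' / 2) * (x $ i * kron j k + x $ j * kron i k)
      + N * (metB x - a' / 2) * (kron i j * x $ k)
      + ((1 - 1 / (r s)\<^sup>2) * a' + N * b' / 2) * (x $ i * x $ j * x $ k)"
    unfolding c3_def using rs by (simp add: field_simps)
  also have "N / (r s)\<^sup>2 * a' / 2 = chrP x"
    unfolding a'_def chrP_def s_def[symmetric] N_def[symmetric]
    using rs N0 by (simp add: field_simps power2_eq_square)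
  also have "N * (metB x - a' / 2) = chrQ x"
    unfolding a'_def chrQ_def metB_def s_def[symmetric] N_def[symmetric]
    using rs N0 by (simp add: field_simps power2_eq_square)
  also have "(1 - 1 / (r s)\<^sup>2) * a' + N * b' / 2 = chrW x"
    unfolding a'_def b'_def chrW_def s_def[symmetric] N_def[symmetric]
    using rs N0 by (simp add: field_simps power2_eq_square power3_eq_cube)
  finally show ?thesis by (simp add: sym_christoffel_def)
qed

text \<open>The warped product formula Ric = - (n - 1) (r'' / r) ds^2 + \<kappa> h in the form of
  \<open>polar_metric\<close>. Here \<kappa> is the coefficient of the round metric, not the
  constant of the profile.\<close>

lemma ricci_polar:
  assumes x: "x \<in> D"
  defines "s \<equiv> ln (norm x)" and "N \<equiv> x \<bullet> x" and "n \<equiv> real CARD('n)"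
  defines "\<kappa> \<equiv> (n - 2) * (1 - (r1 s)\<^sup>2) - r s * r2 s"
  shows "ricci D G j k x = \<kappa> / N * kron j k + (- (n - 1) * r2 s / r s - \<kappa>) / N\<^sup>2 * (x $ j * x $ k)"
proof -
  have x0: "x \<noteq> 0" using D0 x by auto
  then have N0: "N \<noteq> 0" by (simp add: N_def)
  have rs: "r s > 0" by (rule r_pos)
  define p q w where pqw: "p = chrP x" "q = chrQ x" "w = chrW x"
  define p' q' w' where pqw': "p' = (r2 s / r s - (r1 s / r s)\<^sup>2 - 2 * (r1 s / r s - 1)) / N ^ 2"
    "q' = (- (r1 s)\<^sup>2 - r s * r2 s - 2 * (1 - r s * r1 s)) / N ^ 2"
    "w' = ((r1 s)\<^sup>2 + r s * r2 s - 2 * (r2 s / r s - (r1 s / r s)\<^sup>2)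
       - 4 * (r s * r1 s - 2 * r1 s / r s)) / N ^ 3"
  have d\<Gamma>: "partial D m (christoffel D G k i j) x =
        p' * x $ m * (x $ i * kron j k + x $ j * kron i k) + p * (kron m i * kron j k + kron m j * kron i k)
        + q' * x $ m * (kron i j * x $ k) + q * (kron i j * kron m k)
        + w' * x $ m * (x $ i * x $ j * x $ k)
        + w * (kron m i * x $ j * x $ k + x $ i * kron m j * x $ k + x $ i * x $ j * kron m k)" for m k i j
    using partial_eqI[OF cone[OF x] christoffel_polar has_derivative_sym_christoffel[OF chrP_deriv[OF x0] chrQ_deriv[OF x0] chrW_deriv[OF x0]], of m k i j]
    unfolding s_def[symmetric] N_def[symmetric] pqw'[symmetric] pqw[symmetric] axis_nth inner_axis
    by simp
  have \<Gamma>: "christoffel D G k i j x =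
      p * (x $ i * kron j k + x $ j * kron i k) + q * (kron i j * x $ k) + w * (x $ i * x $ j * x $ k)" for k i j
    unfolding christoffel_polar[OF x] sym_christoffel_def pqw ..
  have p: "p = (r1 s / r s - 1) / N" and q: "q = (1 - r s * r1 s) / N" and w: "w = (r s * r1 s - 2 * r1 s / r s) / N ^ 2"
    by (simp_all add: pqw chrP_def chrQ_def chrW_def s_def N_def)
  have a: "2 * p + q' * N + n * q - ((n + 1) * p + q + w * N) + ((n + 1) * p + q + w * N) * q * N - 2 * p * q * N = \<kappa> / N"
    unfolding p q w pqw' \<kappa>_def using N0 rs by (simp add: field_simps power2_eq_square)
  have b: "2 * p' + w' * N + (n + 2) * w - ((n + 1) * p' + q' + w' * N + 2 * w) + ((n + 1) * p + q + w * N) * (2 * p + w * N)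
       - ((n + 3) * p\<^sup>2 + 2 * p * q + 4 * p * w * N + q\<^sup>2 + 2 * q * w * N + w\<^sup>2 * N\<^sup>2) = (- (n - 1) * r2 s / r s - \<kappa>) / N\<^sup>2"
    unfolding p q w pqw' \<kappa>_def using N0 rs by (simp add: field_simps power2_eq_square power3_eq_cube)
  show ?thesis
    unfolding ricci_def riemann_def d\<Gamma> \<Gamma> ricci_contraction N_def[symmetric] n_def[symmetric] a b ..
qed

text \<open>In geometric terms Hess f = l'' ds^2 + r r' l' h, since the slices have second
  fundamental form r r' h.\<close>

lemma hessian_polar:
  assumes x: "x \<in> D" and f: "\<And>x. x \<in> D \<Longrightarrow> f x = l (ln (norm x))"
    and l: "\<And>s. (l has_real_derivative l1 s) (at s)" "\<And>s. (l1 has_real_derivative l2 s) (at s)"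
  defines "s \<equiv> ln (norm x)" and "N \<equiv> x \<bullet> x"
  shows "hessian D G f i j x = r s * r1 s * l1 s / N * kron i j + (l2 s - r s * r1 s * l1 s) / N\<^sup>2 * (x $ i * x $ j)"
proof -
  have x0: "x \<noteq> 0" using D0 x by auto
  then have N0: "N \<noteq> 0" by (simp add: N_def)
  have rs: "r s > 0" by (rule r_pos)
  have df: "partial D j f y = l1 (ln (norm y)) / (y \<bullet> y) ^ 1 * y $ j" if "y \<in> D" for y j
  proof -
    have "y \<noteq> 0" using D0 that by auto
    from partial_eqI[OF cone[OF that] f has_derivative_radial[OF this l(1)], of j] show ?thesis
      by (simp add: inner_axis)
  qed
  have "((\<lambda>y. l1 (ln (norm y)) / (y \<bullet> y) ^ 1 * y $ j) has_derivative
      (\<lambda>v. (l1 s / N) * v $ j + (l2 s - 2 * l1 s) / N\<^sup>2 * (x \<bullet> v) * x $ j)) (at x)"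
    using has_derivative_mult[OF has_derivative_radial_power[OF x0 l(2), of 1] bounded_linear_imp_has_derivative[OF bounded_linear_vec_nth, of j]]
    by (simp add: s_def N_def power2_eq_square)
  from partial_eqI[OF cone[OF x] df this, of i]
  have ddf: "partial D i (partial D j f) x = l1 s / N * kron i j + (l2 s - 2 * l1 s) / N\<^sup>2 * (x $ i * x $ j)"
    by (simp add: inner_axis axis_nth)
  define p q w where pqw: "p = chrP x" "q = chrQ x" "w = chrW x"
  have p: "p = (r1 s / r s - 1) / N" and q: "q = (1 - r s * r1 s) / N" and w: "w = (r s * r1 s - 2 * r1 s / r s) / N ^ 2"
    by (simp_all add: pqw chrP_def chrQ_def chrW_def s_def N_def)
  have "(\<Sum>k\<in>UNIV. christoffel D G k i j x * partial D k f x) = (\<Sum>k\<in>UNIV.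
      kron j k * (p * l1 s / N * x $ i * x $ k) + kron i k * (p * l1 s / N * x $ j * x $ k)
      + (q * l1 s / N * kron i j + w * l1 s / N * (x $ i * x $ j)) * (x $ k * x $ k))"
    unfolding christoffel_polar[OF x] sym_christoffel_def pqw[symmetric] df[OF x]
    by (intro sum.cong refl) (simp add: N_def s_def algebra_simps add_divide_distrib)
  also have "\<dots> = q * l1 s * kron i j + (2 * p + w * N) * l1 s / N * (x $ i * x $ j)"
    using N0 by (simp only: sum.distrib sum_kron sum_square_components sum_distrib_left[symmetric] N_def[symmetric])
       (simp add: field_simps)
  finally have \<Gamma>df: "(\<Sum>k\<in>UNIV. christoffel D G k i j x * partial D k f x) =
      q * l1 s * kron i j + (2 * p + w * N) * l1 s / N * (x $ i * x $ j)" .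
  show ?thesis
    unfolding hessian_def ddf \<Gamma>df p q w using N0 rs by (simp add: field_simps power2_eq_square)
qed

text \<open>\<open>E1\<close> and \<open>E2\<close> are the components of the critical equation along \<open>ds\<^sup>2\<close> and
  along the round metric.\<close>

lemma critical_equation_polar:
  assumes x: "x \<in> D" and f: "\<And>x. x \<in> D \<Longrightarrow> f x = l (ln (norm x))"
    and l: "\<And>s. (l has_real_derivative l1 s) (at s)" "\<And>s. (l1 has_real_derivative l2 s) (at s)"
    and n: "n = real CARD('n)"
    and E1: "\<And>s. (n - 1) * (r2 s * l s - r1 s * l1 s) = r s"
    and E2: "\<And>s. - (l2 s + (n - 1) * (r1 s / r s) * l1 s) * (r s)\<^sup>2 + r s * r1 s * l1 s
        - l s * ((n - 2) * (1 - (r1 s)\<^sup>2) - r s * r2 s) = (r s)\<^sup>2"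
  shows "- laplacian D G f x * G x $ i $ j + hessian D G f i j x - f x * ricci D G i j x = G x $ i $ j"
proof -
  define s N where "s = ln (norm x)" and "N = x \<bullet> x"
  have x0: "x \<noteq> 0" using D0 x by auto
  then have N0: "N \<noteq> 0" by (simp add: N_def)
  have rs: "r s > 0" by (rule r_pos)
  define L where "L = l2 s + (n - 1) * (r1 s / r s) * l1 s"
  define \<kappa> where "\<kappa> = (n - 2) * (1 - (r1 s)\<^sup>2) - r s * r2 s"
  have H: "hessian D G f i j x = r s * r1 s * l1 s / N * kron i j
      + (l2 s - r s * r1 s * l1 s) / N\<^sup>2 * (x $ i * x $ j)" for i j
    unfolding s_def N_def using x f l by (rule hessian_polar)
  have lap: "laplacian D G f x = L"
  proof -
    have inv: "matrix_inv (G x) $ k $ l = N / (r s)\<^sup>2 * kron k l + (1 - 1 / (r s)\<^sup>2) * (x $ k * x $ l)" for k l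
      using matrix_inv_polar_metric[OF x0, of r] r_pos[of s] by (simp add: G[OF x] N_def s_def)
    show ?thesis
      unfolding laplacian_def H inv sym_tensor_trace L_def N_def[symmetric] n[symmetric]
      using N0 rs by (simp add: field_simps power2_eq_square)
  qed
  have g: "G x $ i $ j = (r s)\<^sup>2 / N * kron i j + (1 - (r s)\<^sup>2) / N\<^sup>2 * (x $ i * x $ j)"
    by (simp add: G[OF x] polar_metric_def s_def N_def)
  \<comment> \<open>Along ds^2 the second derivatives of l from the Laplacian and the Hessian
    cancel, which is why \<open>E1\<close> is of first order.\<close>
  have e1: "l2 s - L + (n - 1) * r2 s / r s * l s = 1"
  proof -
    have "l2 s - L + (n - 1) * r2 s / r s * l s = (n - 1) * (r2 s * l s - r1 s * l1 s) / r s"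
      unfolding L_def using rs by (simp add: field_simps)
    then show ?thesis using rs by (simp add: E1)
  qed
  have e2: "- L * (r s)\<^sup>2 + r s * r1 s * l1 s - l s * \<kappa> = (r s)\<^sup>2"
    using E2[of s] unfolding L_def \<kappa>_def by simp
  have fx: "f x = l s" using f[OF x] by (simp add: s_def)
  \<comment> \<open>Only h contributes to the delta term, while h and ds^2 enter the x_i x_j term
    with opposite signs; hence the difference of the two components there.\<close>
  have "- laplacian D G f x * G x $ i $ j + hessian D G f i j x - f x * ricci D G i j x =
     (- L * (r s)\<^sup>2 + r s * r1 s * l1 s - l s * \<kappa>) / N * kron i j
     + ((l2 s - L + (n - 1) * r2 s / r s * l s) - (- L * (r s)\<^sup>2 + r s * r1 s * l1 s - l s * \<kappa>)) / N\<^sup>2 * (x $ i * x $ j)"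
    unfolding lap g H fx ricci_polar[OF x, folded s_def N_def n, folded \<kappa>_def]
    using N0 by (simp add: diff_divide_distrib add_divide_distrib algebra_simps)
  also have "\<dots> = G x $ i $ j" unfolding e1 e2 g ..
  finally show ?thesis .
qed

end

end

section \<open>The static potentials of the AdS-Schwarzschild profile\<close>

locale ads_schwarzschild =
  fixes n :: nat and R a :: real and r :: "real \<Rightarrow> real"
  assumes n3: "3 \<le> n" and profile: "ads_schwarzschild_profile n R a r"
begin

definition "\<kappa> = - R / (real n * (real n - 1))"
text \<open>The mass term: with it r'' = r (\<kappa> + z), and the later formulas are rational in r,
  r', z and the antiderivative. A natural power of the inverse replaces \<open>powi\<close>, so that
  the smoothness rules apply.\<close>

definition "z s = a * inverse (r s) ^ n"
definition "r1 = deriv r"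
definition "r2 s = r s * (\<kappa> + z s)"

lemma kappa_pos: "\<kappa> > 0"
proof -
  have "R < 0" using profile by (simp add: ads_schwarzschild_profile_def)
  moreover have "0 < real n * (real n - 1)" using n3 by simp
  ultimately show ?thesis unfolding \<kappa>_def by (intro divide_pos_pos) auto
qed

lemma a_pos: "a > 0" and r_pos: "r s > 0" and r1_0: "r1 0 = 0"
  using profile by (auto simp: ads_schwarzschild_profile_def r1_def)

lemma z_pos: "z s > 0"
  using a_pos r_pos[of s] by (simp add: z_def)

lemma kz_pos: "\<kappa> + z s > 0"
  using kappa_pos z_pos[of s] by simp

lemma r2_pos: "r2 s > 0"
  using r_pos[of s] kz_pos[of s] by (simp add: r2_def)

lemma r_deriv: "(r has_real_derivative r1 s) (at s)"
  using profile by (simp add: ads_schwarzschild_profile_def r1_def DERIV_deriv_iff_real_differentiable)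

lemma r1_deriv: "(r1 has_real_derivative r2 s) (at s)"
proof -
  have "deriv (deriv r) s + R / (real n * (real n - 1)) * r s = a * r s powi (1 - int n)"
    using profile by (simp add: ads_schwarzschild_profile_def)
  moreover have "r s powi (1 - int n) = r s * inverse (r s) ^ n"
    using r_pos[of s] by (simp add: power_int_diff power_inverse divide_inverse)
  ultimately have "deriv r1 s = r2 s"
    by (simp add: r1_def r2_def z_def \<kappa>_def algebra_simps)
  then show ?thesis
    using profile DERIV_deriv_iff_real_differentiable[of r1 s] by (simp add: ads_schwarzschild_profile_def r1_def)
qed

text \<open>The first integral of the profile, scaled by n - 2 because (n - 2) (1 - r'^2) occurs in
  the spherical Ricci coefficient.\<close>

lemma r1_square: "(real n - 2) * (1 - (r1 s)\<^sup>2) = (2 * z s - (real n - 2) * \<kappa>) * (r s)\<^sup>2"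
proof -
  have "(r1 s)\<^sup>2 + R / (real n * (real n - 1)) * (r s)\<^sup>2 + 2 * a / (real n - 2) * r s powi (2 - int n) = 1"
    using profile by (simp add: ads_schwarzschild_profile_def r1_def)
  moreover have "r s powi (2 - int n) = (r s)\<^sup>2 * inverse (r s) ^ n"
    using r_pos[of s] by (simp add: power_int_diff power_inverse divide_inverse)
  ultimately have "1 - (r1 s)\<^sup>2 = 2 / (real n - 2) * z s * (r s)\<^sup>2 - \<kappa> * (r s)\<^sup>2"
    by (simp add: \<kappa>_def z_def algebra_simps)
  then show ?thesis using n3 by (simp add: field_simps)
qed

lemma z_deriv: "(z has_real_derivative - real n * z s * r1 s / r s) (at s)"
proof -
  obtain m where m: "n = Suc m" using n3 by (cases n) auto
  have "((\<lambda>s. inverse (r s)) has_real_derivative - r1 s / (r s)\<^sup>2) (at s)"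
    using r_pos[of s] by (auto intro!: derivative_eq_intros r_deriv simp: field_simps power2_eq_square)
  from DERIV_cmult[OF DERIV_power[OF this, of n], of a] show ?thesis
    unfolding z_def[abs_def] using r_pos[of s]
    by (elim DERIV_cong) (simp add: m field_simps power2_eq_square)
qed

lemma r2_deriv: "(r2 has_real_derivative r1 s * (\<kappa> - (real n - 1) * z s)) (at s)"
  unfolding r2_def[abs_def] using r_pos[of s]
  by (auto intro!: derivative_eq_intros r_deriv z_deriv simp: field_simps)

lemma r1_strict_mono: "s < t \<Longrightarrow> r1 s < r1 t"
  by (rule DERIV_pos_imp_increasing[of s t r1]) (use r1_deriv r2_pos in blast)+

lemma r1_pos: "0 < s \<Longrightarrow> 0 < r1 s" and r1_neg: "s < 0 \<Longrightarrow> r1 s < 0"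
  using r1_strict_mono[of 0 s] r1_strict_mono[of s 0] by (auto simp: r1_0)

lemma r_mono: "0 \<le> s \<Longrightarrow> s \<le> t \<Longrightarrow> r s \<le> r t"
proof (rule DERIV_nonneg_imp_nondecreasing[of s t r])
  show "\<exists>y. DERIV r x :> y \<and> 0 \<le> y" if "0 \<le> s" "s \<le> x" for x
    using r_deriv[of x] r1_pos[of x] r1_0 that by (intro exI[of _ "r1 x"]) (cases "x = 0"; auto)
qed auto

lemma r_ge_r0: "r 0 \<le> r s"
proof (cases "0 \<le> s")
  case False
  show ?thesis
  proof (rule DERIV_nonpos_imp_nonincreasing[of s 0 r])
    show "\<exists>y. DERIV r x :> y \<and> y \<le> 0" if "x \<le> 0" for x
      using r_deriv[of x] r1_neg[of x] r1_0 that by (intro exI[of _ "r1 x"]) (cases "x = 0"; auto)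
  qed (use False in auto)
qed (simp add: r_mono)

text \<open>Bootstrapping: r'' is an algebraic expression in r, so class C^k of r and r' passes to
  r'' and gives both one more order.\<close>

lemma C_diff_profile: "C_diff k UNIV r \<and> C_diff k UNIV r1"
proof (induction k)
  case 0
  have "isCont r s" "isCont r1 s" for s
    using r_deriv r1_deriv DERIV_isCont by blast+
  then show ?case by (simp add: continuous_at_imp_continuous_on)
next
  case (Suc k)
  have U: "open (UNIV :: real set)" by simp
  have r2: "C_diff k UNIV r2"
    unfolding r2_def[abs_def] z_def
    by (intro C_diff_mult C_diff_add C_diff_const C_diff_power C_diff_inverse U) (use Suc r_pos in \<open>auto simp: less_imp_neq[symmetric]\<close>)
  show ?case
  proof
    show "C_diff (Suc k) UNIV r"
      by (rule C_diff_SucI[OF U r_deriv[unfolded has_field_derivative_def]])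
         (use Suc in \<open>intro C_diff_mult C_diff_const U; simp\<close>)
    show "C_diff (Suc k) UNIV r1"
      by (rule C_diff_SucI[OF U r1_deriv[unfolded has_field_derivative_def]])
         (intro C_diff_mult C_diff_const U r2)
  qed
qed

lemma C_diff_z: "C_diff k UNIV z"
  unfolding z_def[abs_def]
  by (intro C_diff_cmult C_diff_power C_diff_inverse) (use C_diff_profile r_pos in \<open>auto simp: less_imp_neq[symmetric]\<close>)

text \<open>Uniqueness for the second order equation: the energy of the difference of two solutions
  satisfies a Gronwall inequality, since the nonlinearity is Lipschitz on \<open>{r 0..}\<close>.\<close>

lemma r_even: "r (- s) = r s"
proof -
  have *: "r (- s) = r s" if s: "0 \<le> s" for s
  proof -
    define g where "g = (\<lambda>x. \<kappa> * x + a * inverse x ^ (n - 1))"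
    have g: "r2 s = g (r s)" for s
    proof -
      have "inverse (r s) ^ n = inverse (r s) * inverse (r s) ^ (n - 1)"
        using n3 by (cases n) auto
      then show ?thesis using r_pos[of s] by (simp add: r2_def z_def g_def algebra_simps)
    qed
    \<comment> \<open>Bounds |\<kappa> - (n - 1) a u^(-n)|, the modulus of the derivative of
      \<open>g\<close>, for u at least r 0, the minimum of r.\<close>
    define K where "K = \<kappa> + a * real (n - 1) * inverse (r 0) ^ n"
    have lip: "\<bar>g x - g y\<bar> \<le> K * \<bar>x - y\<bar>" if "r 0 \<le> x" "r 0 \<le> y" for x y
    proof -
      obtain m where m: "n = Suc (Suc m)" using n3 by (cases n; cases "n - 1") auto
      have "norm (g x - g y) \<le> K * norm (x - y)"
      proof (rule field_differentiable_bound[where S = "{r 0..}"])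
        fix u assume "u \<in> {r 0..}"
        then have u: "r 0 \<le> u" by simp
        then have u0: "0 < u" using r_pos[of 0] by linarith
        have "(inverse has_real_derivative - (inverse u)\<^sup>2) (at u)"
          using u0 by (auto intro!: derivative_eq_intros simp: power2_eq_square)
        from DERIV_add[OF DERIV_cmult[OF DERIV_ident, of \<kappa>] DERIV_cmult[OF DERIV_power[OF this, of "n - 1"], of a]]
        have "(g has_real_derivative \<kappa> - a * real (n - 1) * inverse u ^ n) (at u)"
          unfolding g_def by (elim DERIV_cong) (simp add: m power2_eq_square)
        then show "(g has_field_derivative \<kappa> - a * real (n - 1) * inverse u ^ n) (at u within {r 0..})"
          by (rule has_field_derivative_at_within)
        have "inverse u ^ n \<le> inverse (r 0) ^ n"
          using u u0 r_pos[of 0] by (intro power_mono) auto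
        then have "a * real (n - 1) * inverse u ^ n \<le> a * real (n - 1) * inverse (r 0) ^ n"
          using a_pos by (intro mult_left_mono) auto
        moreover have "0 \<le> a * real (n - 1) * inverse u ^ n" using a_pos u0 by simp
        ultimately show "norm (\<kappa> - a * real (n - 1) * inverse u ^ n) \<le> K"
          using kappa_pos by (simp add: K_def)
      qed (use that in auto)
      then show ?thesis by simp
    qed
    have K: "0 \<le> K" using kappa_pos a_pos r_pos[of 0] by (simp add: K_def)
    define d d1 where "d = (\<lambda>s. r s - r (- s))" and "d1 = (\<lambda>s. r1 s + r1 (- s))"
    \<comment> \<open>The rate 1 + K absorbs the growth of d^2 + d'^2: the term 2 d d' is at most
      this sum, and 2 d' d'' at most K times it. Evenness holds because \<open>E\<close> starts at
      0, by r'(0) = 0.\<close>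
    define E where "E = (\<lambda>s. ((d s)\<^sup>2 + (d1 s)\<^sup>2) * exp (- (1 + K) * s))"
    have rm: "((\<lambda>s. r (- s)) has_real_derivative - r1 (- s)) (at s)"
      and r1m: "((\<lambda>s. r1 (- s)) has_real_derivative - r2 (- s)) (at s)" for s
      using r_deriv r1_deriv by (simp_all flip: DERIV_mirror)
    have d: "(d has_real_derivative d1 s) (at s)" for s
      unfolding d_def d1_def by (auto intro!: derivative_eq_intros r_deriv rm)
    have d1: "(d1 has_real_derivative r2 s - r2 (- s)) (at s)" for s
      unfolding d1_def by (auto intro!: derivative_eq_intros r1_deriv r1m)
    have "E s \<le> E 0"
    proof (rule DERIV_nonpos_imp_nonincreasing[OF s])
      fix t
      define E' where "E' = (2 * d t * d1 t + 2 * d1 t * (r2 t - r2 (- t)) - (1 + K) * ((d t)\<^sup>2 + (d1 t)\<^sup>2)) * exp (- (1 + K) * t)"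
      have "DERIV E t :> E'"
        unfolding E_def E'_def by (auto intro!: derivative_eq_intros d d1 simp: algebra_simps)
      moreover have "E' \<le> 0"
      proof -
        have "\<bar>r2 t - r2 (- t)\<bar> \<le> K * \<bar>d t\<bar>"
          unfolding g d_def using r_ge_r0 by (intro lip) auto
        then have "\<bar>d1 t\<bar> * \<bar>r2 t - r2 (- t)\<bar> \<le> \<bar>d1 t\<bar> * (K * \<bar>d t\<bar>)"
          by (intro mult_left_mono) auto
        then have "d1 t * (r2 t - r2 (- t)) \<le> K * (\<bar>d t\<bar> * \<bar>d1 t\<bar>)"
          using abs_ge_self[of "d1 t * (r2 t - r2 (- t))"] unfolding abs_mult by (simp only: mult_ac)
        moreover have "2 * (\<bar>d t\<bar> * \<bar>d1 t\<bar>) \<le> (d t)\<^sup>2 + (d1 t)\<^sup>2"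
          using sum_squares_bound[of "\<bar>d t\<bar>" "\<bar>d1 t\<bar>"] by simp
        moreover from this have "K * (2 * (\<bar>d t\<bar> * \<bar>d1 t\<bar>)) \<le> K * ((d t)\<^sup>2 + (d1 t)\<^sup>2)"
          using K by (rule mult_left_mono)
        moreover have "d t * d1 t \<le> \<bar>d t\<bar> * \<bar>d1 t\<bar>"
          using abs_ge_self[of "d t * d1 t"] by (simp add: abs_mult)
        ultimately have "2 * d t * d1 t + 2 * d1 t * (r2 t - r2 (- t)) - (1 + K) * ((d t)\<^sup>2 + (d1 t)\<^sup>2) \<le> 0"
          by (simp add: algebra_simps)
        then show ?thesis unfolding E'_def by (simp add: mult_le_0_iff)
      qed
      ultimately show "\<exists>y. DERIV E t :> y \<and> y \<le> 0" by blast
    qed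
    also have "E 0 = 0" by (simp add: E_def d_def d1_def r1_0)
    finally have "(d s)\<^sup>2 + (d1 s)\<^sup>2 \<le> 0"
      by (simp add: E_def mult_le_0_iff)
    then show ?thesis by (simp add: sum_power2_le_zero_iff d_def)
  qed
  show ?thesis using *[of s] *[of "- s"] by (cases "0 \<le> s") auto
qed

lemma z_even: "z (- s) = z s" by (simp add: z_def r_even)

lemma r1_odd: "r1 (- s) = - r1 s"
proof -
  have "((\<lambda>s. r (- s)) has_real_derivative - r1 (- s)) (at s)"
    using r_deriv by (simp flip: DERIV_mirror)
  then have "(r has_real_derivative - r1 (- s)) (at s)" by (simp add: r_even)
  then show ?thesis using DERIV_unique[OF r_deriv] by force
qed

section \<open>The antiderivative I and its symmetry\<close>

definition "i1 s = real n * z s / (r s * (\<kappa> + z s)\<^sup>2)"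

lemma i1_pos: "0 < i1 s"
  using n3 z_pos[of s] r_pos[of s] kz_pos[of s] by (simp add: i1_def)

lemma isCont_i1: "isCont i1 s"
  unfolding i1_def[abs_def] using r_pos[of s] kz_pos[of s]
  by (intro continuous_intros DERIV_isCont[OF z_deriv] DERIV_isCont[OF r_deriv]) auto

text \<open>The value 0 at the horizon, together with the evenness of \<open>i1\<close>, makes this
  choice of antiderivative odd.\<close>

definition "i0 = (SOME F. F 0 = 0 \<and> (\<forall>s. (F has_real_derivative i1 s) (at s)))"

lemma i0_0: "i0 0 = 0" and i0_deriv: "(i0 has_real_derivative i1 s) (at s)"
proof -
  obtain F where F: "\<And>s. (F has_vector_derivative i1 s) (at s)"
    using einterval_antiderivative[of "-\<infinity>" "\<infinity>" i1] isCont_i1 by auto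
  have "\<exists>F. F 0 = 0 \<and> (\<forall>s. (F has_real_derivative i1 s) (at s))"
    using F by (intro exI[of _ "\<lambda>s. F s - F 0"])
      (auto intro!: derivative_eq_intros simp: has_real_derivative_iff_has_vector_derivative)
  from someI_ex[OF this] show "i0 0 = 0" "(i0 has_real_derivative i1 s) (at s)"
    by (auto simp: i0_def)
qed

lemma i0_strict_mono: "s < t \<Longrightarrow> i0 s < i0 t"
  by (rule DERIV_pos_imp_increasing[of s t i0]) (use i0_deriv i1_pos in blast)+

lemma i0_odd: "i0 (- s) = - i0 s"
proof -
  have "((\<lambda>s. i0 (- s)) has_real_derivative - i1 (- s)) (at s)" for s
    using i0_deriv by (simp flip: DERIV_mirror)
  from DERIV_add[OF i0_deriv this]
  have "((\<lambda>s. i0 s + i0 (- s)) has_real_derivative 0) (at s)" for s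
    by (simp add: i1_def r_even z_even)
  then have "i0 s + i0 (- s) = i0 0 + i0 (- 0)"
    by (intro DERIV_isconst_all[where f = "\<lambda>s. i0 s + i0 (- s)"]) blast
  then show ?thesis by (simp add: i0_0)
qed

lemma C_diff_i0: "C_diff k UNIV i0"
proof -
  have U: "open (UNIV :: real set)" by simp
  have "C_diff k UNIV i1"
    unfolding i1_def[abs_def]
    by (intro C_diff_divide C_diff_cmult C_diff_mult C_diff_power C_diff_add C_diff_const C_diff_z U)
       (use C_diff_profile r_pos kz_pos in \<open>auto simp: less_imp_neq[symmetric]\<close>)
  then have "C_diff (Suc k) UNIV i0"
    by (intro C_diff_SucI[OF U i0_deriv[unfolded has_field_derivative_def]] C_diff_mult C_diff_const U)
  then show ?thesis by (rule C_diff_SucD)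
qed

text \<open>The general solution of \<open>(n - 1) (r'' l - r' l') = r\<close>, obtained from
  \<open>(l / r')' = - r / ((n - 1) r'\<^sup>2)\<close> by an integration by parts that removes the
  singularity at the horizon.\<close>

definition "pot C s = (1 / (\<kappa> + z s) - r1 s * (i0 s + C)) / (real n - 1)"
definition "pot1 C s = - r2 s * (i0 s + C) / (real n - 1)"
definition "pot2 C s =
  - (r1 s * (\<kappa> - (real n - 1) * z s) * (i0 s + C) + real n * z s / (\<kappa> + z s)) / (real n - 1)"

text \<open>The derivative of 1 / (\<kappa> + z) is r' times \<open>i1\<close> and cancels the term
  that comes from differentiating \<open>i0\<close>.\<close>

lemma pot_deriv: "(pot C has_real_derivative pot1 C s) (at s)"
proof -
  have "((\<lambda>s. 1 / (\<kappa> + z s) - r1 s * (i0 s + C)) has_real_derivative - r2 s * (i0 s + C)) (at s)"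
    using r_pos[of s] kz_pos[of s]
    by (auto intro!: derivative_eq_intros z_deriv r1_deriv i0_deriv simp: i1_def power2_eq_square field_simps)
  from DERIV_cdivide[OF this] show ?thesis
    unfolding pot_def[abs_def] pot1_def .
qed

lemma pot1_deriv: "(pot1 C has_real_derivative pot2 C s) (at s)"
proof -
  have "r2 s * i1 s = real n * z s / (\<kappa> + z s)"
    using r_pos[of s] kz_pos[of s] by (simp add: r2_def i1_def power2_eq_square)
  then have "((\<lambda>s. - r2 s * (i0 s + C)) has_real_derivative
      - (r1 s * (\<kappa> - (real n - 1) * z s) * (i0 s + C) + real n * z s / (\<kappa> + z s))) (at s)"
    by (auto intro!: derivative_eq_intros r2_deriv i0_deriv simp: algebra_simps)
  from DERIV_cdivide[OF this] show ?thesis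
    unfolding pot1_def[abs_def] pot2_def .
qed

lemma pot_scaled: "(real n - 1) * pot C s = 1 / (\<kappa> + z s) - r1 s * (i0 s + C)"
  and pot1_scaled: "(real n - 1) * pot1 C s = - r2 s * (i0 s + C)"
  and pot2_scaled: "(real n - 1) * pot2 C s =
    - (r1 s * (\<kappa> - (real n - 1) * z s) * (i0 s + C) + real n * z s / (\<kappa> + z s))"
  using n3 by (simp_all add: pot_def pot1_def pot2_def)

text \<open>The terms with \<open>i0 s + C\<close> cancel because r' solves the homogeneous
  equation; r'' / (\<kappa> + z) = r remains.\<close>

lemma pot_first_order: "(real n - 1) * (r2 s * pot C s - r1 s * pot1 C s) = r s"
proof -
  have "(real n - 1) * (r2 s * pot C s - r1 s * pot1 C s)
      = r2 s * ((real n - 1) * pot C s) - r1 s * ((real n - 1) * pot1 C s)"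
    by (simp add: algebra_simps)
  also have "\<dots> = r2 s * (1 / (\<kappa> + z s))"
    unfolding pot_scaled pot1_scaled by (simp only: algebra_simps)
  also have "\<dots> = r s" using kz_pos[of s] by (simp add: r2_def)
  finally show ?thesis .
qed

text \<open>After eliminating r'^2 through \<open>r1_square\<close> and r'' through its formula, and
  multiplying by n - 1, a rational identity remains, in which \<open>J\<close> and \<open>y\<close>
  may be treated as free variables.\<close>

lemma pot_second_order:
  "- (pot2 C s + (real n - 1) * (r1 s / r s) * pot1 C s) * (r s)\<^sup>2 + r s * r1 s * pot1 C s
     - pot C s * ((real n - 2) * (1 - (r1 s)\<^sup>2) - r s * r2 s) = (r s)\<^sup>2"
proof -
  define d J x y k p where abbr: "d = real n - 1" "J = i0 s + C" "x = r s" "y = r1 s" "k = \<kappa> + z s" "p = z s"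
  have nz: "d \<noteq> 0" "x \<noteq> 0" "k \<noteq> 0"
    using n3 r_pos[of s] kz_pos[of s] by (auto simp: abbr)
  have bracket: "(real n - 2) * (1 - (r1 s)\<^sup>2) - r s * r2 s = x\<^sup>2 * ((d + 1) * p - d * k)"
    unfolding r1_square r2_def abbr by (simp add: algebra_simps power2_eq_square)
  have scaled: "d * pot C s = 1 / k - y * J" "d * pot1 C s = - (x * k) * J"
    "d * pot2 C s = - (y * (k - (d + 1) * p) * J + (d + 1) * p / k)"
    unfolding abbr pot_scaled pot1_scaled pot2_scaled r2_def by (simp_all add: algebra_simps)
  have "d * (- (pot2 C s + d * (y / x) * pot1 C s) * x\<^sup>2 + x * y * pot1 C s - pot C s * (x\<^sup>2 * ((d + 1) * p - d * k)))
    = - (d * pot2 C s + d * (y / x) * (d * pot1 C s)) * x\<^sup>2 + x * y * (d * pot1 C s)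
      - (d * pot C s) * (x\<^sup>2 * ((d + 1) * p - d * k))"
    by (simp add: algebra_simps)
  also have "\<dots> = d * x\<^sup>2"
    unfolding scaled using nz by (simp add: field_simps power2_eq_square)
  finally have "- (pot2 C s + d * (y / x) * pot1 C s) * x\<^sup>2 + x * y * pot1 C s
     - pot C s * (x\<^sup>2 * ((d + 1) * p - d * k)) = x\<^sup>2"
    using nz(1) by simp
  then show ?thesis unfolding bracket by (simp add: abbr)
qed

lemma pot_even: "pot 0 (- s) = pot 0 s"
  by (simp add: pot_def z_even r1_odd i0_odd)

lemma C_diff_pot: "C_diff k UNIV (pot C)"
proof -
  have U: "open (UNIV :: real set)" by simp
  show ?thesis
    unfolding pot_def[abs_def]
    by (intro C_diff_divide C_diff_diff C_diff_mult C_diff_add C_diff_const C_diff_z C_diff_i0 U)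
       (use C_diff_profile kz_pos n3 in \<open>auto simp: less_imp_neq[symmetric]\<close>)
qed

section \<open>Zeros of the potentials\<close>

definition "q s = (real n - 1) * pot 0 s / r1 s"

text \<open>(n - 1) \<open>pot C\<close> is (n - 1) \<open>pot 0\<close> minus C r', so division by
  r' isolates C. At the horizon r' vanishes: there \<open>q\<close> has only a default value, and no
  potential has a zero.\<close>

lemma pot_eq_0_iff: "s \<noteq> 0 \<Longrightarrow> pot C s = 0 \<longleftrightarrow> q s = C"
proof -
  assume "s \<noteq> 0"
  then have "r1 s \<noteq> 0" using r1_pos[of s] r1_neg[of s] by (cases "0 < s") auto
  moreover have "q s = (1 / (\<kappa> + z s) - r1 s * i0 s) / r1 s"
    unfolding q_def pot_scaled by simp
  ultimately have "q s = C \<longleftrightarrow> (real n - 1) * pot C s = 0"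
    unfolding pot_scaled by (auto simp: nonzero_divide_eq_eq algebra_simps)
  then show ?thesis using n3 by auto
qed

lemma q_odd: "q (- s) = - q s"
  by (simp add: q_def pot_even r1_odd)

lemma q_eq: "q s = 1 / ((\<kappa> + z s) * r1 s) - i0 s" if "0 < s"
  using r1_pos[OF that] unfolding q_def pot_scaled by (simp add: diff_divide_distrib)

text \<open>The quotient rule has the numerator (n - 1) (l' r' - l r''), which is - r by
  \<open>pot_first_order\<close>.\<close>

lemma q_deriv:
  assumes "0 < s" shows "(q has_real_derivative - r s / (r1 s)\<^sup>2) (at s)"
proof -
  have "(q has_real_derivative ((real n - 1) * pot1 0 s * r1 s - (real n - 1) * pot 0 s * r2 s) / (r1 s * r1 s)) (at s)"
    unfolding q_def[abs_def] using r1_pos[OF assms]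
    by (auto intro!: derivative_eq_intros pot_deriv r1_deriv)
  then show ?thesis
    using pot_first_order[of s 0] by (simp add: algebra_simps power2_eq_square)
qed

lemma q_strict_antimono: "0 < s \<Longrightarrow> s < t \<Longrightarrow> q t < q s"
proof (rule DERIV_neg_imp_decreasing[of s t])
  show "\<exists>y. DERIV q x :> y \<and> y < 0" if "0 < s" "s \<le> x" for x
    using q_deriv[of x] r_pos[of x] r1_pos[of x] that by (intro exI[of _ "- r x / (r1 x)\<^sup>2"]) auto
qed auto

lemma q_surj_between:
  assumes "0 < s" "0 < t" "q t \<le> y" "y \<le> q s"
  obtains u where "0 < u" "q u = y"
proof (cases "s \<le> t")
  case True
  have "continuous_on {s..t} q"
    using assms(1) DERIV_isCont[OF q_deriv] by (intro continuous_at_imp_continuous_on) auto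
  with IVT2'[OF assms(3,4) True] obtain u where "s \<le> u" "q u = y" by blast
  then show ?thesis using assms(1) by (intro that[of u]) auto
next
  case False
  \<comment> \<open>A contradictory case: q t \<le> q s rules out t < s.\<close>
  then have "q s < q t" using q_strict_antimono assms(2) by simp
  then show ?thesis using assms by (intro that[of s]) auto
qed

text \<open>The integrand is dominated by c r' / r^2, the derivative of - c / r; so I + c / r does
  not increase from s = 1 on. Starting at 1 keeps r' away from 0.\<close>

lemma i0_bounded: "\<exists>M. \<forall>s. i0 s \<le> M"
proof -
  obtain m where m: "n = Suc m" using n3 by (cases n) auto
  define B where "B = a * inverse (r 0) ^ m"
  \<comment> \<open>Collects three bounds: r z is at most B, \<kappa> + z at least \<kappa>, and r'
    at least its value at 1.\<close>
  define c where "c = real n * B / (\<kappa>\<^sup>2 * r1 1)"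
  have r11: "0 < r1 1" by (simp add: r1_pos)
  have B: "0 < B" using a_pos r_pos[of 0] by (simp add: B_def)
  have c: "0 < c" using B n3 kappa_pos r11 by (simp add: c_def)
  have J: "i0 t + c / r t \<le> i0 1 + c / r 1" if t: "1 \<le> t" for t
  proof (rule DERIV_nonpos_imp_nonincreasing[of 1 t "\<lambda>t. i0 t + c / r t", OF t])
    fix x :: real assume x: "1 \<le> x"
    have "((\<lambda>t. i0 t + c / r t) has_real_derivative i1 x - c * r1 x / (r x)\<^sup>2) (at x)"
      using r_pos[of x] by (auto intro!: derivative_eq_intros i0_deriv r_deriv simp: power2_eq_square)
    moreover have "i1 x \<le> c * r1 x / (r x)\<^sup>2"
    proof -
      have "inverse (r x) ^ m \<le> inverse (r 0) ^ m"
        using r_ge_r0[of x] r_pos[of 0] by (intro power_mono) auto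
      then have "a * inverse (r x) ^ m \<le> B"
        unfolding B_def using a_pos by (intro mult_left_mono) auto
      moreover have "inverse (r x) ^ n * r x = inverse (r x) ^ m"
        using r_pos[of x] by (simp add: m)
      ultimately have "z x * r x \<le> B"
        unfolding z_def mult.assoc by simp
      have "i1 x = real n * (z x * r x) / ((r x)\<^sup>2 * (\<kappa> + z x)\<^sup>2)"
        using r_pos[of x] unfolding i1_def by (simp add: power2_eq_square)
      also have "\<dots> \<le> real n * B / ((r x)\<^sup>2 * \<kappa>\<^sup>2)"
        using \<open>z x * r x \<le> B\<close> B kappa_pos z_pos[of x] r_pos[of x]
        by (intro frac_le mult_left_mono power_mono mult_pos_pos) auto
      also have "\<dots> = c * r1 1 / (r x)\<^sup>2"
        using r11 kappa_pos by (simp add: c_def)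
      also have "\<dots> \<le> c * r1 x / (r x)\<^sup>2"
        using c r1_strict_mono[of 1 x] x by (intro divide_right_mono mult_left_mono) (cases "x = 1"; auto)+
      finally show ?thesis .
    qed
    ultimately show "\<exists>y. ((\<lambda>t. i0 t + c / r t) has_real_derivative y) (at x) \<and> y \<le> 0"
      by (intro exI conjI) auto
  qed
  have "i0 s \<le> i0 1 + c / r 1" for s
  proof (cases "1 \<le> s")
    case True
    have "0 < c / r s" using c r_pos[of s] by simp
    with J[OF True] show ?thesis by linarith
  next
    case False
    have "0 < c / r 1" using c r_pos[of 1] by simp
    with False i0_strict_mono[of s 1] show ?thesis by linarith
  qed
  then show ?thesis by blast
qed

lemma q_bounded_below: "bdd_below (q ` {0<..})"
proof -
  obtain M where M: "\<And>s. i0 s \<le> M" using i0_bounded by blast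
  have "- M \<le> q s" if "0 < s" for s
  proof -
    have "0 < 1 / ((\<kappa> + z s) * r1 s)" using kz_pos r1_pos[OF that] by simp
    with M[of s] show ?thesis unfolding q_eq[OF that] by linarith
  qed
  then show ?thesis by (intro bdd_belowI[of _ "- M"]) auto
qed

text \<open>Near the horizon r' tends to 0, so 1 / ((\<kappa> + z) r') blows up, while
  \<open>i0\<close> stays below \<open>i0 1\<close>.\<close>

lemma q_unbounded_above: "\<exists>s>0. K < q s"
proof -
  \<comment> \<open>Chosen so that r' < c and z \<le> z 0 make the first term of \<open>q\<close> at
    least |K| + i0 1 + 1.\<close>
  define c where "c = 1 / ((\<kappa> + z 0) * (\<bar>K\<bar> + i0 1 + 1))"
  have "0 < i0 1" using i0_strict_mono[of 0 1] by (simp add: i0_0)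
  then have c: "0 < c" using kz_pos[of 0] by (simp add: c_def)
  have "isCont r1 0" using r1_deriv DERIV_isCont by blast
  then have "\<forall>\<^sub>F s in at_right 0. r1 s < c"
    using c r1_0 by (intro order_tendstoD(2)[of _ "r1 0"]) (auto simp: isCont_def intro: tendsto_within_subset)
  moreover have "\<forall>\<^sub>F s in at_right 0. 0 < s \<and> s < (1::real)"
    by (auto simp: eventually_at_right_field intro: exI[of _ 1])
  ultimately have "\<forall>\<^sub>F s in at_right 0. r1 s < c \<and> 0 < s \<and> s < 1"
    by eventually_elim auto
  then obtain s where s: "r1 s < c" "0 < s" "s < 1"
    using eventually_happens trivial_limit_at_right_real by blast
  have "z s \<le> z 0"
    unfolding z_def using a_pos r_ge_r0[of s] r_pos[of 0] by (intro mult_left_mono power_mono) auto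
  then have "(\<kappa> + z s) * r1 s \<le> (\<kappa> + z 0) * c"
    using s r1_pos[OF s(2)] kz_pos[of 0] by (intro mult_mono) auto
  then have "1 / ((\<kappa> + z 0) * c) \<le> 1 / ((\<kappa> + z s) * r1 s)"
    using kz_pos[of s] r1_pos[OF s(2)] by (intro frac_le) auto
  moreover have "1 / ((\<kappa> + z 0) * c) = \<bar>K\<bar> + i0 1 + 1"
    using kz_pos[of 0] by (simp add: c_def)
  moreover have "i0 s < i0 1" using i0_strict_mono s by simp
  ultimately have "K < q s" unfolding q_eq[OF s(2)] by linarith
  with s show ?thesis by blast
qed

text \<open>As r'' is at least \<kappa> r 0, r' grows at least linearly; the first term of
  \<open>q\<close> drops below \<open>i0 1\<close>, which \<open>i0\<close> exceeds beyond s =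
  1.\<close>

lemma q_negative: "\<exists>s>0. q s < 0"
proof -
  have i01: "0 < i0 1" using i0_strict_mono[of 0 1] by (simp add: i0_0)
  define c where "c = \<kappa> * r 0"
  have c: "0 < c" using kappa_pos r_pos by (simp add: c_def)
  have lin: "c * s \<le> r1 s" if "0 \<le> s" for s
  proof -
    have "r1 0 - c * 0 \<le> r1 s - c * s"
    proof (rule DERIV_nonneg_imp_nondecreasing[of 0 s "\<lambda>s. r1 s - c * s", OF that])
      fix x
      have "\<kappa> * r 0 \<le> (\<kappa> + z x) * r x"
        using kappa_pos z_pos[of x] r_ge_r0[of x] r_pos[of 0] by (intro mult_mono) auto
      then have "0 \<le> r2 x - c" by (simp add: r2_def c_def mult.commute)
      moreover have "((\<lambda>s. r1 s - c * s) has_real_derivative r2 x - c) (at x)"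
        by (auto intro!: derivative_eq_intros r1_deriv)
      ultimately show "\<exists>y. ((\<lambda>s. r1 s - c * s) has_real_derivative y) (at x) \<and> 0 \<le> y" by blast
    qed
    then show ?thesis by (simp add: r1_0)
  qed
  \<comment> \<open>Then \<kappa> c s = \<kappa> c + 1 / i0 1, which exceeds 1 / i0 1; the summand 1
    ensures s > 1.\<close>
  define s where "s = 1 + 1 / (\<kappa> * c * i0 1)"
  have ks: "0 < 1 / (\<kappa> * c * i0 1)" using kappa_pos c i01 by simp
  then have s: "1 < s" by (simp add: s_def)
  have "1 / i0 1 < \<kappa> * (c * s)"
    using kappa_pos c i01 by (simp add: s_def field_simps)
  also have "\<dots> \<le> (\<kappa> + z s) * r1 s"
    using kappa_pos z_pos[of s] lin[of s] s c by (intro mult_mono) auto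
  finally have "1 / i0 1 < (\<kappa> + z s) * r1 s" .
  moreover have "0 < (\<kappa> + z s) * r1 s" using kz_pos[of s] r1_pos[of s] s by simp
  ultimately have "1 / ((\<kappa> + z s) * r1 s) < i0 1"
    using i01 by (simp only: divide_less_eq mult.commute) simp
  also have "i0 1 < i0 s" using i0_strict_mono s by simp
  finally show ?thesis using q_eq[of s] s by (intro exI[of _ s]) auto
qed

theorem zeros_of_potentials:
  obtains \<zeta> \<theta> where "0 < \<zeta>" "\<zeta> < \<theta>" "pot 0 \<theta> = 0"
    "\<And>s. \<zeta> < \<bar>s\<bar> \<Longrightarrow> \<exists>t C. \<zeta> < \<bar>t\<bar> \<and> s * t < 0 \<and> pot C s = 0 \<and> pot C t = 0"
proof -
  define m where "m = Inf (q ` {0<..})"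
  \<comment> \<open>The infimum is not attained, since \<open>q\<close> is smaller still one unit
    further out.\<close>
  have less: "m < q s" if "0 < s" for s
  proof -
    have "m \<le> q (s + 1)"
      unfolding m_def using q_bounded_below that by (intro cInf_lower) auto
    with q_strict_antimono[OF that, of "s + 1"] show ?thesis by simp
  qed
  have surj: "\<exists>s>0. q s = y" if y: "m < y" for y
  proof -
    have "q ` {0<..} \<noteq> {}"
      by (metis empty_iff greaterThan_iff image_is_empty zero_less_one)
    then obtain t where "0 < t" "q t < y"
      using y q_bounded_below cInf_less_iff[of "q ` {0<..}" y] unfolding m_def by auto
    moreover obtain s where "0 < s" "y < q s" using q_unbounded_above by blast
    ultimately show ?thesis using q_surj_between[of s t y] by (metis less_imp_le)
  qed
  have "m < 0" using q_negative less by force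
  then obtain \<zeta> \<theta> where \<zeta>: "0 < \<zeta>" "q \<zeta> = - m" and \<theta>: "0 < \<theta>" "q \<theta> = 0"
    using surj[of "- m"] surj[of 0] by auto
  have anti: "s < t" if "q t < q s" "0 < s" "0 < t" for s t
    using q_strict_antimono[of t s] that by (cases s t rule: linorder_cases) auto
  \<comment> \<open>The value q s lies in the symmetric interval (m, - m), so - q s is also
    attained; being less than q \<zeta> = - m, it is attained beyond \<zeta>.\<close>
  have pos: "\<exists>t>\<zeta>. q t = - q s" if "\<zeta> < s" for s
  proof -
    have "q s < - m" "m < q s" using q_strict_antimono[OF \<zeta>(1) that] less \<zeta> that by auto
    then obtain t where "0 < t" "q t = - q s" using surj[of "- q s"] by auto
    moreover have "\<zeta> < t" using anti[of t \<zeta>] calculation \<zeta> \<open>m < q s\<close> by simp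
    ultimately show ?thesis by blast
  qed
  show ?thesis
  proof (rule that[OF \<zeta>(1)])
    show "\<zeta> < \<theta>" using anti[of \<theta> \<zeta>] \<zeta> \<theta> \<open>m < 0\<close> by simp
    show "pot 0 \<theta> = 0" using pot_eq_0_iff[of \<theta> 0] \<theta> by simp
    fix s assume s: "\<zeta> < \<bar>s\<bar>"
    obtain t where t: "\<zeta> < t" "q t = - q \<bar>s\<bar>" using pos[OF s] by blast
    \<comment> \<open>The partner is placed on the side opposite to s; oddness of \<open>q\<close>
      turns q t = - q |s| into q u = q s.\<close>
    define u where "u = (if 0 < s then - t else t)"
    have "q u = q s" using t(2) s \<zeta>(1) by (auto simp: u_def q_odd abs_if split: if_splits)
    moreover have "s * u < 0" "\<zeta> < \<bar>u\<bar>" using s t(1) \<zeta>(1) by (auto simp: u_def mult_less_0_iff)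
    moreover from this have "s \<noteq> 0" "u \<noteq> 0" by auto
    ultimately have "\<zeta> < \<bar>u\<bar> \<and> s * u < 0 \<and> pot (q s) s = 0 \<and> pot (q s) u = 0"
      by (simp add: pot_eq_0_iff)
    then show "\<exists>t C. \<zeta> < \<bar>t\<bar> \<and> s * t < 0 \<and> pot C s = 0 \<and> pot C t = 0"
      by blast
  qed
qed

end

section \<open>The topology of a manifold given by an atlas\<close>

text \<open>\<open>topology\<close> returns the intended open sets only for a family known to be a
  topology; here intersections and unions pass through the preimages under charts.\<close>

lemma openin_manifold_topology:
  "openin (manifold_topology X A) U \<longleftrightarrow>
     U \<subseteq> X \<and> (\<forall>(D, \<phi>)\<in>A. openin (top_of_set D) {x\<in>D. \<phi> x \<in> U})"
proof -
  have "istopology (\<lambda>U. U \<subseteq> X \<and> (\<forall>(D, \<phi>)\<in>A. openin (top_of_set D) {x\<in>D. \<phi> x \<in> U}))"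
    unfolding istopology_def
  proof (intro conjI allI impI)
    fix S T assume S: "S \<subseteq> X \<and> (\<forall>(D, \<phi>)\<in>A. openin (top_of_set D) {x\<in>D. \<phi> x \<in> S})"
      and T: "T \<subseteq> X \<and> (\<forall>(D, \<phi>)\<in>A. openin (top_of_set D) {x\<in>D. \<phi> x \<in> T})"
    have "{x\<in>D. \<phi> x \<in> S \<inter> T} = {x\<in>D. \<phi> x \<in> S} \<inter> {x\<in>D. \<phi> x \<in> T}" for D and \<phi> :: "real^'b \<Rightarrow> 'a"
      by auto
    with S T show "S \<inter> T \<subseteq> X" "\<forall>(D, \<phi>)\<in>A. openin (top_of_set D) {x\<in>D. \<phi> x \<in> S \<inter> T}"
      by (auto intro!: openin_Int)
  next
    fix \<K> assume K: "\<forall>U\<in>\<K>. U \<subseteq> X \<and> (\<forall>(D, \<phi>)\<in>A. openin (top_of_set D) {x\<in>D. \<phi> x \<in> U})"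
    have "{x\<in>D. \<phi> x \<in> \<Union>\<K>} = (\<Union>U\<in>\<K>. {x\<in>D. \<phi> x \<in> U})" for D and \<phi> :: "real^'b \<Rightarrow> 'a"
      by auto
    with K show "\<Union>\<K> \<subseteq> X" "\<forall>(D, \<phi>)\<in>A. openin (top_of_set D) {x\<in>D. \<phi> x \<in> \<Union>\<K>}"
      by (auto intro!: openin_Union)
  qed
  then show ?thesis
    unfolding manifold_topology_def by (simp only: topology_inverse')
qed

lemma topspace_manifold_topology:
  assumes "\<And>D \<phi>. (D, \<phi>) \<in> A \<Longrightarrow> \<phi> ` D \<subseteq> X"
  shows "topspace (manifold_topology X A) = X"
proof -
  have "{x\<in>D. \<phi> x \<in> X} = D" if "(D, \<phi>) \<in> A" for D \<phi>
    using assms[OF that] by auto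
  then have "openin (manifold_topology X A) X"
    unfolding openin_manifold_topology by auto
  moreover have "U \<subseteq> X" if "openin (manifold_topology X A) U" for U
    using that unfolding openin_manifold_topology by blast
  ultimately show ?thesis unfolding topspace_def by blast
qed

text \<open>Separation is inherited along a continuous injection into a metric space, so points in
  different charts need no separate treatment.\<close>

lemma Hausdorff_manifold_topology:
  fixes f :: "'p \<Rightarrow> 'c::metric_space"
  assumes X: "\<And>D \<phi>. (D, \<phi>) \<in> A \<Longrightarrow> \<phi> ` D \<subseteq> X"
    and f: "inj_on f X" "\<And>D \<phi>. (D, \<phi>) \<in> A \<Longrightarrow> continuous_on D (\<lambda>x. f (\<phi> x))"
  shows "Hausdorff_space (manifold_topology X A)"
proof (rule Hausdorff_space_injective_preimage)
  have top: "topspace (manifold_topology X A) = X"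
    using X by (rule topspace_manifold_topology)
  show "Hausdorff_space (euclidean :: 'c topology)" by (rule Hausdorff_space_euclidean)
  show "inj_on f (topspace (manifold_topology X A))" using f(1) by (simp add: top)
  have pre: "openin (manifold_topology X A) {x \<in> X. f x \<in> U}" if U: "open U" for U
  proof -
    have "openin (top_of_set D) {x \<in> D. \<phi> x \<in> {x \<in> X. f x \<in> U}}" if c: "(D, \<phi>) \<in> A" for D \<phi>
    proof -
      have "{x \<in> D. \<phi> x \<in> {x \<in> X. f x \<in> U}} = D \<inter> (\<lambda>x. f (\<phi> x)) -` U"
        using X[OF c] by auto
      then show ?thesis
        using continuous_openin_preimage_gen[OF f(2)[OF c] U] by simp
    qed
    then show ?thesis
      unfolding openin_manifold_topology by auto
  qed
  then show "continuous_map (manifold_topology X A) euclidean f"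
    unfolding continuous_map_def top by simp
qed

text \<open>X is the continuous image of the compact K: continuity of \<pi> is local, and near each
  point of K it coincides with a chart.\<close>

lemma compact_manifold_topology:
  fixes \<pi> :: "real^'n \<Rightarrow> 'p"
  assumes X: "\<And>D \<phi>. (D, \<phi>) \<in> A \<Longrightarrow> \<phi> ` D \<subseteq> X"
    and K: "compact K" "\<pi> ` K = X"
    and cover: "\<And>x. x \<in> K \<Longrightarrow> \<exists>D \<phi>. (D, \<phi>) \<in> A \<and> x \<in> D \<and> openin (top_of_set K) D \<and> (\<forall>y\<in>D. \<phi> y = \<pi> y)"
  shows "compact_space (manifold_topology X A)"
proof -
  have top: "topspace (manifold_topology X A) = X"
    using X by (rule topspace_manifold_topology)
  have "openin (top_of_set K) {x \<in> K. \<pi> x \<in> U}" if U: "openin (manifold_topology X A) U" for U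
  proof -
    have "\<exists>T. openin (top_of_set K) T \<and> x \<in> T \<and> T \<subseteq> {x \<in> K. \<pi> x \<in> U}"
      if "x \<in> {x \<in> K. \<pi> x \<in> U}" for x
    proof -
      from that have x: "x \<in> K" "\<pi> x \<in> U" by auto
      then obtain D \<phi> where D: "(D, \<phi>) \<in> A" "x \<in> D" "openin (top_of_set K) D" "\<forall>y\<in>D. \<phi> y = \<pi> y"
        using cover by blast
      have "openin (top_of_set D) {y \<in> D. \<phi> y \<in> U}"
        using U D(1) unfolding openin_manifold_topology by auto
      then have "openin (top_of_set K) {y \<in> D. \<phi> y \<in> U}"
        using D(3) by (rule openin_trans)
      moreover have "D \<subseteq> K" using D(3) openin_imp_subset by blast
      ultimately show ?thesis
        using x D by (intro exI[of _ "{y \<in> D. \<phi> y \<in> U}"]) auto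
    qed
    then show ?thesis by (subst openin_subopen) blast
  qed
  then have "continuous_map (top_of_set K) (manifold_topology X A) \<pi>"
    unfolding continuous_map_def top using K by auto
  from image_compactin[OF _ this, of K] K show ?thesis
    by (simp add: compact_space_def top compactin_subtopology)
qed

section \<open>Polar coordinates\<close>

lemma polar_cartesian: "norm u = 1 \<Longrightarrow> polar (exp s *\<^sub>R u) = (s, u)"
  by (simp add: polar_def)

lemma cartesian_polar: "x \<noteq> 0 \<Longrightarrow> exp (fst (polar x)) *\<^sub>R snd (polar x) = x"
  by (simp add: polar_def)

lemma polar_inject: "x \<noteq> 0 \<Longrightarrow> y \<noteq> 0 \<Longrightarrow> polar x = polar y \<longleftrightarrow> x = y"
  by (metis cartesian_polar)

lemma norm_snd_polar: "x \<noteq> 0 \<Longrightarrow> norm (snd (polar x)) = 1"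
  by (simp add: polar_def)

lemma continuous_on_polar: "D \<subseteq> - {0} \<Longrightarrow> continuous_on D polar"
  unfolding polar_def[abs_def] by (auto intro!: continuous_intros)

lemma has_derivative_polar:
  fixes x :: "real^'n"
  assumes "x \<noteq> 0"
  shows "(polar has_derivative
    (\<lambda>v. ((x \<bullet> v) / (x \<bullet> x), v /\<^sub>R norm x - ((x \<bullet> v) / norm x ^ 3) *\<^sub>R x))) (at x)"
  unfolding polar_def[abs_def]
proof (rule has_derivative_Pair[OF has_derivative_ln_norm[OF assms]])
  have "((\<lambda>x. inverse (norm x)) has_derivative (\<lambda>v. - (x \<bullet> v) / norm x ^ 3)) (at x)"
    using assms
    by (auto intro!: derivative_eq_intros has_derivative_norm
        simp: sgn_div_norm inner_commute power3_eq_cube field_simps)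
  from has_derivative_scaleR[OF this has_derivative_ident]
  show "((\<lambda>x. x /\<^sub>R norm x) has_derivative (\<lambda>v. v /\<^sub>R norm x - ((x \<bullet> v) / norm x ^ 3) *\<^sub>R x)) (at x)"
    by simp
qed

lemma pullback_coeffs_polar:
  fixes x :: "real^'n"
  assumes "x \<noteq> 0"
  shows "pullback_coeffs r polar x = polar_metric r x"
proof -
  have e: "(v /\<^sub>R norm x - ((x \<bullet> v) / norm x ^ 3) *\<^sub>R x) \<bullet> (w /\<^sub>R norm x - ((x \<bullet> w) / norm x ^ 3) *\<^sub>R x)
      = v \<bullet> w / (x \<bullet> x) - (x \<bullet> v) * (x \<bullet> w) / (x \<bullet> x)\<^sup>2" for v w
  proof -
    have n: "norm x \<noteq> 0" "x \<bullet> x = norm x ^ 2" using assms by (auto simp: power2_norm_eq_inner)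
    show ?thesis
      unfolding inner_diff_left inner_diff_right inner_scaleR_left inner_scaleR_right n(2)
      using n(1) by (simp add: inner_commute[of _ x] divide_simps power2_eq_square power3_eq_cube)
  qed
  show ?thesis
    unfolding pullback_coeffs_def warped_metric_def frechet_derivative_at[OF has_derivative_polar[OF assms], symmetric] fst_conv snd_conv e
    using assms by (simp add: polar_metric_def polar_def vec_eq_iff inner_axis axis_nth inner_axis_axis kron_def field_simps power2_eq_square)
qed

text \<open>The flip is linear, hence its own derivative, and its signs cancel in the bilinear form;
  only r (- s) = r s is left to use.\<close>

lemma pullback_coeffs_antipodal_flip:
  fixes x :: "real^'n"
  assumes "x \<noteq> 0" "\<And>s. r (- s) = r s"
  shows "pullback_coeffs r (antipodal_flip \<circ> polar) x = pullback_coeffs r polar x"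
proof -
  have "(antipodal_flip has_derivative antipodal_flip) (at p)" for p :: "real \<times> (real^'n)"
    unfolding antipodal_flip_def[abs_def] by (auto intro!: derivative_eq_intros simp: split_beta)
  from diff_chain_at[OF has_derivative_polar[OF assms(1)] this]
  have d: "frechet_derivative (antipodal_flip \<circ> polar) (at x) = antipodal_flip \<circ> frechet_derivative polar (at x)"
    using frechet_derivative_at[OF has_derivative_polar[OF assms(1)]] frechet_derivative_at by metis
  show ?thesis
    unfolding pullback_coeffs_def warped_metric_def d by (simp add: antipodal_flip_def assms(2))
qed

lemma polar_metric_bilinear:
  fixes x :: "real^'n"
  shows "v \<bullet> (polar_metric r x *v w) = (r (ln (norm x)))\<^sup>2 / (x \<bullet> x) * (v \<bullet> w)
     + (1 - (r (ln (norm x)))\<^sup>2) / (x \<bullet> x)\<^sup>2 * ((x \<bullet> v) * (x \<bullet> w))"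
proof -
  define a b where "a = (r (ln (norm x)))\<^sup>2 / (x \<bullet> x)" and "b = (1 - (r (ln (norm x)))\<^sup>2) / (x \<bullet> x)\<^sup>2"
  have "(polar_metric r x *v w) $ i = a * w $ i + (b * (x \<bullet> w)) * x $ i" for i
  proof -
    have "(\<Sum>j\<in>UNIV. (a * kron i j + b * (x $ i * x $ j)) * w $ j)
        = (\<Sum>j\<in>UNIV. kron i j * (a * w $ j) + (b * x $ i) * (x $ j * w $ j))"
      by (intro sum.cong refl) (simp add: algebra_simps)
    also have "\<dots> = a * w $ i + (b * x $ i) * (x \<bullet> w)"
      by (simp only: sum.distrib sum_kron sum_distrib_left[symmetric] inner_vec_def inner_real_def)
    finally show ?thesis
      by (simp add: matrix_vector_mult_def polar_metric_def a_def b_def mult_ac)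
  qed
  then have "polar_metric r x *v w = a *\<^sub>R w + (b * (x \<bullet> w)) *\<^sub>R x"
    by (simp add: vec_eq_iff)
  then show ?thesis
    by (simp add: inner_add_right inner_commute a_def b_def)
qed

lemma polar_metric_symmetric: "transpose (polar_metric r x) = polar_metric r x"
  by (simp add: transpose_def polar_metric_def vec_eq_iff kron_sym mult.commute)

text \<open>The form splits into a spherical part, nonnegative by Cauchy-Schwarz, and the radial
  part c^2 / N^2; the second vanishes only for c = 0, when the first is positive.\<close>

lemma polar_metric_positive:
  fixes x :: "real^'n"
  assumes "x \<noteq> 0" "0 < r (ln (norm x))" "v \<noteq> 0"
  shows "0 < v \<bullet> (polar_metric r x *v v)"
proof -
  define N \<rho> c where "N = x \<bullet> x" and "\<rho> = r (ln (norm x))" and "c = x \<bullet> v"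
  have N: "0 < N" using assms by (simp add: N_def)
  have "c\<^sup>2 \<le> N * (v \<bullet> v)"
    unfolding c_def N_def by (rule Cauchy_Schwarz_ineq)
  then have 1: "0 \<le> \<rho>\<^sup>2 / N\<^sup>2 * (N * (v \<bullet> v) - c\<^sup>2)" by simp
  have "v \<bullet> (polar_metric r x *v v) = \<rho>\<^sup>2 / N\<^sup>2 * (N * (v \<bullet> v) - c\<^sup>2) + c\<^sup>2 / N\<^sup>2"
    unfolding polar_metric_bilinear N_def[symmetric] \<rho>_def[symmetric] c_def[symmetric]
    using N by (simp add: field_simps power2_eq_square)
  moreover have "0 < c\<^sup>2 / N\<^sup>2" if "c \<noteq> 0" using that N by simp
  moreover have "0 < \<rho>\<^sup>2 / N\<^sup>2 * (N * (v \<bullet> v) - c\<^sup>2)" if "c = 0"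
    using that N assms by (simp add: \<rho>_def)
  ultimately show ?thesis using 1 by (cases "c = 0") auto
qed

lemma C_diff_polar_metric:
  fixes r :: "real \<Rightarrow> real"
  assumes "\<And>k. C_diff k UNIV r"
  shows "C_diff k (- {0}) (polar_metric r :: real^'n \<Rightarrow> _)"
proof -
  have o: "open (- {0 :: real^'n})" by auto
  show ?thesis
    by (rule C_diff_matrix[OF o], simp add: polar_metric_def,
        intro C_diff_add C_diff_mult C_diff_divide C_diff_power C_diff_diff C_diff_const
          C_diff_inner_self C_diff_component C_diff_compose_real[OF o C_diff_ln_norm assms] o)
       auto
qed

text \<open>The change of coordinates between two charts of the antipodal quotient, where it is not the
  identity.\<close>

definition antiinversion :: "real^'n \<Rightarrow> real^'n" where
  "antiinversion x = - (x /\<^sub>R (x \<bullet> x))"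

lemma antiinversion_nonzero: "x \<noteq> 0 \<Longrightarrow> antiinversion x \<noteq> 0"
  by (simp add: antiinversion_def)

lemma norm_antiinversion: "norm (antiinversion x) = inverse (norm x)"
  by (cases "x = 0") (simp_all add: antiinversion_def power2_norm_eq_inner[symmetric] power2_eq_square)

lemma inner_antiinversion_self: "antiinversion x \<bullet> antiinversion x = inverse (x \<bullet> x)"
  by (simp add: power2_norm_eq_inner[symmetric] norm_antiinversion power_inverse)

lemma inner_antiinversion: "e \<bullet> antiinversion x = - (e \<bullet> x) / (x \<bullet> x)"
  by (simp add: antiinversion_def divide_inverse mult.commute)

lemma polar_antiinversion: "x \<noteq> 0 \<Longrightarrow> polar (antiinversion x) = antipodal_flip (polar x)"
  unfolding polar_def norm_antiinversion antipodal_flip_def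
  by (simp add: ln_inverse antiinversion_def power2_norm_eq_inner[symmetric] power2_eq_square)

lemma has_derivative_antiinversion:
  fixes x :: "real^'n"
  assumes "x \<noteq> 0"
  shows "(antiinversion has_derivative
    (\<lambda>v. (2 * (x \<bullet> v) / (x \<bullet> x)\<^sup>2) *\<^sub>R x - (1 / (x \<bullet> x)) *\<^sub>R v)) (at x)"
proof -
  have "((\<lambda>x. 1 / (x \<bullet> x)) has_derivative (\<lambda>v. - 2 * (x \<bullet> v) / (x \<bullet> x)\<^sup>2)) (at x)"
    using has_derivative_inner_self_power[OF assms, of 1] by (simp add: power2_eq_square)
  from has_derivative_minus[OF has_derivative_scaleR[OF this has_derivative_ident]]
  show ?thesis by (simp add: antiinversion_def[abs_def] divide_inverse_commute)
qed

lemma C_diff_antiinversion: "C_diff k (- {0}) (antiinversion :: real^'n \<Rightarrow> _)"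
proof -
  have o: "open (- {0 :: real^'n})" by auto
  have "C_diff k (- {0}) (\<lambda>x :: real^'n. (- 1) * (x $ i / (x \<bullet> x)))" for i
    by (intro C_diff_cmult C_diff_divide C_diff_component C_diff_inner_self o) auto
  then show ?thesis
    by (intro C_diff_vec o) (simp add: antiinversion_def divide_inverse mult.commute)
qed

text \<open>\<open>J\<close> is the derivative of \<open>antiinversion\<close> at x and scales inner
  products by |x|^(-4). As ln |x| only changes sign, evenness of r makes the map an
  isometry.\<close>

lemma polar_metric_antiinversion:
  fixes x :: "real^'n"
  assumes "x \<noteq> 0" "\<And>s. r (- s) = r s"
  defines "J \<equiv> \<lambda>v. (2 * (x \<bullet> v) / (x \<bullet> x)\<^sup>2) *\<^sub>R x - (1 / (x \<bullet> x)) *\<^sub>R v"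
  shows "J v \<bullet> (polar_metric r (antiinversion x) *v J w) = v \<bullet> (polar_metric r x *v w)"
proof -
  define N where "N = x \<bullet> x"
  have N: "N \<noteq> 0" using assms by (simp add: N_def)
  have 1: "r (ln (norm (antiinversion x))) = r (ln (norm x))"
    using assms by (simp add: norm_antiinversion ln_inverse)
  have 2: "J v \<bullet> J w = (v \<bullet> w) / N\<^sup>2"
    unfolding J_def inner_diff_left inner_diff_right inner_scaleR_left inner_scaleR_right N_def[symmetric]
    using N by (simp add: inner_commute[of _ x] field_simps power2_eq_square)
  have 3: "antiinversion x \<bullet> J v = - (x \<bullet> v) / N\<^sup>2" for v
    unfolding J_def antiinversion_def inner_minus_left inner_diff_right inner_scaleR_left inner_scaleR_right N_def[symmetric]
    using N by (simp add: field_simps power2_eq_square)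
  show ?thesis
    unfolding polar_metric_bilinear 1 2 3 inner_antiinversion_self N_def[symmetric]
    using N by (simp add: field_simps power2_eq_square)
qed

section \<open>Critical metrics on rotationally symmetric domains\<close>

lemma polar_shell:
  "{x. x \<noteq> 0 \<and> polar x \<in> {a..b} \<times> sphere 0 1} = (shell (exp (2 * a)) (exp (2 * b)) :: (real^'n) set)"
proof (rule set_eqI)
  fix x :: "real^'n"
  show "x \<in> {x. x \<noteq> 0 \<and> polar x \<in> {a..b} \<times> sphere 0 1} \<longleftrightarrow> x \<in> shell (exp (2 * a)) (exp (2 * b))"
  proof (cases "x = 0")
    case True
    then show ?thesis by (simp add: shell_def not_le)
  next
    case False
    then have "x \<bullet> x = exp (2 * ln (norm x))"
      by (simp add: power2_norm_eq_inner[symmetric] exp_double)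
    with False show ?thesis by (simp add: shell_def polar_def)
  qed
qed

text \<open>Locates the points where a potential must vanish. The open set \<open>H\<close> adds no
  further ones, being a neighbourhood of each of its points.\<close>

lemma ln_norm_shell_boundary:
  fixes x :: "real^'n"
  assumes H: "open H" and x: "x \<in> (shell (exp (2 * a)) (exp (2 * b)) \<inter> H) - interior (shell (exp (2 * a)) (exp (2 * b)) \<inter> H)"
  shows "ln (norm x) = a \<or> ln (norm x) = b"
proof -
  have "x \<bullet> x = exp (2 * a) \<or> x \<bullet> x = exp (2 * b)"
  proof (rule ccontr)
    assume "\<not> (x \<bullet> x = exp (2 * a) \<or> x \<bullet> x = exp (2 * b))"
    moreover have "x \<in> H" "exp (2 * a) \<le> x \<bullet> x" "x \<bullet> x \<le> exp (2 * b)"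
      using DiffD1[OF x] by (auto simp: shell_def)
    ultimately show False
      using shell_interior[OF H, of x "exp (2 * a)" "exp (2 * b)"] x by simp
  qed
  then have "norm x = exp a \<or> norm x = exp b"
    by (simp add: power2_norm_eq_inner[symmetric] exp_double)
  then show ?thesis by auto
qed

lemma smooth_on_polar_metric:
  fixes D :: "(real^'n) set"
  assumes "\<And>k. C_diff k UNIV r" "0 \<notin> D" "\<And>x. x \<in> D \<Longrightarrow> G x = polar_metric r x"
  shows "smooth_on D G"
  using assms by (intro smooth_onI[of "- {0}" D "polar_metric r"] C_diff_polar_metric) auto

lemma smooth_on_radial:
  fixes D :: "(real^'n) set" and l :: "real \<Rightarrow> real"
  assumes "\<And>k. C_diff k UNIV l" "0 \<notin> D" "\<And>x. x \<in> D \<Longrightarrow> f x = l (ln (norm x))"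
  shows "smooth_on D f"
  using assms
  by (intro smooth_onI[of "- {0}" D "\<lambda>x. l (ln (norm x))"] C_diff_compose_real[OF _ C_diff_ln_norm]) auto

context ads_schwarzschild
begin

interpretation warping r r1 r2
  by unfold_locales (rule r_pos r_deriv r1_deriv)+

lemma smooth_profile: "C_diff k UNIV r"
  using C_diff_profile by blast

text \<open>The whole space, the closed domains and the quotient all fit these hypotheses: in every
  chart the metric is \<open>polar_metric r\<close> and the function is a radial potential.\<close>

lemma
  fixes A :: "('n::finite, 'p) chart set"
  assumes n: "n = CARD('n)"
    and cone: "\<And>D \<phi> x. (D, \<phi>) \<in> A \<Longrightarrow> x \<in> D \<Longrightarrow> cone_at D x"
    and D0: "\<And>D \<phi>. (D, \<phi>) \<in> A \<Longrightarrow> 0 \<notin> D"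
    and G: "\<And>D \<phi> x. (D, \<phi>) \<in> A \<Longrightarrow> x \<in> D \<Longrightarrow> g (D, \<phi>) x = polar_metric r x"
    and f: "\<And>D \<phi> x. (D, \<phi>) \<in> A \<Longrightarrow> x \<in> D \<Longrightarrow> f (\<phi> x) = pot C (ln (norm x))"
  shows smooth_function_radial: "smooth_function A f"
    and critical_equation_radial: "critical_equation A g f"
proof -
  show "smooth_function A f"
    unfolding smooth_function_def
    using D0 f by (auto intro!: smooth_on_radial[where l = "pot C"] C_diff_pot)
  show "critical_equation A g f"
    unfolding critical_equation_def Let_def
  proof (intro ballI allI, clarify)
    fix D \<phi> and x :: "real^'n" and i j assume c: "(D, \<phi>) \<in> A" and x: "x \<in> D"
    show "- laplacian D (g (D, \<phi>)) (f \<circ> \<phi>) x * g (D, \<phi>) x $ i $ j + hessian D (g (D, \<phi>)) (f \<circ> \<phi>) i j x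
        - f (\<phi> x) * ricci D (g (D, \<phi>)) i j x = g (D, \<phi>) x $ i $ j"
      using critical_equation_polar[of D "g (D, \<phi>)" x "f \<circ> \<phi>" "pot C" "pot1 C" "pot2 C" "real n" i j,
          OF cone[OF c] D0[OF c] G[OF c] x _ pot_deriv pot1_deriv _ pot_first_order pot_second_order] f[OF c] n
      by simp
  qed
qed

text \<open>Compatibility holds because, by \<open>T\<close>, each coordinate change is locally the
  identity or \<open>antiinversion\<close>, both isometries of
  \<open>polar_metric r\<close>.\<close>

lemma riemannian_metric_polar:
  fixes A :: "('n::finite, 'p) chart set"
  assumes D0: "\<And>D \<phi>. (D, \<phi>) \<in> A \<Longrightarrow> 0 \<notin> D"
    and G: "\<And>D \<phi> x. (D, \<phi>) \<in> A \<Longrightarrow> x \<in> D \<Longrightarrow> g (D, \<phi>) x = polar_metric r x"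
    and T: "\<And>c d x. c \<in> A \<Longrightarrow> d \<in> A \<Longrightarrow> x \<in> overlap c d \<Longrightarrow> x \<in> fst c \<and> transition c d x \<in> fst d \<and>
      cone_at (overlap c d) x \<and> (\<exists>N F. open N \<and> x \<in> N \<and> N \<subseteq> - {0} \<and>
        (\<forall>y \<in> overlap c d \<inter> N. transition c d y = F y) \<and> (F = (\<lambda>y. y) \<or> F = antiinversion))"
  shows "riemannian_metric A g"
  unfolding riemannian_metric_def Let_def
proof (intro conjI ballI allI impI)
  fix c assume c: "c \<in> A"
  obtain D \<phi> where D: "c = (D, \<phi>)" by (cases c)
  show "smooth_on (fst c) (g c)"
    using D0 G c D by (auto intro!: smooth_on_polar_metric smooth_profile)
  fix x assume x: "x \<in> fst c"
  have x0: "x \<noteq> 0" using D0 c D x by auto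
  have g: "g c x = polar_metric r x" using G c D x by auto
  show "transpose (g c x) = g c x"
    unfolding g by (rule polar_metric_symmetric)
  show "0 < v \<bullet> (g c x *v v)" if "v \<noteq> 0" for v
    unfolding g using polar_metric_positive[OF x0 r_pos that] .
next
  fix c d x v w assume c: "c \<in> A" and d: "d \<in> A" and x: "x \<in> overlap c d"
  note t = T[OF this]
  have xc: "x \<in> fst c" and xd: "transition c d x \<in> fst d" and cone: "cone_at (overlap c d) x"
    using t by blast+
  from t[THEN conjunct2, THEN conjunct2, THEN conjunct2] obtain N F where "open N \<and> x \<in> N \<and> N \<subseteq> - {0} \<and>
      (\<forall>y \<in> overlap c d \<inter> N. transition c d y = F y) \<and> (F = (\<lambda>y. y) \<or> F = antiinversion)"
    by (elim exE)
  then have N: "open N" "x \<in> N" "\<And>y. y \<in> overlap c d \<inter> N \<Longrightarrow> transition c d y = F y"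
    and F: "F = (\<lambda>y. y) \<or> F = antiinversion" and x0: "x \<noteq> 0"
    by auto
  have gc: "g c x = polar_metric r x" and gd: "g d (transition c d x) = polar_metric r (F x)"
    using G[of "fst c" "snd c"] G[of "fst d" "snd d"] c d xc xd N(2,3) x by auto
  let ?J = "frechet_derivative (transition c d) (at x within overlap c d)"
  from F show "v \<bullet> (g c x *v w) = ?J v \<bullet> (g d (transition c d x) *v ?J w)"
  proof
    assume F: "F = (\<lambda>y. y)"
    have "?J = (\<lambda>v. v)"
      using frechet_derivative_cone[OF cone N, of "\<lambda>v. v"] F by simp
    then show ?thesis unfolding gc gd F by simp
  next
    assume F: "F = antiinversion"
    have J: "?J = (\<lambda>v. (2 * (x \<bullet> v) / (x \<bullet> x)\<^sup>2) *\<^sub>R x - (1 / (x \<bullet> x)) *\<^sub>R v)"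
      using N(3) has_derivative_antiinversion[OF x0] unfolding F
      by (intro frechet_derivative_cone[OF cone N(1,2)])
    show ?thesis
      unfolding gc gd F J by (rule polar_metric_antiinversion[where r = r, OF x0 r_even, symmetric])
  qed
qed

lemma critical_on_ads_space:
  assumes n: "n = CARD('n::finite)"
  shows "\<exists>f. smooth_function (ads_atlas (ads_space :: (real \<times> (real^'n)) set)) f \<and>
     critical_equation (ads_atlas (ads_space :: (real \<times> (real^'n)) set)) (ads_metric r) f"
proof -
  have A: "ads_atlas (ads_space :: (real \<times> (real^'n)) set) = {(- {0}, polar)}"
    by (auto simp: ads_atlas_def ads_space_def polar_def)
  have o: "open (- {0 :: real^'n})" by auto
  have "smooth_function {(- {0} :: (real^'n) set, polar)} (\<lambda>p. pot 0 (fst p))"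
    "critical_equation {(- {0} :: (real^'n) set, polar)} (ads_metric r) (\<lambda>p. pot 0 (fst p))"
    by (rule smooth_function_radial[OF n, where g = "ads_metric r"] critical_equation_radial[OF n];
        use cone_at_open[OF o] in \<open>auto simp: ads_metric_def pullback_coeffs_polar polar_def\<close>)+
  then show ?thesis unfolding A by blast
qed

lemma critical_metric_closed_domain:
  assumes n: "n = CARD('n::finite)" and st: "s < t" and pot: "pot C s = 0" "pot C t = 0"
  defines "\<Omega> \<equiv> {s..t} \<times> sphere 0 1 :: (real \<times> (real^'n)) set"
  shows "critical_metric \<Omega> (ads_atlas \<Omega>) (ads_metric r)"
proof -
  define A B where "A = exp (2 * s)" and "B = exp (2 * t)"
  have AB: "0 < A" "A < B" using st by (auto simp: A_def B_def)
  define D :: "(real^'n) set" where "D = shell A B"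
  have atlas: "ads_atlas \<Omega> = {(D, polar)}"
    unfolding ads_atlas_def \<Omega>_def polar_shell D_def A_def B_def ..
  have D0: "0 \<notin> D" using AB by (auto simp: D_def shell_def)
  have cone: "cone_at D x" if "x \<in> D" for x
    using cone_at_shell[OF open_UNIV AB, of x] that by (simp add: D_def)
  have image: "polar ` D = \<Omega>"
  proof (intro set_eqI iffI)
    fix p :: "real \<times> (real^'n)" assume p: "p \<in> \<Omega>"
    then have e: "polar (exp (fst p) *\<^sub>R snd p) = p" by (auto simp: \<Omega>_def polar_cartesian)
    have nz: "exp (fst p) *\<^sub>R snd p \<noteq> 0" using p by (auto simp: \<Omega>_def)
    show "p \<in> polar ` D"
    proof (rule image_eqI)
      show "p = polar (exp (fst p) *\<^sub>R snd p)" using e by (rule sym)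
      show "exp (fst p) *\<^sub>R snd p \<in> D"
        unfolding D_def A_def B_def polar_shell[symmetric] mem_Collect_eq e
        using p nz unfolding \<Omega>_def by (rule conjI[rotated])
    qed
  qed (unfold D_def A_def B_def polar_shell[symmetric] \<Omega>_def, blast)
  have inj: "inj_on polar D"
    using D0 by (intro inj_onI) (metis polar_inject)
  have overlap: "overlap (D, polar) (D, polar) = D"
    by (auto simp: overlap_def)
  have transition: "transition (D, polar) (D, polar) x = x" if "x \<in> D" for x
    using inv_into_f_f[OF inj that] by (simp add: transition_def)
  have "compact_manifold_with_boundary \<Omega> {(D, polar)}"
    unfolding compact_manifold_with_boundary_def
  proof (intro conjI)
    show "(\<Union>(D, \<phi>)\<in>{(D, polar)}. \<phi> ` D) = \<Omega>" using image by simp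
    show "\<forall>(D, \<phi>)\<in>{(D, polar)}. smooth_domain D \<and> inj_on \<phi> D"
      using inj smooth_domain_shell[OF open_UNIV AB, where ?'a = "real^'n"] by (simp add: D_def)
    have "smooth_on D (transition (D, polar) (D, polar))"
      by (rule smooth_onI[of UNIV D "\<lambda>x. x"]) (auto simp: transition intro: C_diff_bounded_linear)
    then show "\<forall>c\<in>{(D, polar)}. \<forall>d\<in>{(D, polar)}. openin (top_of_set (fst c)) (overlap c d) \<and>
        smooth_on (overlap c d) (transition c d)"
      by (simp add: overlap)
    show "Hausdorff_space (manifold_topology \<Omega> {(D, polar)})"
      by (rule Hausdorff_manifold_topology[where f = "\<lambda>p. p"])
         (use image D0 in \<open>auto intro!: continuous_on_polar\<close>)
    show "compact_space (manifold_topology \<Omega> {(D, polar)})"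
      by (rule compact_manifold_topology[where K = D and \<pi> = polar])
         (use image compact_shell in \<open>auto simp: D_def\<close>)
  qed
  moreover have "riemannian_metric {(D, polar)} (ads_metric r)"
  proof (rule riemannian_metric_polar)
    fix c d :: "('n, real \<times> (real^'n)) chart" and x :: "real^'n"
    assume "c \<in> {(D, polar)}" "d \<in> {(D, polar)}" "x \<in> overlap c d"
    then show "x \<in> fst c \<and> transition c d x \<in> fst d \<and>
      cone_at (overlap c d) x \<and> (\<exists>N F. open N \<and> x \<in> N \<and> N \<subseteq> - {0} \<and>
        (\<forall>y \<in> overlap c d \<inter> N. transition c d y = F y) \<and> (F = (\<lambda>y. y) \<or> F = antiinversion))"
      using cone D0 by (auto simp: overlap transition intro!: exI[of _ "- {0}"])
  qed (use D0 in \<open>auto simp: ads_metric_def intro!: pullback_coeffs_polar\<close>)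
  moreover have "smooth_function {(D, polar)} (\<lambda>p. pot C (fst p))"
    "critical_equation {(D, polar)} (ads_metric r) (\<lambda>p. pot C (fst p))"
    by (rule smooth_function_radial[OF n, where g = "ads_metric r"] critical_equation_radial[OF n];
        use cone D0 in \<open>auto simp: ads_metric_def polar_def intro!: pullback_coeffs_polar\<close>)+
  moreover have "\<forall>p\<in>manifold_boundary {(D, polar)}. pot C (fst p) = 0"
  proof -
    have "pot C (ln (norm x)) = 0" if "x \<in> D - interior D" for x
      using ln_norm_shell_boundary[OF open_UNIV, of x s t] that pot by (auto simp: D_def A_def B_def)
    then show ?thesis by (auto simp: manifold_boundary_def polar_def)
  qed
  ultimately show ?thesis
    unfolding critical_metric_def atlas by (intro conjI exI[of _ "\<lambda>p. pot C (fst p)"])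
qed

end

section \<open>The antipodal quotient\<close>

text \<open>The type parameter fixes the dimension, which \<theta> alone does not determine.\<close>

locale antipodal_quotient =
  fixes \<theta> :: real and dim :: "'n::finite itself"
  assumes theta_nonzero: "\<theta> \<noteq> 0"
begin

text \<open>The double cover of the quotient in Cartesian coordinates, with
  \<open>antiinversion\<close> as deck transformation; |\<theta>| makes it the same for both signs
  of \<theta>.\<close>

definition collar :: "(real^'n) set" where
  "collar = shell (exp (2 * (- \<bar>\<theta>\<bar>))) (exp (2 * \<bar>\<theta>\<bar>))"

definition rep :: "real^'n \<Rightarrow> real \<times> (real^'n)" where
  "rep x = quotient_lift \<theta> x x"

abbreviation proj :: "real^'n \<Rightarrow> (real \<times> (real^'n)) set" where
  "proj \<equiv> quotient_param \<theta>"

lemma collar_bounds: "0 < exp (2 * (- \<bar>\<theta>\<bar>))" "exp (2 * (- \<bar>\<theta>\<bar>)) < exp (2 * \<bar>\<theta>\<bar>)"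
  using theta_nonzero by auto

lemma collar_eq: "collar = {x. x \<noteq> 0 \<and> \<bar>ln (norm x)\<bar> \<le> \<bar>\<theta>\<bar>}"
  unfolding collar_def polar_shell[symmetric] by (auto simp: polar_def)

lemma collar_polar: "{x. x \<noteq> 0 \<and> polar x \<in> closed_domain (- \<theta>) \<theta> \<and> 0 < e \<bullet> x} = collar \<inter> {x. 0 < e \<bullet> x}"
proof -
  have "s \<in> closed_segment (- \<theta>) \<theta> \<longleftrightarrow> \<bar>s\<bar> \<le> \<bar>\<theta>\<bar>" for s
    by (auto simp: closed_segment_eq_real_ivl abs_le_iff)
  then show ?thesis
    unfolding collar_eq by (auto simp: closed_domain_def polar_def)
qed

lemma antiinversion_collar: "x \<in> collar \<Longrightarrow> antiinversion x \<in> collar"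
  by (auto simp: collar_eq antiinversion_nonzero norm_antiinversion ln_inverse)

lemma rep_eq: "rep x = (if 0 \<le> \<theta> * ln (norm x) then polar x else antipodal_flip (polar x))"
  by (simp add: rep_def quotient_lift_def)

lemma domain_eq: "closed_domain \<theta> 0 = {p. 0 \<le> \<theta> * fst p \<and> \<bar>fst p\<bar> \<le> \<bar>\<theta>\<bar> \<and> norm (snd p) = 1}"
  using theta_nonzero
  by (auto simp: closed_domain_def closed_segment_eq_real_ivl zero_le_mult_iff split: if_splits)

lemma rep_in_domain: "x \<in> collar \<Longrightarrow> rep x \<in> closed_domain \<theta> 0"
  by (auto simp: rep_eq domain_eq collar_eq polar_def antipodal_flip_def)

lemma rep_surj:
  assumes "p \<in> closed_domain \<theta> 0"
  shows "\<exists>x\<in>collar. rep x = p"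
proof -
  obtain s u where p: "p = (s, u)" by (cases p)
  have "norm u = 1" "0 \<le> \<theta> * s" "\<bar>s\<bar> \<le> \<bar>\<theta>\<bar>" using assms by (auto simp: domain_eq p)
  then show ?thesis
    by (intro bexI[of _ "exp s *\<^sub>R u"]) (auto simp: rep_eq collar_eq p polar_cartesian)
qed

lemma equiv_antipodal: "equiv (closed_domain \<theta> 0) (antipodal_rel \<theta> :: ((real \<times> (real^'n)) \<times> _) set)"
  by (auto simp: equiv_def antipodal_rel_def refl_on_def sym_def trans_def horizon_def rot_sphere_def prod_eq_iff)

lemma proj_eq: "proj x = antipodal_rel \<theta> `` {rep x}"
  by (simp add: quotient_param_def rep_def)

lemma proj_image: "proj ` collar = quotient_space \<theta>"
proof -
  have "closed_domain \<theta> 0 = rep ` collar"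
    using rep_in_domain rep_surj by (intro equalityI subsetI) (blast, blast)
  then have "quotient_space \<theta> = (\<lambda>p. antipodal_rel \<theta> `` {p}) ` rep ` collar"
    by (simp only: quotient_space_def quotient_def UNION_singleton_eq_range)
  then show ?thesis by (simp only: image_image proj_eq[symmetric])
qed

text \<open>Off the horizon \<open>rep\<close> sends x and its antiinversion to the same point on
  the side of \<theta>; on the horizon it keeps both, and the relation identifies them.\<close>

lemma proj_eq_iff:
  assumes x: "x \<in> collar" and y: "y \<in> collar"
  shows "proj x = proj y \<longleftrightarrow> y = x \<or> y = antiinversion x"
proof -
  have nz: "x \<noteq> 0" "y \<noteq> 0" using x y by (auto simp: collar_eq)
  have anti: "y = antiinversion x \<longleftrightarrow> polar y = antipodal_flip (polar x)"
    using nz polar_inject[of y "antiinversion x"] by (simp add: antiinversion_nonzero polar_antiinversion)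
  have "proj x = proj y \<longleftrightarrow> (rep x, rep y) \<in> antipodal_rel \<theta>"
    unfolding proj_eq using eq_equiv_class_iff[OF equiv_antipodal rep_in_domain[OF x] rep_in_domain[OF y]] .
  also have "\<dots> \<longleftrightarrow> rep x = rep y \<or> fst (rep x) = 0 \<and> fst (rep y) = 0 \<and> snd (rep y) = - snd (rep x)"
    using rep_in_domain[OF x] rep_in_domain[OF y]
    by (auto simp: antipodal_rel_def horizon_def rot_sphere_def domain_eq mem_Times_iff)
  also have "\<dots> \<longleftrightarrow> polar y = polar x \<or> polar y = antipodal_flip (polar x)"
  proof -
    have "\<theta> * ln (norm x) = 0 \<longleftrightarrow> fst (polar x) = 0" "\<theta> * ln (norm y) = 0 \<longleftrightarrow> fst (polar y) = 0"
      using theta_nonzero by (auto simp: polar_def)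
    then show ?thesis
      using theta_nonzero
      by (auto simp: rep_eq antipodal_flip_def prod_eq_iff polar_def zero_le_mult_iff split: if_splits)
  qed
  finally show ?thesis using polar_inject[OF nz(2,1)] anti by simp
qed

text \<open>A class contains at most \<open>rep x\<close> and its flip, so a flip invariant function
  does not see which of them \<open>SOME\<close> picks.\<close>

lemma invariant_on_proj:
  assumes x: "x \<in> collar" and h: "\<And>p. h (antipodal_flip p) = h p"
  shows "h (SOME p. p \<in> proj x) = h (polar x)"
proof -
  have "rep x \<in> proj x"
    using equiv_class_self[OF equiv_antipodal rep_in_domain[OF x]] by (simp add: proj_eq)
  then have "(SOME p. p \<in> proj x) \<in> proj x" by (rule someI)
  moreover have "p = rep x \<or> p = antipodal_flip (rep x)" if "p \<in> proj x" for p
    using that unfolding proj_eq antipodal_rel_def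
    by (auto simp: horizon_def rot_sphere_def antipodal_flip_def prod_eq_iff mem_Times_iff)
  ultimately have "(SOME p. p \<in> proj x) = rep x \<or> (SOME p. p \<in> proj x) = antipodal_flip (rep x)"
    by blast
  moreover have "h (rep x) = h (polar x)" by (simp add: rep_eq h)
  ultimately show ?thesis by (elim disjE) (simp_all add: h)
qed

text \<open>The tensor \<open>u \<otimes> u\<close> determines \<open>u\<close> up to sign, and then \<open>s u\<close> determines \<open>s\<close>.\<close>

definition separating :: "real \<times> (real^'n) \<Rightarrow> (real^'n) \<times> (real^'n^'n)" where
  "separating p = (fst p *\<^sub>R snd p, \<chi> i j. snd p $ i * snd p $ j)"

lemma separating_flip: "separating (antipodal_flip p) = separating p"
  by (simp add: separating_def antipodal_flip_def)

lemma separating_eqD: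
  assumes "separating p = separating q" "norm (snd p) = 1"
  shows "q = p \<or> q = antipodal_flip p"
proof -
  define u v where "u = snd p" and "v = snd q"
  have uv: "u $ i * u $ j = v $ i * v $ j" for i j
    using assms(1) by (simp add: separating_def vec_eq_iff u_def v_def)
  have "u \<noteq> 0" using assms(2) by (auto simp: u_def)
  then obtain i where i: "u $ i \<noteq> 0" by (auto simp: vec_eq_iff)
  have "v $ i = u $ i \<or> v $ i = - u $ i"
    using uv[of i i] by (simp add: square_eq_iff[symmetric])
  then have "v = u \<or> v = - u"
  proof
    assume "v $ i = u $ i"
    then have "v $ j = u $ j" for j using uv[of i j] i by simp
    then show ?thesis by (simp add: vec_eq_iff)
  next
    assume vi: "v $ i = - u $ i"
    have "v $ j = - u $ j" for j
    proof -
      have "u $ i * (u $ j + v $ j) = 0" using uv[of i j] unfolding vi by (simp add: algebra_simps)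
      then show ?thesis using i by simp
    qed
    then show ?thesis by (simp add: vec_eq_iff)
  qed
  moreover have "fst p *\<^sub>R u = fst q *\<^sub>R v"
    using assms(1) by (simp add: separating_def u_def v_def)
  ultimately have "v = u \<and> fst q = fst p \<or> v = - u \<and> fst q = - fst p"
    using \<open>u \<noteq> 0\<close> scaleR_cancel_right[of "fst p" u "- fst q"] by auto
  then show ?thesis by (auto simp: prod_eq_iff antipodal_flip_def u_def v_def)
qed

definition hemi :: "real^'n \<Rightarrow> (real^'n) set" where
  "hemi e = collar \<inter> {x. 0 < e \<bullet> x}"

lemma quotient_atlas_eq: "quotient_atlas \<theta> = {(hemi e, proj) | e. norm e = 1}"
  unfolding quotient_atlas_def collar_polar hemi_def ..

lemma hemi_subset: "hemi e \<subseteq> collar" "0 \<notin> hemi e"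
  by (auto simp: hemi_def collar_eq)

lemma antiinversion_hemi: "x \<in> collar \<Longrightarrow> antiinversion x \<in> hemi e \<longleftrightarrow> e \<bullet> x < 0"
proof -
  assume x: "x \<in> collar"
  then have "0 < x \<bullet> x" by (auto simp: collar_eq)
  moreover have "0 < - c / N \<longleftrightarrow> c < 0" if "0 < N" for c N :: real
    using that by (simp add: field_simps)
  ultimately have "0 < e \<bullet> antiinversion x \<longleftrightarrow> e \<bullet> x < 0"
    unfolding inner_antiinversion by blast
  then show ?thesis using antiinversion_collar[OF x] by (simp add: hemi_def)
qed

text \<open>\<open>antiinversion\<close> reverses the sign of e \<bullet> x, so an open half-space
  meets each fibre at most once.\<close>

lemma inj_on_proj: "inj_on proj (hemi e)"
proof (rule inj_onI)
  fix x y assume xy: "x \<in> hemi e" "y \<in> hemi e" "proj x = proj y"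
  then have "y = x \<or> y = antiinversion x"
    using proj_eq_iff hemi_subset by blast
  then show "x = y" using antiinversion_hemi[of x e] xy by (auto simp: hemi_def)
qed

lemma overlap_hemi: "overlap (hemi e, proj) (hemi e', proj) = collar \<inter> ({x. 0 < e \<bullet> x} \<inter> {x. e' \<bullet> x \<noteq> 0})"
proof -
  have "proj x \<in> proj ` hemi e' \<longleftrightarrow> e' \<bullet> x \<noteq> 0" if x: "x \<in> collar" for x
  proof -
    have "proj x \<in> proj ` hemi e' \<longleftrightarrow> x \<in> hemi e' \<or> antiinversion x \<in> hemi e'"
      using proj_eq_iff[OF x] hemi_subset antiinversion_collar[OF x] by (auto simp: image_iff)
    then show ?thesis using antiinversion_hemi[OF x, of e'] x by (auto simp: hemi_def)
  qed
  then show ?thesis by (auto simp: overlap_def hemi_def)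
qed

lemma transition_hemi:
  assumes "x \<in> collar"
  shows "0 < e' \<bullet> x \<Longrightarrow> transition (hemi e, proj) (hemi e', proj) x = x"
    and "e' \<bullet> x < 0 \<Longrightarrow> transition (hemi e, proj) (hemi e', proj) x = antiinversion x"
proof -
  have inv: "transition (hemi e, proj) (hemi e', proj) x = y" if "y \<in> hemi e'" "proj x = proj y" for y
    using inv_into_f_f[OF inj_on_proj that(1)] that(2) by (simp add: transition_def)
  show "0 < e' \<bullet> x \<Longrightarrow> transition (hemi e, proj) (hemi e', proj) x = x"
    by (rule inv) (use assms in \<open>auto simp: hemi_def\<close>)
  show "e' \<bullet> x < 0 \<Longrightarrow> transition (hemi e, proj) (hemi e', proj) x = antiinversion x"
    by (rule inv) (use assms antiinversion_hemi proj_eq_iff antiinversion_collar in auto)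
qed

lemma open_halfspaces: "open {x::real^'n. 0 < e \<bullet> x}" "open {x::real^'n. e \<bullet> x < 0}" "open {x::real^'n. e \<bullet> x \<noteq> 0}"
  by (intro open_Collect_less open_Collect_neq continuous_intros)+

lemma cone_at_overlap:
  "x \<in> overlap (hemi e, proj) (hemi e', proj) \<Longrightarrow> cone_at (overlap (hemi e, proj) (hemi e', proj)) x"
  unfolding overlap_hemi collar_def
  by (intro cone_at_shell collar_bounds open_Int open_halfspaces)

lemma cone_at_hemi: "x \<in> hemi e \<Longrightarrow> cone_at (hemi e) x"
  unfolding hemi_def collar_def by (intro cone_at_shell collar_bounds open_halfspaces)

text \<open>The hyperplane e' \<bullet> x = 0 may cut the overlap into two pieces with different
  coordinate changes, so a single formula is available only locally.\<close>

lemma transition_local: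
  assumes "x \<in> overlap (hemi e, proj) (hemi e', proj)"
  shows "\<exists>N F. open N \<and> x \<in> N \<and> N \<subseteq> - {0} \<and>
    (\<forall>y \<in> overlap (hemi e, proj) (hemi e', proj) \<inter> N. transition (hemi e, proj) (hemi e', proj) y = F y) \<and>
    (F = (\<lambda>y. y) \<or> F = antiinversion)"
proof (cases "0 < e' \<bullet> x")
  case True
  then show ?thesis
    using open_halfspaces(1)[of e'] transition_hemi(1)[of _ e' e]
    by (intro exI[of _ "{x. 0 < e' \<bullet> x}"] exI[of _ "\<lambda>y. y"]) (auto simp: overlap_hemi)
next
  case False
  then show ?thesis
    using open_halfspaces(2)[of e'] transition_hemi(2)[of _ e' e] assms
    by (intro exI[of _ "{x. e' \<bullet> x < 0}"] exI[of _ "antiinversion"]) (auto simp: overlap_hemi)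
qed

lemma transition_in_hemi:
  "x \<in> overlap (hemi e, proj) (hemi e', proj) \<Longrightarrow> transition (hemi e, proj) (hemi e', proj) x \<in> hemi e'"
  unfolding overlap_def transition_def by (auto intro: inv_into_into)

lemma compact_manifold_quotient:
  "compact_manifold_with_boundary (quotient_space \<theta>) (quotient_atlas \<theta> :: ('n, _) chart set)"
  unfolding compact_manifold_with_boundary_def
proof (intro conjI)
  have cover: "\<exists>e. norm e = 1 \<and> x \<in> hemi e" if "x \<in> collar" for x
    using that by (intro exI[of _ "x /\<^sub>R norm x"]) (auto simp: hemi_def collar_eq)
  have sub: "\<phi> ` D \<subseteq> quotient_space \<theta>" if c: "(D, \<phi>) \<in> quotient_atlas \<theta>"
    for D and \<phi> :: "real^'n \<Rightarrow> (real \<times> (real^'n)) set"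
  proof -
    obtain e where "D = hemi e" "\<phi> = proj" using c by (auto simp: quotient_atlas_eq)
    then show ?thesis using image_mono[OF hemi_subset(1)[of e], of proj] proj_image by simp
  qed
  show "(\<Union>(D, \<phi>)\<in>quotient_atlas \<theta> :: ('n, _) chart set. \<phi> ` D) = quotient_space \<theta>"
  proof
    show "(\<Union>(D, \<phi>)\<in>quotient_atlas \<theta> :: ('n, _) chart set. \<phi> ` D) \<subseteq> quotient_space \<theta>"
      using sub by (intro UN_least) (simp add: split_beta)
    show "quotient_space \<theta> \<subseteq> (\<Union>(D, \<phi>)\<in>quotient_atlas \<theta> :: ('n, _) chart set. \<phi> ` D)"
    proof
      fix P :: "(real \<times> (real^'n)) set" assume "P \<in> quotient_space \<theta>"
      then obtain x e where "P = proj x" "norm e = 1" "x \<in> hemi e"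
        unfolding proj_image[symmetric] using cover by blast
      then have "(hemi e, proj) \<in> quotient_atlas \<theta>" "P \<in> proj ` hemi e"
        by (auto simp: quotient_atlas_eq)
      then show "P \<in> (\<Union>(D, \<phi>)\<in>quotient_atlas \<theta> :: ('n, _) chart set. \<phi> ` D)"
        by (intro UN_I[of "(hemi e, proj)"]) simp_all
    qed
  qed
  show "\<forall>(D, \<phi>)\<in>quotient_atlas \<theta> :: ('n, _) chart set. smooth_domain D \<and> inj_on \<phi> D"
    using inj_on_proj smooth_domain_shell[OF open_halfspaces(1) collar_bounds]
    by (auto simp: quotient_atlas_eq hemi_def collar_def)
  have "openin (top_of_set (hemi e)) (overlap (hemi e, proj) (hemi e', proj))" for e e'
  proof -
    have "overlap (hemi e, proj) (hemi e', proj) = hemi e \<inter> {x. e' \<bullet> x \<noteq> 0}"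
      unfolding overlap_hemi by (auto simp: hemi_def)
    then show ?thesis using openin_open_Int[OF open_halfspaces(3)] by simp
  qed
  moreover have "smooth_on (overlap (hemi e, proj) (hemi e', proj)) (transition (hemi e, proj) (hemi e', proj))" for e e'
    unfolding smooth_on_def
  proof
    fix x assume "x \<in> overlap (hemi e, proj) (hemi e', proj)"
    from transition_local[OF this] obtain N F where "open N \<and> x \<in> N \<and> N \<subseteq> - {0} \<and>
      (\<forall>y \<in> overlap (hemi e, proj) (hemi e', proj) \<inter> N. transition (hemi e, proj) (hemi e', proj) y = F y) \<and>
      (F = (\<lambda>y. y) \<or> F = antiinversion)"
      by (elim exE)
    then have N: "open N" "x \<in> N" "N \<subseteq> - {0}"
      "\<And>y. y \<in> overlap (hemi e, proj) (hemi e', proj) \<inter> N \<Longrightarrow> transition (hemi e, proj) (hemi e', proj) y = F y"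
      "F = (\<lambda>y. y) \<or> F = antiinversion"
      by auto
    have "C_diff k N F" for k
      using N(5) C_diff_bounded_linear[OF N(1) bounded_linear_ident] C_diff_subset[OF C_diff_antiinversion N(3)] by auto
    then show "\<exists>W F. open W \<and> x \<in> W \<and> (\<forall>k. C_diff k W F) \<and>
        (\<forall>y\<in>overlap (hemi e, proj) (hemi e', proj) \<inter> W. F y = transition (hemi e, proj) (hemi e', proj) y)"
      using N by (intro exI[of _ N] exI[of _ F]) auto
  qed
  ultimately show "\<forall>c\<in>quotient_atlas \<theta> :: ('n, _) chart set. \<forall>d\<in>quotient_atlas \<theta>.
      openin (top_of_set (fst c)) (overlap c d) \<and> smooth_on (overlap c d) (transition c d)"
    by (auto simp: quotient_atlas_eq)
  show "Hausdorff_space (manifold_topology (quotient_space \<theta>) (quotient_atlas \<theta> :: ('n, _) chart set))"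
  proof (rule Hausdorff_manifold_topology[OF sub])
    \<comment> \<open>Flip invariance of \<open>separating\<close> makes the choice immaterial; in
      charts this is \<open>separating\<close> after \<open>polar\<close>, which is
      continuous.\<close>
    let ?f = "\<lambda>P. separating (SOME p. p \<in> P)"
    have f: "?f (proj x) = separating (polar x)" if "x \<in> collar" for x
      using that separating_flip by (rule invariant_on_proj[where h = separating])
    show "inj_on ?f (quotient_space \<theta>)"
      unfolding proj_image[symmetric]
    proof (rule inj_onI, clarify)
      fix x y assume xy: "x \<in> collar" "y \<in> collar" and "?f (proj x) = ?f (proj y)"
      then have "separating (polar x) = separating (polar y)" by (simp add: f)
      moreover have nz: "x \<noteq> 0" "y \<noteq> 0" using xy by (auto simp: collar_eq)
      ultimately have "polar y = polar x \<or> polar y = antipodal_flip (polar x)"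
        using separating_eqD norm_snd_polar by blast
      then have "y = x \<or> y = antiinversion x"
        using nz polar_inject[of y x] polar_inject[of y "antiinversion x"]
        by (simp add: antiinversion_nonzero polar_antiinversion)
      then show "proj x = proj y" using proj_eq_iff[OF xy] by simp
    qed
    fix D and \<phi> :: "real^'n \<Rightarrow> (real \<times> (real^'n)) set" assume "(D, \<phi>) \<in> quotient_atlas \<theta>"
    then obtain e where D: "D = hemi e" "\<phi> = proj" by (auto simp: quotient_atlas_eq)
    have "continuous_on (hemi e) (\<lambda>x. separating (polar x))"
      unfolding separating_def
      by (intro continuous_intros continuous_on_polar continuous_on_vec_lambda continuous_on_component)
         (use hemi_subset in auto)
    then show "continuous_on D (\<lambda>x. ?f (\<phi> x))"
      unfolding D using f hemi_subset(1)[of e] by (subst continuous_on_cong[OF refl]) auto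
  qed
  show "compact_space (manifold_topology (quotient_space \<theta>) (quotient_atlas \<theta> :: ('n, _) chart set))"
  proof (rule compact_manifold_topology[OF sub _ proj_image])
    show "compact collar" unfolding collar_def by (rule compact_shell)
    fix x assume "x \<in> collar"
    then obtain e where e: "norm e = 1" "x \<in> hemi e" using cover by blast
    moreover have "openin (top_of_set collar) (hemi e)"
      unfolding hemi_def by (rule openin_open_Int[OF open_halfspaces(1)])
    ultimately show "\<exists>D \<phi>. (D, \<phi>) \<in> quotient_atlas \<theta> \<and> x \<in> D \<and> openin (top_of_set collar) D \<and> (\<forall>y\<in>D. \<phi> y = proj y)"
      by (intro exI[of _ "hemi e"] exI[of _ proj]) (auto simp: quotient_atlas_eq)
  qed
qed

end

lemma (in ads_schwarzschild) critical_metric_quotient: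
  assumes n: "n = CARD('n::finite)" and \<theta>: "\<theta> \<noteq> 0" "pot 0 \<theta> = 0"
  shows "critical_metric (quotient_space \<theta> :: (real \<times> (real^'n)) set set) (quotient_atlas \<theta>) (quotient_metric \<theta> r)"
proof -
  interpret Q: antipodal_quotient \<theta> "TYPE('n)" using \<theta> by unfold_locales
  let ?A = "quotient_atlas \<theta> :: ('n, (real \<times> (real^'n)) set) chart set"
  define f where "f = (\<lambda>P :: (real \<times> (real^'n)) set. pot 0 (fst (SOME p. p \<in> P)))"
  have f: "f (Q.proj x) = pot 0 (ln (norm x))" if "x \<in> Q.collar" for x
    using Q.invariant_on_proj[OF that, of "\<lambda>p. pot 0 (fst p)"]
    by (simp add: f_def antipodal_flip_def pot_even polar_def)
  have g: "quotient_metric \<theta> r c x = polar_metric r x" if "x \<noteq> 0" for x :: "real^'n" and c :: "('n, (real \<times> (real^'n)) set) chart"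
    using that pullback_coeffs_antipodal_flip[of x r] r_even
    by (simp add: quotient_metric_def quotient_lift_def pullback_coeffs_polar)
  have chart: "\<exists>e. D = Q.hemi e \<and> \<phi> = Q.proj" if "(D, \<phi>) \<in> ?A" for D \<phi>
    using that by (auto simp: Q.quotient_atlas_eq)
  have nz: "x \<in> Q.hemi e \<Longrightarrow> x \<noteq> 0" for x e using Q.hemi_subset(2)[of e] by auto
  have "riemannian_metric ?A (quotient_metric \<theta> r)"
  proof (rule riemannian_metric_polar)
    fix c d and x :: "real^'n" assume "c \<in> ?A" "d \<in> ?A" and x: "x \<in> overlap c d"
    then obtain e e' where cd: "c = (Q.hemi e, Q.proj)" "d = (Q.hemi e', Q.proj)"
      by (auto simp: Q.quotient_atlas_eq)
    show "x \<in> fst c \<and> transition c d x \<in> fst d \<and>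
      cone_at (overlap c d) x \<and> (\<exists>N F. open N \<and> x \<in> N \<and> N \<subseteq> - {0} \<and>
        (\<forall>y \<in> overlap c d \<inter> N. transition c d y = F y) \<and> (F = (\<lambda>y. y) \<or> F = antiinversion))"
      using Q.transition_in_hemi Q.cone_at_overlap Q.transition_local x unfolding cd
      by (auto simp: overlap_def)
  qed (use chart g nz in \<open>fastforce\<close>)+
  moreover have "smooth_function ?A f" "critical_equation ?A (quotient_metric \<theta> r) f"
  proof -
    have cone: "cone_at D x" if "(D, \<phi>) \<in> ?A" "x \<in> D" for D \<phi> x
      using chart[OF that(1)] that(2) Q.cone_at_hemi by blast
    have D0: "0 \<notin> D" if "(D, \<phi>) \<in> ?A" for D \<phi>
      using chart[OF that] nz by blast
    have G: "quotient_metric \<theta> r (D, \<phi>) x = polar_metric r x" if "(D, \<phi>) \<in> ?A" "x \<in> D" for D \<phi> x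
      using D0[OF that(1)] that(2) by (intro g) auto
    have f_radial: "f (\<phi> x) = pot 0 (ln (norm x))" if "(D, \<phi>) \<in> ?A" "x \<in> D" for D \<phi> x
      using chart[OF that(1)] that(2) f Q.hemi_subset(1) by blast
    show "smooth_function ?A f"
      using n cone D0 G f_radial by (rule smooth_function_radial)
    show "critical_equation ?A (quotient_metric \<theta> r) f"
      using n cone D0 G f_radial by (rule critical_equation_radial)
  qed
  moreover have "\<forall>p\<in>manifold_boundary ?A. f p = 0"
  proof -
    have "f (Q.proj x) = 0" if x: "x \<in> Q.hemi e - interior (Q.hemi e)" for x e
    proof -
      \<comment> \<open>Both rims of the collar lie over the sphere at \<theta>; the horizon is
        interior and imposes no condition.\<close>
      have "ln (norm x) = - \<bar>\<theta>\<bar> \<or> ln (norm x) = \<bar>\<theta>\<bar>"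
        using x unfolding Q.hemi_def Q.collar_def by (intro ln_norm_shell_boundary[OF Q.open_halfspaces(1)])
      moreover have "pot 0 \<bar>\<theta>\<bar> = 0" "pot 0 (- \<bar>\<theta>\<bar>) = 0"
        using \<theta> pot_even[of \<theta>] by (auto simp: abs_if)
      moreover have "x \<in> Q.collar" using x Q.hemi_subset(1) by blast
      ultimately show ?thesis using f[of x] by auto
    qed
    then show ?thesis by (auto simp: manifold_boundary_def Q.quotient_atlas_eq)
  qed
  ultimately show ?thesis
    unfolding critical_metric_def using Q.compact_manifold_quotient by blast
qed

section \<open>The two sides of the horizon\<close>

text \<open>A connected subset projects to an interval of the s-axis that omits 0, so it cannot
  leave its side. The sides are connected because the sphere is, from dimension 2 of the ambient
  space on.\<close>

lemma components_minus_horizon: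
  assumes "2 \<le> CARD('n::finite)"
  shows "{0<..} \<times> sphere 0 1 \<in> components (ads_space - horizon :: (real \<times> (real^'n)) set)"
    and "{..<0} \<times> sphere 0 1 \<in> components (ads_space - horizon :: (real \<times> (real^'n)) set)"
proof -
  let ?S = "ads_space - horizon :: (real \<times> (real^'n)) set"
  have S: "?S = (UNIV - {0}) \<times> sphere 0 1"
    by (auto simp: ads_space_def horizon_def rot_sphere_def)
  have sph: "connected (sphere 0 1 :: (real^'n) set)" "sphere 0 1 \<noteq> ({} :: (real^'n) set)"
    using connected_sphere[of "0 :: real^'n" 1] assms by auto
  have *: "I \<times> sphere 0 1 \<in> components ?S"
    if I: "connected I" "s \<in> I" "0 \<notin> I" and max: "\<And>t. t \<notin> I \<Longrightarrow> 0 \<in> closed_segment s t" for I :: "real set" and s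
    unfolding in_components_maximal
  proof (intro conjI allI impI)
    show "I \<times> sphere 0 1 \<noteq> ({} :: (real \<times> (real^'n)) set)" using I sph by auto
    show "I \<times> sphere 0 1 \<subseteq> ?S" using I(3) unfolding S by auto
    show "connected (I \<times> sphere 0 1 :: (real \<times> (real^'n)) set)" using I(1) sph(1) by (rule connected_Times)
    fix E assume E: "E \<noteq> {} \<and> I \<times> sphere 0 1 \<subseteq> E \<and> E \<subseteq> ?S \<and> connected E"
    then have "connected (fst ` E)"
      by (intro connected_continuous_image continuous_intros) auto
    then have ivl: "is_interval (fst ` E)" by (simp add: is_interval_connected_1)
    obtain u :: "real^'n" where "u \<in> sphere 0 1" using sph(2) by blast
    then have "(s, u) \<in> E" using E I(2) by blast
    then have s: "s \<in> fst ` E" by (rule image_eqI[rotated]) simp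
    have 0: "0 \<notin> fst ` E" using E unfolding S by auto
    have "fst ` E \<subseteq> I"
    proof
      fix t assume "t \<in> fst ` E"
      then have "closed_segment s t \<subseteq> fst ` E"
        using s ivl is_interval_convex by (intro closed_segment_subset)
      then show "t \<in> I" using max[of t] 0 by blast
    qed
    then have "fst p \<in> I" if "p \<in> E" for p using that by blast
    moreover have "snd p \<in> sphere 0 1" if "p \<in> E" for p
    proof -
      have "p \<in> (UNIV - {0}) \<times> sphere 0 1" using E that S by blast
      then show ?thesis by (simp add: mem_Times_iff)
    qed
    ultimately have "E \<subseteq> I \<times> sphere 0 1" by (simp add: subset_iff mem_Times_iff)
    then show "E = I \<times> sphere 0 1" using E by (intro subset_antisym) simp_all
  qed
  show "{0<..} \<times> sphere 0 1 \<in> components ?S"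
    by (rule *[of _ 1]) (auto simp: closed_segment_eq_real_ivl)
  show "{..<0} \<times> sphere 0 1 \<in> components ?S"
    by (rule *[of _ "-1"]) (auto simp: closed_segment_eq_real_ivl)
qed


lemma rot_sphere_subset_iff:
  "rot_sphere s \<subseteq> (X \<times> sphere 0 1 - Y \<times> sphere 0 1 :: (real \<times> (real^'n)) set) \<longleftrightarrow> s \<in> X - Y"
  "rot_sphere s \<subseteq> (X \<times> sphere 0 1 :: (real \<times> (real^'n)) set) \<longleftrightarrow> s \<in> X"
proof -
  have "(axis undefined 1 :: real^'n) \<in> sphere 0 1" by simp
  then show "rot_sphere s \<subseteq> (X \<times> sphere 0 1 - Y \<times> sphere 0 1 :: (real \<times> (real^'n)) set) \<longleftrightarrow> s \<in> X - Y"
    "rot_sphere s \<subseteq> (X \<times> sphere 0 1 :: (real \<times> (real^'n)) set) \<longleftrightarrow> s \<in> X"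
    unfolding rot_sphere_def by blast+
qed

theorem corollary3p2:
  fixes r :: "real \<Rightarrow> real" and R a :: real
  assumes "CARD('n::finite) \<ge> 3"
    and "ads_schwarzschild_profile CARD('n) R a r"
  shows
    "(\<exists>f. smooth_function (ads_atlas (ads_space :: (real \<times> (real^'n)) set)) f \<and>
          critical_equation (ads_atlas (ads_space :: (real \<times> (real^'n)) set)) (ads_metric r) f) \<and>
     (\<forall>M\<^sub>1 M\<^sub>2 :: (real \<times> (real^'n)) set.
        components (ads_space - horizon) = {M\<^sub>1, M\<^sub>2} \<and> M\<^sub>1 \<noteq> M\<^sub>2 \<longrightarrow>
        (\<exists>\<zeta>. rot_sphere \<zeta> \<subseteq> M\<^sub>1 \<and> rot_sphere (- \<zeta>) \<subseteq> M\<^sub>2 \<and>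
             horizon_reflection ` (rot_sphere \<zeta> :: (real \<times> (real^'n)) set) = rot_sphere (- \<zeta>) \<and>
             (let U = closed_domain (- \<zeta>) \<zeta> in
               (\<forall>\<zeta>\<^sub>1. rot_sphere \<zeta>\<^sub>1 \<subseteq> M\<^sub>1 - U \<longrightarrow>
                 (\<exists>\<zeta>\<^sub>2. rot_sphere \<zeta>\<^sub>2 \<subseteq> M\<^sub>2 - U \<and>
                    (let \<Omega> = (closed_domain \<zeta>\<^sub>1 \<zeta>\<^sub>2 :: (real \<times> (real^'n)) set)
                     in critical_metric \<Omega> (ads_atlas \<Omega>) (ads_metric r)))) \<and>
               (\<exists>\<theta>. rot_sphere \<theta> \<subseteq> M\<^sub>1 - U \<and>
                 critical_metric (quotient_space \<theta> :: (real \<times> (real^'n)) set set)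
                   (quotient_atlas \<theta>) (quotient_metric \<theta> r)) \<and>
               (\<exists>\<theta>. rot_sphere \<theta> \<subseteq> M\<^sub>2 - U \<and>
                 critical_metric (quotient_space \<theta> :: (real \<times> (real^'n)) set set)
                   (quotient_atlas \<theta>) (quotient_metric \<theta> r)))))"
proof -
  interpret ads_schwarzschild "CARD('n)" R a r
    using assms by unfold_locales
  obtain \<zeta> \<theta> where \<zeta>: "0 < \<zeta>" "\<zeta> < \<theta>" and \<theta>: "pot 0 \<theta> = 0"
    and zeros: "\<And>s. \<zeta> < \<bar>s\<bar> \<Longrightarrow> \<exists>t C. \<zeta> < \<bar>t\<bar> \<and> s * t < 0 \<and> pot C s = 0 \<and> pot C t = 0"
    using zeros_of_potentials by blast
  have domain: "critical_metric (closed_domain s t :: (real \<times> (real^'n)) set)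
      (ads_atlas (closed_domain s t)) (ads_metric r)" if "s \<noteq> t" "pot C s = 0" "pot C t = 0" for s t C
  proof (cases s t rule: linorder_cases)
    case less
    then show ?thesis
      using critical_metric_closed_domain[OF refl less, of C] that
      by (simp add: closed_domain_def closed_segment_eq_real_ivl)
  next
    case greater
    then show ?thesis
      using critical_metric_closed_domain[OF refl greater, of C] that
      by (simp add: closed_domain_def closed_segment_eq_real_ivl)
  qed (use that in simp)
  have "\<exists>\<zeta>. rot_sphere \<zeta> \<subseteq> M\<^sub>1 \<and> rot_sphere (- \<zeta>) \<subseteq> M\<^sub>2 \<and>
      horizon_reflection ` (rot_sphere \<zeta> :: (real \<times> (real^'n)) set) = rot_sphere (- \<zeta>) \<and>
      (let U = closed_domain (- \<zeta>) \<zeta> in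
        (\<forall>\<zeta>\<^sub>1. rot_sphere \<zeta>\<^sub>1 \<subseteq> M\<^sub>1 - U \<longrightarrow>
          (\<exists>\<zeta>\<^sub>2. rot_sphere \<zeta>\<^sub>2 \<subseteq> M\<^sub>2 - U \<and>
             (let \<Omega> = (closed_domain \<zeta>\<^sub>1 \<zeta>\<^sub>2 :: (real \<times> (real^'n)) set)
              in critical_metric \<Omega> (ads_atlas \<Omega>) (ads_metric r)))) \<and>
        (\<exists>\<theta>. rot_sphere \<theta> \<subseteq> M\<^sub>1 - U \<and>
          critical_metric (quotient_space \<theta> :: (real \<times> (real^'n)) set set)
            (quotient_atlas \<theta>) (quotient_metric \<theta> r)) \<and>
        (\<exists>\<theta>. rot_sphere \<theta> \<subseteq> M\<^sub>2 - U \<and>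
          critical_metric (quotient_space \<theta> :: (real \<times> (real^'n)) set set)
            (quotient_atlas \<theta>) (quotient_metric \<theta> r)))"
    if comp: "components (ads_space - horizon) = {M\<^sub>1, M\<^sub>2}" "M\<^sub>1 \<noteq> M\<^sub>2" for M\<^sub>1 M\<^sub>2 :: "(real \<times> (real^'n)) set"
  proof -
    have sphere: "(axis undefined 1 :: real^'n) \<in> sphere 0 1" by simp
    have ne: "{0<..} \<times> sphere 0 1 \<noteq> ({..<0} \<times> sphere 0 1 :: (real \<times> (real^'n)) set)"
    proof
      assume eq: "{0<..} \<times> sphere 0 1 = ({..<0} \<times> sphere 0 1 :: (real \<times> (real^'n)) set)"
      have "(1 :: real, axis undefined 1) \<in> {0<..} \<times> (sphere 0 1 :: (real^'n) set)" using sphere by simp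
      then have "(1::real) \<in> {..<0}" unfolding eq by blast
      then show False by simp
    qed
    have "{0<..} \<times> sphere 0 1 \<in> {M\<^sub>1, M\<^sub>2}" "{..<0} \<times> sphere 0 1 \<in> {M\<^sub>1, M\<^sub>2}"
      using components_minus_horizon[where 'n = 'n] assms(1) comp(1) by simp_all
    then have sides: "M\<^sub>1 = {0<..} \<times> sphere 0 1 \<and> M\<^sub>2 = {..<0} \<times> sphere 0 1 \<or>
        M\<^sub>1 = {..<0} \<times> sphere 0 1 \<and> M\<^sub>2 = {0<..} \<times> sphere 0 1"
      using ne by auto
    \<comment> \<open>Written with a factor 1 or -1 the two labellings of the sides have the same
      shape, so one sign \<sigma> covers both.\<close>
    have "{s. 0 < 1 * s} = {0::real<..}" "{s. 1 * s < 0} = {..<0::real}"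
      "{s. 0 < -1 * s} = {..<0::real}" "{s. -1 * s < 0} = {0::real<..}"
      by auto
    with sides have "M\<^sub>1 = {s. 0 < 1 * s} \<times> sphere 0 1 \<and> M\<^sub>2 = {s. 1 * s < 0} \<times> sphere 0 1 \<or>
        M\<^sub>1 = {s. 0 < -1 * s} \<times> sphere 0 1 \<and> M\<^sub>2 = {s. -1 * s < 0} \<times> sphere 0 1"
      by simp
    then obtain \<sigma> :: real where \<sigma>: "\<sigma> = 1 \<or> \<sigma> = -1"
      and M: "M\<^sub>1 = {s. 0 < \<sigma> * s} \<times> sphere 0 1" "M\<^sub>2 = {s. \<sigma> * s < 0} \<times> sphere 0 1"
      by blast
    have U: "closed_domain (- (\<sigma> * \<zeta>)) (\<sigma> * \<zeta>) = {s. \<bar>s\<bar> \<le> \<zeta>} \<times> (sphere 0 1 :: (real^'n) set)"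
      using \<sigma> \<zeta>(1) by (auto simp: closed_domain_def closed_segment_eq_real_ivl)
    show ?thesis
      unfolding Let_def
    proof (rule exI[of _ "\<sigma> * \<zeta>"], intro conjI allI impI)
      show "rot_sphere (\<sigma> * \<zeta>) \<subseteq> M\<^sub>1" "rot_sphere (- (\<sigma> * \<zeta>)) \<subseteq> M\<^sub>2"
        unfolding M rot_sphere_subset_iff using \<sigma> \<zeta>(1) by auto
      show "horizon_reflection ` rot_sphere (\<sigma> * \<zeta>) = (rot_sphere (- (\<sigma> * \<zeta>)) :: (real \<times> (real^'n)) set)"
        by (auto simp: horizon_reflection_def rot_sphere_def image_iff)
    next
      fix s assume "rot_sphere s \<subseteq> M\<^sub>1 - closed_domain (- (\<sigma> * \<zeta>)) (\<sigma> * \<zeta>)"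
      then have s: "0 < \<sigma> * s" "\<zeta> < \<bar>s\<bar>"
        unfolding M U rot_sphere_subset_iff by auto
      obtain t C where t: "\<zeta> < \<bar>t\<bar>" "s * t < 0" "pot C s = 0" "pot C t = 0"
        using zeros[OF s(2)] by blast
      have "\<sigma> * t < 0" using \<sigma> s(1) t(2) by (auto simp: mult_less_0_iff)
      then have "rot_sphere t \<subseteq> M\<^sub>2 - closed_domain (- (\<sigma> * \<zeta>)) (\<sigma> * \<zeta>)"
        unfolding M U rot_sphere_subset_iff using t(1) by auto
      moreover have "s \<noteq> t" using t(2) by (auto simp: mult_less_0_iff)
      ultimately show "\<exists>t. rot_sphere t \<subseteq> M\<^sub>2 - closed_domain (- (\<sigma> * \<zeta>)) (\<sigma> * \<zeta>) \<and>
          critical_metric (closed_domain s t :: (real \<times> (real^'n)) set) (ads_atlas (closed_domain s t)) (ads_metric r)"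
        using domain t(3,4) by blast
    next
      \<comment> \<open>As \<open>pot 0\<close> is even, \<theta> and its mirror image serve on
        either side.\<close>
      have quot: "critical_metric (quotient_space t :: (real \<times> (real^'n)) set set) (quotient_atlas t) (quotient_metric t r)"
        if "t = \<sigma> * \<theta> \<or> t = - (\<sigma> * \<theta>)" for t
        using that \<sigma> \<zeta> \<theta> pot_even[of \<theta>] by (intro critical_metric_quotient[OF refl]) auto
      have "rot_sphere (\<sigma> * \<theta>) \<subseteq> M\<^sub>1 - closed_domain (- (\<sigma> * \<zeta>)) (\<sigma> * \<zeta>)"
        "rot_sphere (- (\<sigma> * \<theta>)) \<subseteq> M\<^sub>2 - closed_domain (- (\<sigma> * \<zeta>)) (\<sigma> * \<zeta>)"
        unfolding M U rot_sphere_subset_iff using \<sigma> \<zeta> by auto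
      then show "\<exists>t. rot_sphere t \<subseteq> M\<^sub>1 - closed_domain (- (\<sigma> * \<zeta>)) (\<sigma> * \<zeta>) \<and>
          critical_metric (quotient_space t :: (real \<times> (real^'n)) set set) (quotient_atlas t) (quotient_metric t r)"
        "\<exists>t. rot_sphere t \<subseteq> M\<^sub>2 - closed_domain (- (\<sigma> * \<zeta>)) (\<sigma> * \<zeta>) \<and>
          critical_metric (quotient_space t :: (real \<times> (real^'n)) set set) (quotient_atlas t) (quotient_metric t r)"
        using quot by blast+
    qed
  qed
  then show ?thesis
    using critical_on_ads_space[OF refl] by blast
qed

end
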